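(* Let $\mathcal{G}$ be an ultragraph and let $K$ be a field. Set $$X_1=\{I_{(H,B_H)} : H\subseteq\mathcal{G}^0 \text{ is a saturated hereditary subcollection and } \mathcal{G}^0\setminus H \text{ is downward directed}\}$$ and $$X_2=\{I_{(H,B_H\setminus\{w\})} : H\subseteq\mathcal{G}^0 \text{ is a saturated hereditary subcollection},\ w\in B_H \text{ and } A\geq \{w\} \text{ for all } A\in\mathcal{G}^0\setminus H\}.$$ Then $X_1\cup X_2$ is the set of all graded prime ideals of $L_K(\mathcal{G})$.
   Context: An ultragraph $\mathcal{G}=(G^0,\mathcal{G}^1,r_{\mathcal{G}},s_{\mathcal{G}})$ consists of a countable set of vertices $G^0$, a countable set of edges $\mathcal{G}^1$, a source map $s_{\mathcal{G}}:\mathcal{G}^1\to G^0$ and a range map $r_{\mathcal{G}}:\mathcal{G}^1\to\mathcal{P}(G^0)\setminus\{\emptyset\}$. An algebra in $\mathcal{P}(X)$ is a collection of subsets of $X$ closed under $\cup,\cap,\setminus$. $\mathcal{G}^0$ (not to be confused with $G^0$) is the smallest algebra in $\mathcal{P}(G^0)$ containing all $\{v\}$, $v\in G^0$, and all $r_{\mathcal{G}}(e)$, $e\in\mathcal{G}^1$. A path of positive length in $\mathcal{G}$ is a sequence of edges $\alpha=e_1\cdots e_n$ ($n\ge1$) with $s_{\mathcal{G}}(e_{i+1})\in r_{\mathcal{G}}(e_i)$ for $1\le i\le n-1$; $s_{\mathcal{G}}(\alpha)=s_{\mathcal{G}}(e_1)$, $r_{\mathcal{G}}(\alpha)=r_{\mathcal{G}}(e_n)$.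 A subcollection $H\subseteq\mathcal{G}^0$ (with $\emptyset\in H$) is hereditary if (1) $\{s_{\mathcal{G}}(e)\}\in H$ implies $r_{\mathcal{G}}(e)\in H$ for all $e\in\mathcal{G}^1$; (2) $A\cup B\in H$ for all $A,B\in H$; (3) $A\in H$, $B\in\mathcal{G}^0$, $B\subseteq A$ imply $B\in H$. It is saturated if, whenever $v\in G^0$ satisfies $0<|s_{\mathcal{G}}^{-1}(v)|<\infty$ and $r_{\mathcal{G}}(e)\in H$ for all $e\in s_{\mathcal{G}}^{-1}(v)$, then $\{v\}\in H$. For saturated hereditary $H$, the set of breaking vertices is $$B_H=\{v\in G^0: |s_{\mathcal{G}}^{-1}(v)|=\infty \text{ and } 0<|s_{\mathcal{G}}^{-1}(v)\cap\{e: r_{\mathcal{G}}(e)\notin H\}|<\infty\}.$$ An admissible pair is $(H,S)$ with $H$ saturated hereditary and $S\subseteq B_H$. The ultragraph Leavitt path algebra $L_K(\mathcal{G})$ is the universal $K$-algebra generated by elements $p_A$ ($A\in\mathcal{G}^0$), $s_e,s_{e^*}$ ($e\in\mathcal{G}^1$) subject to: (1) $p_\emptyset=0$, $p_Ap_B=p_{A\cap B}$, $p_{A\cup B}=p_A+p_B-p_{A\cap B}$; (2) $p_{s_{\mathcal{G}}(e)}s_e=s_ep_{r_{\mathcal{G}}(e)}=s_e$ and $p_{r_{\mathcal{G}}(e)}s_{e^*}=s_{e^*}p_{s_{\mathcal{G}}(e)}=s_{e^*}$; (3) $s_{e^*}s_f=\delta_{e,f}p_{r_{\mathcal{G}}(e)}$;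 (4) $p_v=\sum_{s_{\mathcal{G}}(e)=v}s_es_{e^*}$ whenever $0<|s_{\mathcal{G}}^{-1}(v)|<\infty$ (writing $p_v=p_{\{v\}}$). It is $\mathbb{Z}$-graded, with $p_A$, $s_e$, $s_{e^*}$ of degree $0,1,-1$; graded ideals refer to this grading. Ideals are two-sided. For an admissible pair $(H,S)$ and $w\in B_H$ put $p_w^H=p_w-\sum_{s_{\mathcal{G}}(e)=w,\ r_{\mathcal{G}}(e)\notin H}s_es_{e^*}$. $I_{(H,S)}$ is the ideal of $L_K(\mathcal{G})$ generated by $\{p_A:A\in H\}\cup\{p_w^H:w\in S\}$. For $A,B\in\mathcal{G}^0$ write $A\geq B$ if either $B\subseteq A$ or there is a path $\alpha$ of positive length with $s_{\mathcal{G}}(\alpha)\in A$ and $B\subseteq r_{\mathcal{G}}(\alpha)$. A nonempty subset $M\subseteq\mathcal{G}^0$ is downward directed if for all $A,B\in M$ there exists $\emptyset\ne C\in M$ with $A\geq C$ and $B\geq C$. *)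

theory Defs
  imports
    "HOL-Library.Countable_Set"
    "HOL-Library.Poly_Mapping"
    "HOL-Algebra.QuotRing"
begin

section \<open>Ultragraphs\<close>

record ('v, 'e) ultragraph =
  verts :: "'v set"
  edges :: "'e set"
  src :: "'e \<Rightarrow> 'v"
  rng :: "'e \<Rightarrow> 'v set"

locale ultragraph =
  fixes G :: "('v, 'e) ultragraph"
  assumes countable_verts: "countable (verts G)"
    and countable_edges: "countable (edges G)"
    and src_in_verts: "e \<in> edges G \<Longrightarrow> src G e \<in> verts G"
    and rng_subset_verts: "e \<in> edges G \<Longrightarrow> rng G e \<subseteq> verts G"
    and rng_nonempty: "e \<in> edges G \<Longrightarrow> rng G e \<noteq> {}"

definition emitted :: "('v, 'e) ultragraph \<Rightarrow> 'v \<Rightarrow> 'e set" where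
  "emitted G v = {e \<in> edges G. src G e = v}"

text \<open>The smallest algebra of subsets containing all singletons and all ranges, usually
  written \<open>\<G>\<^sup>0\<close>. The rule \<open>empty\<close> is redundant (\<open>A - A = {}\<close>) unless there are no vertices.\<close>

inductive_set gverts :: "('v, 'e) ultragraph \<Rightarrow> 'v set set" for G where
  empty: "{} \<in> gverts G"
| vertex: "v \<in> verts G \<Longrightarrow> {v} \<in> gverts G"
| range: "e \<in> edges G \<Longrightarrow> rng G e \<in> gverts G"
| union: "A \<in> gverts G \<Longrightarrow> B \<in> gverts G \<Longrightarrow> A \<union> B \<in> gverts G"
| inter: "A \<in> gverts G \<Longrightarrow> B \<in> gverts G \<Longrightarrow> A \<inter> B \<in> gverts G"
| diff: "A \<in> gverts G \<Longrightarrow> B \<in> gverts G \<Longrightarrow> A - B \<in> gverts G"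

definition is_path :: "('v, 'e) ultragraph \<Rightarrow> 'e list \<Rightarrow> bool" where
  "is_path G es \<longleftrightarrow>
     es \<noteq> [] \<and> set es \<subseteq> edges G \<and> successively (\<lambda>e f. src G f \<in> rng G e) es"

definition hereditary :: "('v, 'e) ultragraph \<Rightarrow> 'v set set \<Rightarrow> bool" where
  "hereditary G H \<longleftrightarrow>
     H \<subseteq> gverts G \<and> {} \<in> H \<and>
     (\<forall>e\<in>edges G. {src G e} \<in> H \<longrightarrow> rng G e \<in> H) \<and>
     (\<forall>A\<in>H. \<forall>B\<in>H. A \<union> B \<in> H) \<and>
     (\<forall>A\<in>H. \<forall>B\<in>gverts G. B \<subseteq> A \<longrightarrow> B \<in> H)"

definition saturated :: "('v, 'e) ultragraph \<Rightarrow> 'v set set \<Rightarrow> bool" where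
  "saturated G H \<longleftrightarrow>
     (\<forall>v\<in>verts G. emitted G v \<noteq> {} \<and> finite (emitted G v) \<and>
        (\<forall>e\<in>emitted G v. rng G e \<in> H) \<longrightarrow> {v} \<in> H)"

definition breaking :: "('v, 'e) ultragraph \<Rightarrow> 'v set set \<Rightarrow> 'v set" where
  "breaking G H =
     {v \<in> verts G. infinite (emitted G v) \<and>
        {e \<in> emitted G v. rng G e \<notin> H} \<noteq> {} \<and> finite {e \<in> emitted G v. rng G e \<notin> H}}"

definition reaches :: "('v, 'e) ultragraph \<Rightarrow> 'v set \<Rightarrow> 'v set \<Rightarrow> bool" where
  "reaches G A B \<longleftrightarrow>
     B \<subseteq> A \<or> (\<exists>es. is_path G es \<and> src G (hd es) \<in> A \<and> B \<subseteq> rng G (last es))"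

definition downward_directed :: "('v, 'e) ultragraph \<Rightarrow> 'v set set \<Rightarrow> bool" where
  "downward_directed G M \<longleftrightarrow>
     M \<noteq> {} \<and> M \<subseteq> gverts G \<and>
     (\<forall>A\<in>M. \<forall>B\<in>M. \<exists>C\<in>M. C \<noteq> {} \<and> reaches G A C \<and> reaches G B C)"


section \<open>Ideals of rings that need not have a unit\<close>

text \<open>Leavitt path algebras are in general not unital, so the locales \<open>ring\<close>, \<open>ideal\<close> and
  \<open>primeideal\<close> of HOL-Algebra do not apply. We use the record type for rings and ignore its
  field \<open>one\<close>, which may lie outside the carrier.\<close>

definition two_sided_ideal :: "('a, 'b) ring_scheme \<Rightarrow> 'a set \<Rightarrow> bool" where
  "two_sided_ideal R I \<longleftrightarrow>
     additive_subgroup I R \<and>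
     (\<forall>a\<in>I. \<forall>x\<in>carrier R. x \<otimes>\<^bsub>R\<^esub> a \<in> I \<and> a \<otimes>\<^bsub>R\<^esub> x \<in> I)"

definition generated_ideal :: "('a, 'b) ring_scheme \<Rightarrow> 'a set \<Rightarrow> 'a set" where
  "generated_ideal R X = \<Inter>{I. two_sided_ideal R I \<and> X \<subseteq> I}"

text \<open>The condition \<open>I J \<subseteq> P\<close> only has to be tested on products \<open>a b\<close>, since \<open>P\<close> is closed
  under sums.\<close>

definition prime_two_sided_ideal :: "('a, 'b) ring_scheme \<Rightarrow> 'a set \<Rightarrow> bool" where
  "prime_two_sided_ideal R P \<longleftrightarrow>
     two_sided_ideal R P \<and> P \<noteq> carrier R \<and>
     (\<forall>I J. two_sided_ideal R I \<and> two_sided_ideal R J \<and>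
        (\<forall>a\<in>I. \<forall>b\<in>J. a \<otimes>\<^bsub>R\<^esub> b \<in> P) \<longrightarrow> I \<subseteq> P \<or> J \<subseteq> P)"


section \<open>Free associative algebras\<close>

datatype 'g word = Word (letters: "'g list")

instantiation word :: (type) monoid_add
begin

definition zero_word :: "'g word" where
  "zero_word = Word []"

definition plus_word :: "'g word \<Rightarrow> 'g word \<Rightarrow> 'g word" where
  "plus_word u v = Word (letters u @ letters v)"

instance
proof
  fix u v w :: "'g word"
  show "u + v + w = u + (v + w)" by (simp add: plus_word_def)
  show "0 + u = u" by (simp add: plus_word_def zero_word_def)
  show "u + 0 = u" by (simp add: plus_word_def zero_word_def)
qed

end

text \<open>The ring \<open>'g word \<Rightarrow>\<^sub>0 'k\<close> is the free unital algebra on the type \<open>'g\<close>; multiplication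
  convolves along concatenation, and \<open>single 0 c\<close> is the scalar \<open>c\<close>. Polynomials in letters from
  \<open>X\<close> without constant term form the free non-unital algebra on \<open>X\<close>.\<close>

definition free_algebra :: "'g set \<Rightarrow> ('g word \<Rightarrow>\<^sub>0 'k::field) ring" where
  "free_algebra X =
     \<lparr>carrier = {f. \<forall>w\<in>Poly_Mapping.keys f. letters w \<noteq> [] \<and> set (letters w) \<subseteq> X},
      monoid.mult = (*), one = 1, zero = 0, add = (+)\<rparr>"

inductive_set algebra_ideal ::
  "'g set \<Rightarrow> ('g word \<Rightarrow>\<^sub>0 'k::field) set \<Rightarrow> ('g word \<Rightarrow>\<^sub>0 'k) set" for X Rel where
  zero: "0 \<in> algebra_ideal X Rel"
| rel: "a \<in> Rel \<Longrightarrow> a \<in> algebra_ideal X Rel"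
| add: "a \<in> algebra_ideal X Rel \<Longrightarrow> b \<in> algebra_ideal X Rel \<Longrightarrow> a + b \<in> algebra_ideal X Rel"
| scale: "a \<in> algebra_ideal X Rel \<Longrightarrow> Poly_Mapping.single 0 c * a \<in> algebra_ideal X Rel"
| left: "a \<in> algebra_ideal X Rel \<Longrightarrow> x \<in> carrier (free_algebra X) \<Longrightarrow>
    x * a \<in> algebra_ideal X Rel"
| right: "a \<in> algebra_ideal X Rel \<Longrightarrow> x \<in> carrier (free_algebra X) \<Longrightarrow>
    a * x \<in> algebra_ideal X Rel"


section \<open>Ultragraph Leavitt path algebras\<close>

datatype ('v, 'e) gen = GenP "'v set" | GenS 'e | GenStar 'e

type_synonym ('v, 'e, 'k) gen_poly = "('v, 'e) gen word \<Rightarrow>\<^sub>0 'k"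

definition gens :: "('v, 'e) ultragraph \<Rightarrow> ('v, 'e) gen set" where
  "gens G = GenP ` gverts G \<union> GenS ` edges G \<union> GenStar ` edges G"

definition xp :: "'v set \<Rightarrow> ('v, 'e, 'k::field) gen_poly" where
  "xp A = Poly_Mapping.single (Word [GenP A]) 1"

definition xs :: "'e \<Rightarrow> ('v, 'e, 'k::field) gen_poly" where
  "xs e = Poly_Mapping.single (Word [GenS e]) 1"

definition xstar :: "'e \<Rightarrow> ('v, 'e, 'k::field) gen_poly" where
  "xstar e = Poly_Mapping.single (Word [GenStar e]) 1"

text \<open>A relation \<open>a = b\<close> is represented by the polynomial \<open>a - b\<close>.\<close>

definition lpa_relators :: "('v, 'e) ultragraph \<Rightarrow> ('v, 'e, 'k::field) gen_poly set" where
  "lpa_relators G =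
     {xp {}} \<union>
     {xp A * xp B - xp (A \<inter> B) | A B. A \<in> gverts G \<and> B \<in> gverts G} \<union>
     {xp (A \<union> B) - (xp A + xp B - xp (A \<inter> B)) | A B. A \<in> gverts G \<and> B \<in> gverts G} \<union>
     {xp {src G e} * xs e - xs e | e. e \<in> edges G} \<union>
     {xs e * xp (rng G e) - xs e | e. e \<in> edges G} \<union>
     {xp (rng G e) * xstar e - xstar e | e. e \<in> edges G} \<union>
     {xstar e * xp {src G e} - xstar e | e. e \<in> edges G} \<union>
     {xstar e * xs f - (if e = f then xp (rng G e) else 0) | e f. e \<in> edges G \<and> f \<in> edges G} \<union>
     {xp {v} - (\<Sum>e\<in>emitted G v. xs e * xstar e) | v.
        v \<in> verts G \<and> emitted G v \<noteq> {} \<and> finite (emitted G v)}"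

definition lpa_rel_ideal :: "('v, 'e) ultragraph \<Rightarrow> ('v, 'e, 'k::field) gen_poly set" where
  "lpa_rel_ideal G = algebra_ideal (gens G) (lpa_relators G)"

text \<open>The elements of the algebra are cosets of the ideal of relations.\<close>

type_synonym ('v, 'e, 'k) lpa_elem = "('v, 'e, 'k) gen_poly set"

definition lpa :: "('v, 'e) ultragraph \<Rightarrow> ('v, 'e, 'k::field) lpa_elem ring" where
  "lpa G = free_algebra (gens G) Quot lpa_rel_ideal G"

definition lpa_class ::
  "('v, 'e) ultragraph \<Rightarrow> ('v, 'e, 'k::field) gen_poly \<Rightarrow> ('v, 'e, 'k) lpa_elem" where
  "lpa_class G x = lpa_rel_ideal G +>\<^bsub>free_algebra (gens G)\<^esub> x"

fun gen_degree :: "('v, 'e) gen \<Rightarrow> int" where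
  "gen_degree (GenP A) = 0"
| "gen_degree (GenS e) = 1"
| "gen_degree (GenStar e) = - 1"

definition word_degree :: "('v, 'e) gen word \<Rightarrow> int" where
  "word_degree w = sum_list (map gen_degree (letters w))"

definition lpa_component ::
  "('v, 'e) ultragraph \<Rightarrow> int \<Rightarrow> ('v, 'e, 'k::field) lpa_elem set" where
  "lpa_component G n =
     {lpa_class G x | x. x \<in> carrier (free_algebra (gens G)) \<and> (\<forall>w\<in>Poly_Mapping.keys x. word_degree w = n)}"

definition lpa_graded_ideal ::
  "('v, 'e) ultragraph \<Rightarrow> ('v, 'e, 'k::field) lpa_elem set \<Rightarrow> bool" where
  "lpa_graded_ideal G I \<longleftrightarrow>
     two_sided_ideal (lpa G) I \<and>
     (\<forall>x\<in>I. \<exists>N y. finite N \<and> (\<forall>n\<in>N. y n \<in> I \<inter> lpa_component G n) \<and>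
        x = (\<Oplus>\<^bsub>lpa G\<^esub>n\<in>N. y n))"

text \<open>Meaningful for breaking vertices \<open>w\<close>, for which the sum is finite.\<close>

definition breaking_gen ::
  "('v, 'e) ultragraph \<Rightarrow> 'v set set \<Rightarrow> 'v \<Rightarrow> ('v, 'e, 'k::field) gen_poly" where
  "breaking_gen G H w = xp {w} - (\<Sum>e | e \<in> emitted G w \<and> rng G e \<notin> H. xs e * xstar e)"

definition ideal_of_pair ::
  "('v, 'e) ultragraph \<Rightarrow> 'v set set \<Rightarrow> 'v set \<Rightarrow> ('v, 'e, 'k::field) lpa_elem set" where
  "ideal_of_pair G H S =
     generated_ideal (lpa G)
       ((\<lambda>A. lpa_class G (xp A)) ` H \<union> (\<lambda>w. lpa_class G (breaking_gen G H w)) ` S)"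

end

theory Submission
  imports Defs
begin

text \<open>
  Write \<open>L\<close> for the path algebra. The first half of the proof shows that every graded ideal \<open>I\<close> of \<open>L\<close> is
  \<open>I\<^bsub>(H,S)\<^esub>\<close> for \<open>H = {A. p\<^sub>A \<in> I}\<close> and \<open>S = {w \<in> B\<^sub>H. p\<^sub>w\<^sup>H \<in> I}\<close> (\<open>graded_ideal_eq_pair_ideal\<close>). It does not
  pass to a quotient ultragraph. Let \<open>x \<in> I\<close> be homogeneous. Multiplication by elements \<open>s\<^sub>e\<^sup>*\<close> on the left
  or \<open>s\<^sub>e\<close> on the right reduces to degree \<open>0\<close>. In degree \<open>0\<close> the elements \<open>s\<^sub>e\<^sup>* x s\<^sub>f\<close> involve shorter paths
  than \<open>x\<close>, so by induction \<open>q x q\<close> lies in \<open>I\<^bsub>(H,S)\<^esub>\<close> for every finite sum \<open>q = \<Sum> s\<^sub>e s\<^sub>e\<^sup>*\<close>. For large \<open>q\<close>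
  the difference \<open>x - q x q\<close> is a linear combination of elements \<open>p\<^sub>A (1 - q)\<close>, which may be examined at one
  vertex at a time; there the definition of breaking vertices enters (\<open>vertex_gap\<close>).

  Suppose that moreover \<open>I\<close> is prime. If \<open>A\<close> and \<open>B\<close> are not in \<open>H\<close>, then \<open>p\<^sub>A L p\<^sub>B\<close> is not contained in \<open>I\<close>, so
  some \<open>p\<^sub>A s\<^sub>\<alpha> p\<^sub>D s\<^sub>\<beta>\<^sup>* p\<^sub>B\<close> is not in \<open>I\<close>, and the ranges of \<open>\<alpha>\<close> and \<open>\<beta>\<close> show that \<open>A\<close> and \<open>B\<close> have a common
  descendant outside \<open>H\<close> (\<open>prime_downward_directed\<close>). With \<open>p\<^sub>w\<^sup>H\<close> in place of \<open>p\<^sub>B\<close>, where \<open>w \<in> B\<^sub>H - S\<close>, only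
  the elements with empty \<open>\<beta>\<close> and \<open>w \<in> D\<close> survive, whence \<open>A \<ge> {w}\<close>; with \<open>p\<^sub>v\<^sup>H\<close> and \<open>p\<^sub>w\<^sup>H\<close> one gets \<open>v = w\<close>. So
  \<open>S\<close> is \<open>B\<^sub>H\<close> or \<open>B\<^sub>H - {w}\<close> (\<open>graded_prime_cases\<close>).

  For the converse, comparing leading homogeneous components shows that primeness of a graded ideal need
  only be tested on homogeneous elements (\<open>graded_prime_criterion\<close>), hence on two larger graded ideals. By
  the first half each of these contains some \<open>p\<^sub>A\<close> with \<open>A \<notin> H\<close> or some \<open>p\<^sub>w\<^sup>H\<close> with \<open>w \<in> B\<^sub>H - S\<close>
  (\<open>larger_graded_ideal\<close>), and the condition on \<open>H\<close> provides an idempotent that lies in both of them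
  but, by \<open>pair_ideal_faithful\<close>, not in \<open>I\<^bsub>(H,S)\<^esub>\<close>. The latter fact is proved by a representation of \<open>L\<close> on
  functions on a countable set, in which every \<open>A \<notin> H\<close> acts as the restriction to a countably infinite
  subset; all countably infinite sets being in bijection, the edges can be accommodated freely.
\<close>


section \<open>Polynomials in words\<close>

text \<open>The part of a polynomial that is supported on the words satisfying \<open>Q\<close>.\<close>

definition part :: "('a \<Rightarrow> bool) \<Rightarrow> ('a \<Rightarrow>\<^sub>0 'k::field) \<Rightarrow> ('a \<Rightarrow>\<^sub>0 'k)" where
  "part Q f = Abs_poly_mapping (\<lambda>w. if Q w then Poly_Mapping.lookup f w else 0)"

lemma lookup_part: "Poly_Mapping.lookup (part Q f) w = (if Q w then Poly_Mapping.lookup f w else 0)"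
proof -
  have "finite {w. (if Q w then Poly_Mapping.lookup f w else 0) \<noteq> 0}"
    by (rule finite_subset[OF _ finite_lookup[of f]]) auto
  then show ?thesis by (simp add: part_def)
qed

lemma part_zero [simp]: "part Q 0 = 0"
  by (rule poly_mapping_eqI) (simp add: lookup_part)

lemma part_add [simp]: "part Q (a + b) = part Q a + part Q b"
  by (rule poly_mapping_eqI) (simp add: lookup_part lookup_add)

lemma part_diff [simp]: "part Q (a - b) = part Q a - part Q b"
  by (rule poly_mapping_eqI) (simp add: lookup_part lookup_minus)

lemma part_sum: "part Q (sum f A) = (\<Sum>i\<in>A. part Q (f i))"
  by (rule poly_mapping_eqI) (simp add: lookup_part lookup_sum)

lemma part_single:
  "part Q (Poly_Mapping.single w c) = (if Q w then Poly_Mapping.single w c else 0)"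
  by (rule poly_mapping_eqI) (simp add: lookup_part lookup_single when_def)

lemma keys_part: "Poly_Mapping.keys (part Q f) = {w \<in> Poly_Mapping.keys f. Q w}"
  by (auto simp: in_keys_iff lookup_part split: if_splits)

lemma part_id: "(\<And>w. w \<in> Poly_Mapping.keys f \<Longrightarrow> Q w) \<Longrightarrow> part Q f = f"
  by (rule poly_mapping_eqI) (auto simp: lookup_part in_keys_iff)

lemma part_none: "(\<And>w. w \<in> Poly_Mapping.keys f \<Longrightarrow> \<not> Q w) \<Longrightarrow> part Q f = 0"
  by (rule poly_mapping_eqI) (auto simp: lookup_part in_keys_iff)

lemma keys_part_imp: "part Q f = f \<Longrightarrow> w \<in> Poly_Mapping.keys f \<Longrightarrow> Q w"
  by (metis (mono_tags, lifting) keys_part mem_Collect_eq)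

lemma sum_singles:
  fixes f :: "'a \<Rightarrow>\<^sub>0 'k::field"
  assumes "finite S" "Poly_Mapping.keys f \<subseteq> S"
  shows "f = (\<Sum>w\<in>S. Poly_Mapping.single w (Poly_Mapping.lookup f w))"
proof (rule poly_mapping_eqI)
  fix v
  have "(\<Sum>w\<in>S. Poly_Mapping.lookup f w when w = v)
      = (\<Sum>w\<in>S. if v = w then Poly_Mapping.lookup f v else 0)"
    by (rule sum.cong) (auto simp: when_def)
  also have "\<dots> = Poly_Mapping.lookup f v"
    using assms by (auto simp: in_keys_iff)
  finally show "Poly_Mapping.lookup f v =
      Poly_Mapping.lookup (\<Sum>w\<in>S. Poly_Mapping.single w (Poly_Mapping.lookup f w)) v"
    by (simp add: lookup_sum lookup_single)
qed

lemma poly_induct_keys [consumes 1, case_names zero single add]: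
  fixes f :: "'a \<Rightarrow>\<^sub>0 'k::field"
  assumes "\<forall>w\<in>Poly_Mapping.keys f. Q w"
    and "P 0" and "\<And>w c. Q w \<Longrightarrow> P (Poly_Mapping.single w c)"
    and "\<And>a b. P a \<Longrightarrow> P b \<Longrightarrow> P (a + b)"
  shows "P f"
proof -
  have "P (\<Sum>w\<in>S. Poly_Mapping.single w (Poly_Mapping.lookup f w))"
    if "finite S" "\<And>w. w \<in> S \<Longrightarrow> Q w" for S
    using that by (induction S rule: finite_induct) (auto intro: assms)
  from this[of "Poly_Mapping.keys f"] show ?thesis
    using sum_singles[of "Poly_Mapping.keys f" f] assms(1) by auto
qed

lemma poly_induct [case_names zero single add]:
  fixes f :: "'a \<Rightarrow>\<^sub>0 'k::field"
  assumes "P 0" and "\<And>w c. P (Poly_Mapping.single w c)" and "\<And>a b. P a \<Longrightarrow> P b \<Longrightarrow> P (a + b)"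
  shows "P f"
  using assms by (rule poly_induct_keys[where Q = "\<lambda>_. True", rotated]) auto

text \<open>A property of words that is compatible with concatenation cuts out a retract.\<close>

lemma part_mult:
  fixes a b :: "'a::monoid_add \<Rightarrow>\<^sub>0 'k::field"
  assumes "\<And>u v. Q (u + v) \<longleftrightarrow> Q u \<and> Q v"
  shows "part Q (a * b) = part Q a * part Q b"
proof (induction a rule: poly_induct)
  case (single u c)
  show ?case
    by (induction b rule: poly_induct) (auto simp: part_single mult_single assms algebra_simps)
qed (auto simp: algebra_simps)

lemma scalar_commute:
  fixes x :: "'a::monoid_add \<Rightarrow>\<^sub>0 'k::field"
  shows "Poly_Mapping.single 0 c * x = x * Poly_Mapping.single 0 c"
  by (induction x rule: poly_induct) (auto simp: mult_single algebra_simps)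

lemma lookup_mult_zero_word:
  fixes x y :: "'g word \<Rightarrow>\<^sub>0 'k::field"
  shows "Poly_Mapping.lookup (x * y) 0 = Poly_Mapping.lookup x 0 * Poly_Mapping.lookup y 0"
proof (induction x rule: poly_induct)
  case (single u c)
  have "u + v = 0 \<longleftrightarrow> u = 0 \<and> v = 0" for v
    by (cases u; cases v) (auto simp: plus_word_def zero_word_def)
  then show ?case
    by (induction y rule: poly_induct)
      (auto simp: mult_single lookup_single when_def lookup_add algebra_simps)
qed (auto simp: lookup_add algebra_simps)


subsection \<open>Two-sided ideals of a unital ring\<close>

text \<open>The free algebra on all letters of a type is a unital ring in the sense of type classes, which
  gives access to its simplification rules.\<close>

definition ring_ideal :: "'a::ring_1 set \<Rightarrow> bool" where
  "ring_ideal I \<longleftrightarrow> 0 \<in> I \<and> (\<forall>a\<in>I. \<forall>b\<in>I. a + b \<in> I) \<and> (\<forall>a\<in>I. \<forall>x. x * a \<in> I \<and> a * x \<in> I)"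

lemma ring_ideal_zero: "ring_ideal I \<Longrightarrow> 0 \<in> I"
  and ring_ideal_add: "ring_ideal I \<Longrightarrow> a \<in> I \<Longrightarrow> b \<in> I \<Longrightarrow> a + b \<in> I"
  and ring_ideal_left: "ring_ideal I \<Longrightarrow> a \<in> I \<Longrightarrow> x * a \<in> I"
  and ring_ideal_right: "ring_ideal I \<Longrightarrow> a \<in> I \<Longrightarrow> a * x \<in> I"
  by (auto simp: ring_ideal_def)

lemma ring_ideal_uminus: "ring_ideal I \<Longrightarrow> a \<in> I \<Longrightarrow> - a \<in> I"
  using ring_ideal_left[of I a "-1"] by simp

lemma ring_ideal_diff: "ring_ideal I \<Longrightarrow> a \<in> I \<Longrightarrow> b \<in> I \<Longrightarrow> a - b \<in> I"
  using ring_ideal_add[of I a "- b"] ring_ideal_uminus[of I b] by simp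

lemma ring_ideal_sum: "ring_ideal I \<Longrightarrow> (\<And>i. i \<in> A \<Longrightarrow> f i \<in> I) \<Longrightarrow> sum f A \<in> I"
  by (induction A rule: infinite_finite_induct) (auto intro: ring_ideal_zero ring_ideal_add)

text \<open>For polynomials, closure under multiplication by terms suffices.\<close>

lemma ring_idealI_poly:
  fixes I :: "('a::monoid_add \<Rightarrow>\<^sub>0 'k::field) set"
  assumes "0 \<in> I" "\<And>a b. a \<in> I \<Longrightarrow> b \<in> I \<Longrightarrow> a + b \<in> I"
    and "\<And>a w c. a \<in> I \<Longrightarrow> Poly_Mapping.single w c * a \<in> I"
    and "\<And>a w c. a \<in> I \<Longrightarrow> a * Poly_Mapping.single w c \<in> I"
  shows "ring_ideal I"
proof -
  have "x * a \<in> I \<and> a * x \<in> I" if "a \<in> I" for a x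
    by (induction x rule: poly_induct) (auto simp: assms that algebra_simps)
  then show ?thesis using assms by (auto simp: ring_ideal_def)
qed


section \<open>Ideals of the path algebra as ideals of a free algebra\<close>

text \<open>The polynomials without constant term.\<close>

definition aug :: "('g word \<Rightarrow>\<^sub>0 'k::field) set" where
  "aug = {x. Poly_Mapping.lookup x 0 = 0}"

lemma ring_ideal_aug: "ring_ideal aug"
  by (simp add: ring_ideal_def aug_def lookup_add lookup_mult_zero_word)

lemma letters_plus [simp]: "letters (u + v) = letters u @ letters v"
  by (simp add: plus_word_def)

lemma letters_zero [simp]: "letters 0 = []"
  by (simp add: zero_word_def)

lemma letters_eq_Nil [simp]: "letters w = [] \<longleftrightarrow> w = 0"
  by (cases w) (simp add: zero_word_def)

text \<open>The words in the generators of the path algebra.\<close>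

definition gen_word :: "('v, 'e) ultragraph \<Rightarrow> ('v, 'e) gen word \<Rightarrow> bool" where
  "gen_word G w \<longleftrightarrow> set (letters w) \<subseteq> gens G"

lemma gen_word_plus [simp]: "gen_word G (u + v) \<longleftrightarrow> gen_word G u \<and> gen_word G v"
  by (auto simp: gen_word_def)

lemma gen_word_zero [simp]: "gen_word G 0"
  by (simp add: gen_word_def)

abbreviation letter :: "'g \<Rightarrow> 'g word \<Rightarrow>\<^sub>0 'k::field" where
  "letter g \<equiv> Poly_Mapping.single (Word [g]) 1"

text \<open>The free algebra on all letters of the type is easier to work with than the free algebra on
  the generators. Ideals of the path algebra are encoded as two-sided ideals of the former that
  contain the relators and the superfluous letters and consist of polynomials without constant
  term.\<close>

definition lpa_ideal :: "('v, 'e) ultragraph \<Rightarrow> ('v, 'e, 'k::field) gen_poly set \<Rightarrow> bool" where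
  "lpa_ideal G I \<longleftrightarrow> ring_ideal I \<and> lpa_relators G \<subseteq> I \<and> (\<forall>g. g \<notin> gens G \<longrightarrow> letter g \<in> I) \<and> I \<subseteq> aug"

text \<open>The smallest such ideal containing \<open>Y\<close>. It consists of polynomials without constant term only
  if \<open>Y\<close> does.\<close>

definition lpa_gen ::
  "('v, 'e) ultragraph \<Rightarrow> ('v, 'e, 'k::field) gen_poly set \<Rightarrow> ('v, 'e, 'k) gen_poly set" where
  "lpa_gen G Y = \<Inter>{I. lpa_ideal G I \<and> Y \<subseteq> I}"

text \<open>Equality in the path algebra: \<open>lpa_gen G {}\<close> is the ideal of relations.\<close>

definition lpa_eq ::
  "('v, 'e) ultragraph \<Rightarrow> ('v, 'e, 'k::field) gen_poly \<Rightarrow> ('v, 'e, 'k) gen_poly \<Rightarrow> bool" where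
  "lpa_eq G a b \<longleftrightarrow> a - b \<in> lpa_gen G {}"

lemma lpa_ideal_ring: "lpa_ideal G I \<Longrightarrow> ring_ideal I"
  by (simp add: lpa_ideal_def)

lemmas lpa_ideal_zero = ring_ideal_zero[OF lpa_ideal_ring]
  and lpa_ideal_add = ring_ideal_add[OF lpa_ideal_ring]
  and lpa_ideal_diff = ring_ideal_diff[OF lpa_ideal_ring]
  and lpa_ideal_uminus = ring_ideal_uminus[OF lpa_ideal_ring]
  and lpa_ideal_left = ring_ideal_left[OF lpa_ideal_ring]
  and lpa_ideal_right = ring_ideal_right[OF lpa_ideal_ring]
  and lpa_ideal_sum = ring_ideal_sum[OF lpa_ideal_ring]

lemma aug_simps [simp]:
  "xp A \<in> aug" "xs e \<in> aug" "xstar e \<in> aug" "0 \<in> aug"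
  "letter g \<in> aug"
  by (auto simp: aug_def xp_def xs_def xstar_def lookup_single zero_word_def when_def)

lemma aug_add [simp]: "a \<in> aug \<Longrightarrow> b \<in> aug \<Longrightarrow> a + b \<in> aug"
  and aug_diff [simp]: "a \<in> aug \<Longrightarrow> b \<in> aug \<Longrightarrow> a - b \<in> aug"
  and aug_left [simp]: "a \<in> aug \<Longrightarrow> x * a \<in> aug"
  and aug_right [simp]: "a \<in> aug \<Longrightarrow> a * x \<in> aug"
  and aug_sum [simp]: "(\<And>i. i \<in> A \<Longrightarrow> f i \<in> aug) \<Longrightarrow> sum f A \<in> aug"
  using ring_ideal_aug
  by (auto intro: ring_ideal_add ring_ideal_diff ring_ideal_left ring_ideal_right ring_ideal_sum)

lemma lpa_relators_aug: "lpa_relators G \<subseteq> aug"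
  by (auto simp: lpa_relators_def intro!: aug_diff aug_sum)

lemma lpa_ideal_aug: "lpa_ideal G aug"
  using ring_ideal_aug lpa_relators_aug by (auto simp: lpa_ideal_def)

lemma lpa_ideal_subset_aug: "lpa_ideal G I \<Longrightarrow> I \<subseteq> aug"
  by (simp add: lpa_ideal_def)

lemma lpa_gen_ideal:
  assumes "Y \<subseteq> aug"
  shows "lpa_ideal G (lpa_gen G Y)"
proof -
  have "lpa_gen G Y \<subseteq> aug"
    using assms lpa_ideal_aug unfolding lpa_gen_def by blast
  then show ?thesis
    unfolding lpa_ideal_def lpa_gen_def ring_ideal_def by blast
qed

lemma lpa_gen_superset: "Y \<subseteq> lpa_gen G Y"
  by (auto simp: lpa_gen_def)

lemma lpa_gen_least: "lpa_ideal G I \<Longrightarrow> Y \<subseteq> I \<Longrightarrow> lpa_gen G Y \<subseteq> I"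
  by (auto simp: lpa_gen_def)

lemma lpa_ideal_rel: "lpa_ideal G (lpa_gen G {})"
  by (simp add: lpa_gen_ideal)

lemma lpa_eq_refl [simp, intro]: "lpa_eq G a a"
  by (simp add: lpa_eq_def lpa_ideal_zero[OF lpa_ideal_rel])

lemma lpa_eq_sym: "lpa_eq G a b \<Longrightarrow> lpa_eq G b a"
  using lpa_ideal_uminus[OF lpa_ideal_rel, of "a - b" G] by (simp add: lpa_eq_def)

lemma lpa_eq_trans [trans]: "lpa_eq G a b \<Longrightarrow> lpa_eq G b c \<Longrightarrow> lpa_eq G a c"
  using lpa_ideal_add[OF lpa_ideal_rel, of "a - b" G "b - c"] by (simp add: lpa_eq_def)

lemma lpa_eq_add: "lpa_eq G a b \<Longrightarrow> lpa_eq G c d \<Longrightarrow> lpa_eq G (a + c) (b + d)"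
  using lpa_ideal_add[OF lpa_ideal_rel, of "a - b" G "c - d"] by (simp add: lpa_eq_def algebra_simps)

lemma lpa_eq_diff: "lpa_eq G a b \<Longrightarrow> lpa_eq G c d \<Longrightarrow> lpa_eq G (a - c) (b - d)"
  using lpa_ideal_diff[OF lpa_ideal_rel, of "a - b" G "c - d"] by (simp add: lpa_eq_def algebra_simps)

lemma lpa_eq_left: "lpa_eq G a b \<Longrightarrow> lpa_eq G (x * a) (x * b)"
  using lpa_ideal_left[OF lpa_ideal_rel, of "a - b" G x] by (simp add: lpa_eq_def algebra_simps)

lemma lpa_eq_right: "lpa_eq G a b \<Longrightarrow> lpa_eq G (a * x) (b * x)"
  using lpa_ideal_right[OF lpa_ideal_rel, of "a - b" G x] by (simp add: lpa_eq_def algebra_simps)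

lemma lpa_eq_mult: "lpa_eq G a b \<Longrightarrow> lpa_eq G c d \<Longrightarrow> lpa_eq G (a * c) (b * d)"
  by (meson lpa_eq_left lpa_eq_right lpa_eq_trans)

lemma lpa_eq_sum: "(\<And>i. i \<in> A \<Longrightarrow> lpa_eq G (f i) (g i)) \<Longrightarrow> lpa_eq G (sum f A) (sum g A)"
  by (induction A rule: infinite_finite_induct) (auto intro: lpa_eq_add)

lemma lpa_eq_ideal: "lpa_eq G a b \<Longrightarrow> lpa_ideal G I \<Longrightarrow> a \<in> I \<longleftrightarrow> b \<in> I"
proof -
  assume *: "lpa_eq G a b" "lpa_ideal G I"
  then have "a - b \<in> I"
    using lpa_gen_least[of G I "{}"] by (auto simp: lpa_eq_def)
  then show ?thesis
    using lpa_ideal_add[OF *(2), of "a - b" b] lpa_ideal_diff[OF *(2), of a "a - b"] by auto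
qed

lemma lpa_eq_relator: "a - b \<in> lpa_relators G \<Longrightarrow> lpa_eq G a b"
  using lpa_ideal_rel by (auto simp: lpa_eq_def lpa_ideal_def)


subsection \<open>The anti-involution\<close>

text \<open>Reversing words and exchanging \<open>s\<^sub>e\<close> with \<open>s\<^sub>e\<^sup>*\<close> preserves the relations, so that every statement
  about left multiplication has a mirror image.\<close>

fun flip_gen :: "('v, 'e) gen \<Rightarrow> ('v, 'e) gen" where
  "flip_gen (GenP A) = GenP A"
| "flip_gen (GenS e) = GenStar e"
| "flip_gen (GenStar e) = GenS e"

definition flip_word :: "('v, 'e) gen word \<Rightarrow> ('v, 'e) gen word" where
  "flip_word w = Word (rev (map flip_gen (letters w)))"

definition flip :: "('v, 'e, 'k::field) gen_poly \<Rightarrow> ('v, 'e, 'k) gen_poly" where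
  "flip f = Poly_Mapping.map_key flip_word f"

lemma flip_gen_flip_gen [simp]: "flip_gen (flip_gen g) = g"
  by (cases g) auto

lemma flip_word_flip_word [simp]: "flip_word (flip_word w) = w"
  by (cases w) (simp add: flip_word_def rev_map comp_def)

lemma flip_word_plus [simp]: "flip_word (u + v) = flip_word v + flip_word u"
  by (simp add: flip_word_def plus_word_def)

lemma inj_flip_word: "inj flip_word"
  by (metis flip_word_flip_word injI)

lemma flip_zero [simp]: "flip 0 = 0"
  and flip_add [simp]: "flip (a + b) = flip a + flip b"
  by (simp_all add: flip_def map_key_zero[OF inj_flip_word] map_key_plus[OF inj_flip_word])

lemma flip_diff [simp]: "flip (a - b) = flip a - flip b"
  by (metis add_diff_cancel diff_add_cancel flip_add)

lemma flip_single [simp]: "flip (Poly_Mapping.single w c) = Poly_Mapping.single (flip_word w) c"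
  using map_key_single[OF inj_flip_word, of "flip_word w" c] by (simp add: flip_def)

lemma flip_mult [simp]: "flip (a * b) = flip b * flip a"
proof (induction a rule: poly_induct)
  case (single u c)
  show ?case by (induction b rule: poly_induct) (simp_all add: mult_single algebra_simps)
qed (simp_all add: algebra_simps)

lemma flip_flip [simp]: "flip (flip a) = a"
  by (induction a rule: poly_induct) simp_all

lemma flip_sum: "flip (sum f A) = (\<Sum>i\<in>A. flip (f i))"
  by (induction A rule: infinite_finite_induct) simp_all

lemma flip_one [simp]: "flip 1 = 1"
  by (metis flip_flip flip_mult mult_1 mult_1_right)

lemma flip_generators [simp]: "flip (xp A) = xp A" "flip (xs e) = xstar e" "flip (xstar e) = xs e"
  by (simp_all add: xp_def xs_def xstar_def flip_word_def)

lemma flip_aug: "x \<in> aug \<Longrightarrow> flip x \<in> aug"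
  by (simp add: aug_def flip_def map_key.rep_eq inj_flip_word flip_word_def zero_word_def)

lemma lpa_relators_cases:
  assumes "r \<in> lpa_relators G"
  obtains "r = xp {}"
    | A B where "r = xp A * xp B - xp (A \<inter> B)" "A \<in> gverts G" "B \<in> gverts G"
    | A B where "r = xp (A \<union> B) - (xp A + xp B - xp (A \<inter> B))" "A \<in> gverts G" "B \<in> gverts G"
    | e where "r = xp {src G e} * xs e - xs e" "e \<in> edges G"
    | e where "r = xs e * xp (rng G e) - xs e" "e \<in> edges G"
    | e where "r = xp (rng G e) * xstar e - xstar e" "e \<in> edges G"
    | e where "r = xstar e * xp {src G e} - xstar e" "e \<in> edges G"
    | e f where "r = xstar e * xs f - (if e = f then xp (rng G e) else 0)" "e \<in> edges G" "f \<in> edges G"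
    | v where "r = xp {v} - (\<Sum>e\<in>emitted G v. xs e * xstar e)" "v \<in> verts G" "emitted G v \<noteq> {}"
        "finite (emitted G v)"
  using assms unfolding lpa_relators_def by blast

lemma flip_relator:
  assumes "r \<in> lpa_relators G"
  shows "flip r \<in> lpa_relators G"
  using assms
proof (cases rule: lpa_relators_cases)
  case 1
  then show ?thesis using assms by simp
next
  case (2 A B)
  then have "flip r = xp B * xp A - xp (B \<inter> A)" by (simp add: Int_commute)
  then show ?thesis using 2 unfolding lpa_relators_def by blast
next
  case (3 A B)
  then have "flip r = r" by simp
  then show ?thesis using assms by simp
next
  case (4 e)
  then have "flip r = xstar e * xp {src G e} - xstar e" by simp
  then show ?thesis using 4 unfolding lpa_relators_def by blast
next
  case (5 e)
  then have "flip r = xp (rng G e) * xstar e - xstar e" by simp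
  then show ?thesis using 5 unfolding lpa_relators_def by blast
next
  case (6 e)
  then have "flip r = xs e * xp (rng G e) - xs e" by simp
  then show ?thesis using 6 unfolding lpa_relators_def by blast
next
  case (7 e)
  then have "flip r = xp {src G e} * xs e - xs e" by simp
  then show ?thesis using 7 unfolding lpa_relators_def by blast
next
  case (8 e f)
  then have "flip r = xstar f * xs e - (if f = e then xp (rng G f) else 0)" by simp
  then show ?thesis using 8 unfolding lpa_relators_def by blast
next
  case (9 v)
  then have "flip r = r" by (simp add: flip_sum)
  then show ?thesis using assms by simp
qed

lemma lpa_eq_flip:
  fixes a b :: "('v, 'e, 'k::field) gen_poly"
  assumes "lpa_eq G a b"
  shows "lpa_eq G (flip a) (flip b)"
proof -
  let ?J = "{x :: ('v, 'e, 'k) gen_poly. flip x \<in> lpa_gen G {}}"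
  have "lpa_ideal G ?J"
    unfolding lpa_ideal_def ring_ideal_def
  proof (intro conjI allI ballI impI subsetI)
    fix g assume g: "g \<notin> gens G"
    then have "flip_gen g \<notin> gens G" by (cases g) (auto simp: gens_def)
    then show "letter g \<in> ?J"
      using lpa_ideal_rel by (auto simp: flip_word_def lpa_ideal_def)
  next
    fix x assume "x \<in> ?J"
    then have "flip x \<in> aug" using lpa_ideal_subset_aug[OF lpa_ideal_rel] by blast
    then have "flip (flip x) \<in> aug" by (rule flip_aug)
    then show "x \<in> aug" by simp
  next
    fix r :: "('v, 'e, 'k) gen_poly" assume "r \<in> lpa_relators G"
    then have "flip r \<in> lpa_relators G" by (rule flip_relator)
    then show "r \<in> ?J" using lpa_ideal_rel unfolding lpa_ideal_def by blast
  qed (auto intro: lpa_ideal_zero[OF lpa_ideal_rel] lpa_ideal_add[OF lpa_ideal_rel]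
      lpa_ideal_left[OF lpa_ideal_rel] lpa_ideal_right[OF lpa_ideal_rel])
  then show ?thesis using assms lpa_gen_least[of G ?J "{}"] by (auto simp: lpa_eq_def)
qed


section \<open>Calculating in the path algebra\<close>

context ultragraph
begin

abbreviation eqv :: "('v, 'e, 'k::field) gen_poly \<Rightarrow> ('v, 'e, 'k) gen_poly \<Rightarrow> bool"
    (infix \<open>\<approx>\<close> 50) where
  "a \<approx> b \<equiv> lpa_eq G a b"

text \<open>Scalars are the constant polynomials; they are central.\<close>

abbreviation scal :: "'k::field \<Rightarrow> ('v, 'e, 'k) gen_poly" where
  "scal c \<equiv> Poly_Mapping.single 0 c"

lemma p_empty: "(xp {} :: ('v, 'e, 'k::field) gen_poly) \<approx> 0"
  by (rule lpa_eq_relator) (simp add: lpa_relators_def)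

lemma p_mult:
  assumes "A \<in> gverts G" "B \<in> gverts G"
  shows "(xp A * xp B :: ('v, 'e, 'k::field) gen_poly) \<approx> xp (A \<inter> B)"
  by (rule lpa_eq_relator) (use assms in \<open>unfold lpa_relators_def, blast\<close>)

lemma p_union:
  assumes "A \<in> gverts G" "B \<in> gverts G"
  shows "(xp (A \<union> B) :: ('v, 'e, 'k::field) gen_poly) \<approx> xp A + xp B - xp (A \<inter> B)"
  by (rule lpa_eq_relator) (use assms in \<open>unfold lpa_relators_def, blast\<close>)

lemma p_s:
  assumes "e \<in> edges G"
  shows "(xp {src G e} * xs e :: ('v, 'e, 'k::field) gen_poly) \<approx> xs e"
  by (rule lpa_eq_relator) (use assms in \<open>unfold lpa_relators_def, blast\<close>)

lemma s_p:
  assumes "e \<in> edges G"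
  shows "(xs e * xp (rng G e) :: ('v, 'e, 'k::field) gen_poly) \<approx> xs e"
  by (rule lpa_eq_relator) (use assms in \<open>unfold lpa_relators_def, blast\<close>)

lemma p_t:
  assumes "e \<in> edges G"
  shows "(xp (rng G e) * xstar e :: ('v, 'e, 'k::field) gen_poly) \<approx> xstar e"
  by (rule lpa_eq_relator) (use assms in \<open>unfold lpa_relators_def, blast\<close>)

lemma t_p:
  assumes "e \<in> edges G"
  shows "(xstar e * xp {src G e} :: ('v, 'e, 'k::field) gen_poly) \<approx> xstar e"
  by (rule lpa_eq_relator) (use assms in \<open>unfold lpa_relators_def, blast\<close>)

lemma t_s:
  assumes "e \<in> edges G" "f \<in> edges G"
  shows "(xstar e * xs f :: ('v, 'e, 'k::field) gen_poly) \<approx> (if e = f then xp (rng G e) else 0)"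
  by (rule lpa_eq_relator) (use assms in \<open>unfold lpa_relators_def, blast\<close>)

lemma t_s_same:
  assumes "e \<in> edges G"
  shows "(xstar e * xs e :: ('v, 'e, 'k::field) gen_poly) \<approx> xp (rng G e)"
  using t_s[OF assms assms] by simp

lemma t_s_other:
  assumes "e \<in> edges G" "f \<in> edges G" "e \<noteq> f"
  shows "(xstar e * xs f :: ('v, 'e, 'k::field) gen_poly) \<approx> 0"
  using t_s[OF assms(1,2)] assms(3) by simp

lemma ck:
  assumes "v \<in> verts G" "emitted G v \<noteq> {}" "finite (emitted G v)"
  shows "(xp {v} :: ('v, 'e, 'k::field) gen_poly) \<approx> (\<Sum>e\<in>emitted G v. xs e * xstar e)"
  by (rule lpa_eq_relator) (use assms in \<open>unfold lpa_relators_def, blast\<close>)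

lemma superfluous_letter:
  assumes "g \<notin> gens G"
  shows "(letter g :: ('v, 'e, 'k::field) gen_poly) \<approx> 0"
  using lpa_ideal_rel[of G] assms by (auto simp: lpa_eq_def lpa_ideal_def)

lemma p_idem:
  assumes "A \<in> gverts G"
  shows "(xp A * xp A :: ('v, 'e, 'k::field) gen_poly) \<approx> xp A"
  using p_mult[OF assms assms] by simp

lemma gverts_src: "e \<in> edges G \<Longrightarrow> {src G e} \<in> gverts G"
  by (simp add: gverts.vertex src_in_verts)

lemma p_s_cases:
  assumes "A \<in> gverts G" "e \<in> edges G"
  shows "(xp A * xs e :: ('v, 'e, 'k::field) gen_poly) \<approx> (if src G e \<in> A then xs e else 0)"
proof -
  have "(xp A * xs e :: ('v, 'e, 'k) gen_poly) \<approx> xp A * (xp {src G e} * xs e)"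
    by (rule lpa_eq_left[OF lpa_eq_sym[OF p_s[OF assms(2)]]])
  also have "xp A * (xp {src G e} * xs e) = (xp A * xp {src G e}) * (xs e :: ('v, 'e, 'k) gen_poly)"
    by (simp add: mult.assoc)
  also have "\<dots> \<approx> xp (A \<inter> {src G e}) * xs e"
    by (rule lpa_eq_right[OF p_mult]) (use assms gverts_src in auto)
  also have "\<dots> \<approx> (if src G e \<in> A then xs e else 0)"
    using p_s[OF assms(2)] lpa_eq_right[OF p_empty, of "xs e"] by auto
  finally show ?thesis .
qed

lemma t_p_cases:
  assumes "A \<in> gverts G" "e \<in> edges G"
  shows "(xstar e * xp A :: ('v, 'e, 'k::field) gen_poly) \<approx> (if src G e \<in> A then xstar e else 0)"
  using lpa_eq_flip[OF p_s_cases[OF assms, where 'k = 'k]] by (auto split: if_splits)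

lemma scal_left:
  fixes x y :: "('v, 'e, 'k::field) gen_poly"
  shows "x * (scal c * y) = scal c * (x * y)"
  by (metis mult.assoc scalar_commute)


subsection \<open>Normal forms of words\<close>

text \<open>The element \<open>s\<^sub>\<alpha> p\<^sub>A s\<^sub>\<beta>\<^sup>*\<close>. The edge sequences need not be paths; if they are not, the
  element vanishes in the path algebra.\<close>

definition mono :: "'e list \<Rightarrow> 'v set \<Rightarrow> 'e list \<Rightarrow> ('v, 'e, 'k::field) gen_poly" where
  "mono \<alpha> A \<beta> = prod_list (map xs \<alpha>) * xp A * prod_list (map xstar (rev \<beta>))"

lemma mono_Nil [simp]: "mono [] A [] = xp A"
  by (simp add: mono_def)

lemma mono_Cons_left: "mono (e # \<alpha>) A \<beta> = xs e * mono \<alpha> A \<beta>"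
  by (simp add: mono_def mult.assoc)

lemma mono_Cons_right: "mono \<alpha> A (e # \<beta>) = mono \<alpha> A \<beta> * xstar e"
  by (simp add: mono_def mult.assoc)

text \<open>The property of being zero or equal, in the path algebra, to one of these elements in degree \<open>n\<close>.\<close>

definition normal :: "int \<Rightarrow> ('v, 'e, 'k::field) gen_poly \<Rightarrow> bool" where
  "normal n x \<longleftrightarrow> x \<approx> 0 \<or> (\<exists>\<alpha> A \<beta>. set \<alpha> \<subseteq> edges G \<and> set \<beta> \<subseteq> edges G \<and> A \<in> gverts G \<and>
     int (length \<alpha>) - int (length \<beta>) = n \<and> x \<approx> mono \<alpha> A \<beta>)"

lemma normalI:
  assumes "x \<approx> mono \<alpha> A \<beta>" "set \<alpha> \<subseteq> edges G" "set \<beta> \<subseteq> edges G" "A \<in> gverts G"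
    "int (length \<alpha>) - int (length \<beta>) = n"
  shows "normal n x"
  using assms unfolding normal_def by blast

lemma normal_eqv: "normal n y \<Longrightarrow> x \<approx> y \<Longrightarrow> normal n x"
  unfolding normal_def using lpa_eq_trans by blast

lemma normal_zero [simp]: "normal n 0"
  by (simp add: normal_def)

lemma p_mono:
  assumes "B \<in> gverts G" "A \<in> gverts G" "set \<alpha> \<subseteq> edges G"
  shows "(xp B * mono \<alpha> A \<beta> :: ('v, 'e, 'k::field) gen_poly) \<approx>
    (if \<alpha> = [] then mono [] (B \<inter> A) \<beta> else if src G (hd \<alpha>) \<in> B then mono \<alpha> A \<beta> else 0)"
proof (cases \<alpha>)
  case Nil
  then show ?thesis
    using lpa_eq_right[OF p_mult[OF assms(1,2)], of "prod_list (map xstar (rev \<beta>))"]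
    by (simp add: mono_def mult.assoc)
next
  case (Cons e \<alpha>')
  then show ?thesis
    using lpa_eq_right[OF p_s_cases[OF assms(1), of e], of "mono \<alpha>' A \<beta>"] assms(3)
    by (simp add: mono_Cons_left mult.assoc split: if_splits)
qed

lemma normal_p_mult:
  assumes "B \<in> gverts G" "normal n x"
  shows "normal n (xp B * x)"
  using assms(2) unfolding normal_def
proof (elim disjE exE conjE)
  assume "x \<approx> 0"
  then show "xp B * x \<approx> 0 \<or> (\<exists>\<alpha> A \<beta>. set \<alpha> \<subseteq> edges G \<and> set \<beta> \<subseteq> edges G \<and> A \<in> gverts G \<and>
     int (length \<alpha>) - int (length \<beta>) = n \<and> xp B * x \<approx> mono \<alpha> A \<beta>)"
    using lpa_eq_left[of G x 0 "xp B"] by simp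
next
  fix \<alpha> A \<beta> assume *: "x \<approx> mono \<alpha> A \<beta>" "set \<alpha> \<subseteq> edges G" "set \<beta> \<subseteq> edges G" "A \<in> gverts G"
    "int (length \<alpha>) - int (length \<beta>) = n"
  note eq = lpa_eq_trans[OF lpa_eq_left[OF *(1), of "xp B"] p_mono[OF assms(1) *(4,2), of \<beta>]]
  have "normal n (xp B * x)"
  proof (cases "\<alpha> = []")
    case True
    show ?thesis
      by (rule normalI[of _ "[]" "B \<inter> A" \<beta>]) (use eq True * assms(1) gverts.inter in auto)
  next
    case False
    show ?thesis
      by (rule normal_eqv[OF _ eq]) (use False * in \<open>auto intro: normalI[OF lpa_eq_refl]\<close>)
  qed
  then show "xp B * x \<approx> 0 \<or> (\<exists>\<alpha> A \<beta>. set \<alpha> \<subseteq> edges G \<and> set \<beta> \<subseteq> edges G \<and> A \<in> gverts G \<and>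
     int (length \<alpha>) - int (length \<beta>) = n \<and> xp B * x \<approx> mono \<alpha> A \<beta>)"
    by (simp add: normal_def)
qed

text \<open>Multiplying a normal form by \<open>s\<^sub>e\<^sup>*\<close> cancels a leading \<open>s\<^sub>e\<close>; if \<open>\<alpha>\<close> is empty, then \<open>s\<^sub>e\<^sup>*\<close> commutes past
  \<open>p\<^sub>A\<close>, up to the case that the product vanishes.\<close>

lemma normal_letter_mult:
  fixes x :: "('v, 'e, 'k::field) gen_poly"
  assumes "normal n x"
  shows "normal (gen_degree g + n) (letter g * x)"
proof (cases "g \<in> gens G")
  case False
  then show ?thesis
    using lpa_eq_right[OF superfluous_letter[OF False], of x] by (simp add: normal_def)
next
  case True
  from assms consider "x \<approx> 0" | \<alpha> A \<beta> where "x \<approx> mono \<alpha> A \<beta>" "set \<alpha> \<subseteq> edges G" "set \<beta> \<subseteq> edges G"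
    "A \<in> gverts G" "int (length \<alpha>) - int (length \<beta>) = n"
    unfolding normal_def by blast
  then show ?thesis
  proof cases
    case 1
    then show ?thesis
      using lpa_eq_left[OF 1, of "letter g"] by (simp add: normal_def)
  next
    case 2
    from True consider B where "g = GenP B" "B \<in> gverts G" | e where "g = GenS e" "e \<in> edges G"
      | e where "g = GenStar e" "e \<in> edges G" by (auto simp: gens_def)
    then show ?thesis
    proof cases
      case 1
      then show ?thesis using normal_p_mult[OF 1(2) assms] by (simp add: xp_def)
    next
      case (2 e)
      have "letter g * x \<approx> mono (e # \<alpha>) A \<beta>"
        using lpa_eq_left[OF \<open>x \<approx> mono \<alpha> A \<beta>\<close>, of "letter g"] 2 by (simp add: mono_Cons_left xs_def)
      then show ?thesis
        by (rule normalI) (use \<open>set \<alpha> \<subseteq> edges G\<close> \<open>set \<beta> \<subseteq> edges G\<close> \<open>A \<in> gverts G\<close> 2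
          \<open>int (length \<alpha>) - int (length \<beta>) = n\<close> in auto)
    next
      case (3 e)
      have eq: "letter g * x \<approx> xstar e * mono \<alpha> A \<beta>"
        using lpa_eq_left[OF \<open>x \<approx> mono \<alpha> A \<beta>\<close>, of "letter g"] 3 by (simp add: xstar_def)
      show ?thesis
      proof (cases \<alpha>)
        case Nil
        have "xstar e * mono \<alpha> A \<beta> = (xstar e * xp A) * prod_list (map xstar (rev \<beta>))"
          by (simp add: Nil mono_def mult.assoc)
        also have "\<dots> \<approx> (if src G e \<in> A then xstar e else 0) * prod_list (map xstar (rev \<beta>))"
          by (rule lpa_eq_right[OF t_p_cases]) (use 2 3 in auto)
        finally have eq2: "letter g * x \<approx> (if src G e \<in> A then xstar e else 0) * prod_list (map xstar (rev \<beta>))"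
          using eq lpa_eq_trans by blast
        show ?thesis
        proof (cases "src G e \<in> A")
          case True
          have "letter g * x \<approx> xstar e * prod_list (map xstar (rev \<beta>))"
            using eq2 True by simp
          also have "\<dots> \<approx> (xp (rng G e) * xstar e) * prod_list (map xstar (rev \<beta>))"
            by (rule lpa_eq_right[OF lpa_eq_sym[OF p_t[OF 3(2)]]])
          also have "\<dots> = mono [] (rng G e) (\<beta> @ [e])"
            by (simp add: mono_def mult.assoc)
          finally show ?thesis
            by (rule normalI) (use 2 3 Nil gverts.range in auto)
        qed (use eq2 in \<open>simp add: normal_def\<close>)
      next
        case (Cons f \<alpha>')
        have f: "f \<in> edges G" using 2 Cons by auto
        have "xstar e * mono \<alpha> A \<beta> = (xstar e * xs f) * mono \<alpha>' A \<beta>"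
          by (simp add: Cons mono_Cons_left mult.assoc)
        also have "\<dots> \<approx> (if e = f then xp (rng G e) else 0) * mono \<alpha>' A \<beta>"
          by (rule lpa_eq_right[OF t_s[OF 3(2) f]])
        finally have eq2: "letter g * x \<approx> (if e = f then xp (rng G e) else 0) * mono \<alpha>' A \<beta>"
          using eq lpa_eq_trans by blast
        have "normal (n - 1) (mono \<alpha>' A \<beta> :: ('v, 'e, 'k) gen_poly)"
          by (rule normalI[OF lpa_eq_refl]) (use 2 Cons in auto)
        then have "normal (n - 1) (xp (rng G e) * mono \<alpha>' A \<beta> :: ('v, 'e, 'k) gen_poly)"
          by (rule normal_p_mult[OF gverts.range[OF 3(2)]])
        then have "normal (n - 1) ((if e = f then xp (rng G e) else 0) * mono \<alpha>' A \<beta> :: ('v, 'e, 'k) gen_poly)"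
          by (cases "e = f") auto
        then have "normal (n - 1) (letter g * x)"
          by (rule normal_eqv[OF _ eq2])
        then show ?thesis using 3 by simp
      qed
    qed
  qed
qed

lemma normal_word:
  assumes "w \<noteq> 0"
  shows "normal (word_degree w) (Poly_Mapping.single w 1 :: ('v, 'e, 'k::field) gen_poly)"
proof -
  have "normal (word_degree (Word gs)) (Poly_Mapping.single (Word gs) 1 :: ('v, 'e, 'k) gen_poly)"
    if "gs \<noteq> []" for gs :: "('v, 'e) gen list"
    using that
  proof (induction gs rule: list_nonempty_induct)
    case (single g)
    show ?case
    proof (cases "g \<in> gens G")
      case False
      then show ?thesis using superfluous_letter[OF False, where 'k = 'k] by (simp add: normal_def)
    next
      case True
      then consider B where "g = GenP B" "B \<in> gverts G" | e where "g = GenS e" "e \<in> edges G"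
        | e where "g = GenStar e" "e \<in> edges G" by (auto simp: gens_def)
      then show ?thesis
      proof cases
        case 1
        then show ?thesis
          by (intro normalI[of _ "[]" B "[]"]) (auto simp: xp_def word_degree_def)
      next
        case 2
        then show ?thesis
          using lpa_eq_sym[OF s_p[OF 2(2), where 'k = 'k]] gverts.range
          by (intro normalI[of _ "[e]" "rng G e" "[]"]) (auto simp: mono_Cons_left xs_def word_degree_def)
      next
        case 3
        then show ?thesis
          using lpa_eq_sym[OF p_t[OF 3(2), where 'k = 'k]] gverts.range
          by (intro normalI[of _ "[]" "rng G e" "[e]"]) (auto simp: mono_Cons_right xstar_def word_degree_def)
      qed
    qed
  next
    case (cons g gs)
    have "Poly_Mapping.single (Word (g # gs)) 1 = letter g * (Poly_Mapping.single (Word gs) 1 :: ('v, 'e, 'k) gen_poly)"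
      by (simp add: mult_single plus_word_def)
    then show ?case using normal_letter_mult[OF cons.IH, of g] by (simp add: word_degree_def)
  qed
  then show ?thesis using assms by (cases w) (auto simp: zero_word_def)
qed

text \<open>To check a linear property, it suffices to check it on scalar multiples of the elements \<open>s\<^sub>\<alpha> p\<^sub>A s\<^sub>\<beta>\<^sup>*\<close>.\<close>

lemma homogeneous_induct [consumes 2, case_names eqv zero add mono]:
  fixes x :: "('v, 'e, 'k::field) gen_poly"
  assumes "x \<in> aug" "\<And>w. w \<in> Poly_Mapping.keys x \<Longrightarrow> Q (word_degree w)"
    and eqv: "\<And>x y. x \<approx> y \<Longrightarrow> P y \<Longrightarrow> P x"
    and zero: "P 0" and add: "\<And>a b. P a \<Longrightarrow> P b \<Longrightarrow> P (a + b)"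
    and mono: "\<And>c \<alpha> A \<beta>. set \<alpha> \<subseteq> edges G \<Longrightarrow> set \<beta> \<subseteq> edges G \<Longrightarrow> A \<in> gverts G \<Longrightarrow>
       Q (int (length \<alpha>) - int (length \<beta>)) \<Longrightarrow> P (scal c * mono \<alpha> A \<beta>)"
  shows "P x"
proof -
  have "\<forall>w\<in>Poly_Mapping.keys x. w \<noteq> 0 \<and> Q (word_degree w)"
    using assms(1,2) by (auto simp: aug_def in_keys_iff)
  then show ?thesis
  proof (induction x rule: poly_induct_keys)
    case zero
    show ?case by (rule assms(4))
  next
    case (add a b)
    then show ?case by (intro assms(5))
  next
    case (single w c)
    have eq: "Poly_Mapping.single w c = scal c * Poly_Mapping.single w 1"
      by (simp add: mult_single)
    have "normal (word_degree w) (Poly_Mapping.single w 1 :: ('v, 'e, 'k) gen_poly)"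
      using normal_word single by blast
    then consider "Poly_Mapping.single w 1 \<approx> (0 :: ('v, 'e, 'k) gen_poly)" |
      \<alpha> A \<beta> where "Poly_Mapping.single w 1 \<approx> (mono \<alpha> A \<beta> :: ('v, 'e, 'k) gen_poly)" "set \<alpha> \<subseteq> edges G" "set \<beta> \<subseteq> edges G"
      "A \<in> gverts G" "int (length \<alpha>) - int (length \<beta>) = word_degree w"
      unfolding normal_def by blast
    then show ?case
    proof cases
      case 1
      have "Poly_Mapping.single w c \<approx> 0"
        unfolding eq using lpa_eq_left[OF 1, of "scal c"] by simp
      then show ?thesis by (rule eqv[OF _ assms(4)])
    next
      case 2
      have "Q (int (length \<alpha>) - int (length \<beta>))" using 2(5) single by simp
      then show ?thesis
        unfolding eq by (rule eqv[OF lpa_eq_left[OF 2(1)] mono[OF 2(2-4)]])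
    qed
  qed
qed

subsection \<open>Local units\<close>

lemma flip_prod_s: "flip (prod_list (map xs es)) = prod_list (map xstar (rev es))"
  and flip_prod_star: "flip (prod_list (map xstar es)) = prod_list (map xs (rev es))"
  by (induction es) simp_all

lemma flip_mono [simp]: "flip (mono \<alpha> A \<beta>) = mono \<beta> A \<alpha>"
  by (simp add: mono_def mult.assoc flip_prod_s flip_prod_star)

lemma local_left_unit:
  fixes x :: "('v, 'e, 'k::field) gen_poly"
  assumes "x \<in> aug"
  shows "\<exists>A\<in>gverts G. \<forall>B\<in>gverts G. A \<subseteq> B \<longrightarrow> xp B * x \<approx> x" (is "?P x")
  using assms
proof (rule homogeneous_induct[where Q = "\<lambda>_. True" and P = ?P])
  fix x y assume xy: "x \<approx> y" and "?P y"
  then obtain A where A: "A \<in> gverts G" "\<forall>B\<in>gverts G. A \<subseteq> B \<longrightarrow> xp B * y \<approx> y" by (elim bexE)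
  have "xp B * x \<approx> x" if "B \<in> gverts G" "A \<subseteq> B" for B
    using lpa_eq_trans[OF lpa_eq_left[OF xy] lpa_eq_trans[OF A(2)[rule_format, OF that] lpa_eq_sym[OF xy]]] .
  then show "?P x" using A(1) by blast
next
  show "?P 0" by (rule bexI[OF _ gverts.empty]) simp
next
  fix a b assume "?P a" "?P b"
  then obtain A B where A: "A \<in> gverts G" "\<forall>C\<in>gverts G. A \<subseteq> C \<longrightarrow> xp C * a \<approx> a"
    and B: "B \<in> gverts G" "\<forall>C\<in>gverts G. B \<subseteq> C \<longrightarrow> xp C * b \<approx> b" by (elim bexE)
  show "?P (a + b)"
    by (rule bexI[OF _ gverts.union[OF A(1) B(1)]]) (use A B in \<open>simp add: distrib_left lpa_eq_add\<close>)
next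
  fix c :: 'k and \<alpha> A \<beta>
  assume *: "set \<alpha> \<subseteq> edges G" "A \<in> gverts G"
  define A' where "A' = (if \<alpha> = [] then A else {src G (hd \<alpha>)})"
  have A': "A' \<in> gverts G" using * by (cases \<alpha>) (auto simp: A'_def gverts_src)
  have "xp B * (scal c * mono \<alpha> A \<beta>) \<approx> scal c * mono \<alpha> A \<beta>" if B: "B \<in> gverts G" "A' \<subseteq> B" for B
  proof -
    have "B \<inter> A = A" if "\<alpha> = []" using B(2) that by (auto simp: A'_def)
    then have "xp B * mono \<alpha> A \<beta> \<approx> (mono \<alpha> A \<beta> :: ('v, 'e, 'k) gen_poly)"
      using p_mono[OF B(1) *(2,1), of \<beta>, where 'k = 'k] B(2) by (auto simp: A'_def split: if_splits)
    then show ?thesis unfolding scal_left by (rule lpa_eq_left)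
  qed
  then show "?P (scal c * mono \<alpha> A \<beta>)" using A' by blast
qed simp

lemma local_units:
  fixes x :: "('v, 'e, 'k::field) gen_poly"
  assumes "x \<in> aug"
  shows "\<exists>A\<in>gverts G. xp A * x \<approx> x \<and> x * xp A \<approx> x"
proof -
  obtain A where A: "A \<in> gverts G" "\<forall>B\<in>gverts G. A \<subseteq> B \<longrightarrow> xp B * x \<approx> x"
    using local_left_unit[OF assms] by (elim bexE)
  obtain B where B: "B \<in> gverts G" "\<forall>C\<in>gverts G. B \<subseteq> C \<longrightarrow> xp C * flip x \<approx> flip x"
    using local_left_unit[OF flip_aug[OF assms]] by (elim bexE)
  have C: "A \<union> B \<in> gverts G" by (rule gverts.union[OF A(1) B(1)])
  have "x * xp (A \<union> B) \<approx> x"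
    using lpa_eq_flip[OF B(2)[rule_format, OF C]] by simp
  moreover have "xp (A \<union> B) * x \<approx> x" using A(2) C by blast
  ultimately show ?thesis using C by blast
qed

end


section \<open>Graded ideals are determined by the idempotents that they contain\<close>

text \<open>The component of degree \<open>n\<close> of a polynomial, polynomials that are homogeneous of degree \<open>n\<close> (zero
  being homogeneous of every degree), and ideals that contain the components of their elements.\<close>

abbreviation degree_part :: "int \<Rightarrow> ('v, 'e, 'k::field) gen_poly \<Rightarrow> ('v, 'e, 'k) gen_poly" where
  "degree_part n \<equiv> part (\<lambda>w. word_degree w = n)"

definition homogeneous :: "int \<Rightarrow> ('v, 'e, 'k::field) gen_poly \<Rightarrow> bool" where
  "homogeneous n x \<longleftrightarrow> (\<forall>w\<in>Poly_Mapping.keys x. word_degree w = n)"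

definition graded :: "('v, 'e, 'k::field) gen_poly set \<Rightarrow> bool" where
  "graded I \<longleftrightarrow> (\<forall>x\<in>I. \<forall>n. degree_part n x \<in> I)"

lemma word_degree_plus [simp]: "word_degree (u + v) = word_degree u + word_degree v"
  by (simp add: word_degree_def)

lemma homogeneous_degree_part: "homogeneous n (degree_part n x)"
  by (auto simp: homogeneous_def keys_part)

lemma degree_part_homogeneous: "homogeneous n x \<Longrightarrow> degree_part m x = (if m = n then x else 0)"
  unfolding homogeneous_def by (auto intro: part_id part_none)

lemma homogeneous_iff_degree_part: "homogeneous n x \<longleftrightarrow> degree_part n x = x"
  using homogeneous_degree_part[of n x] degree_part_homogeneous[of n x n] by auto

lemma homogeneous_mult:
  assumes "homogeneous n x" "homogeneous m y"
  shows "homogeneous (n + m) (x * y)"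
  using assms keys_mult[of x y] by (fastforce simp: homogeneous_def)

lemma homogeneous_add:
  assumes "homogeneous n x" "homogeneous n y"
  shows "homogeneous n (x + y)"
  using assms by (simp add: homogeneous_iff_degree_part)

lemma homogeneous_diff:
  assumes "homogeneous n x" "homogeneous n y"
  shows "homogeneous n (x - y)"
  using assms by (simp add: homogeneous_iff_degree_part)

lemma homogeneous_sum:
  assumes "\<And>i. i \<in> A \<Longrightarrow> homogeneous n (f i)"
  shows "homogeneous n (sum f A)"
  using assms by (simp add: homogeneous_iff_degree_part part_sum)

lemma homogeneous_generators [simp]:
  "homogeneous 0 (xp A)" "homogeneous 1 (xs e)" "homogeneous (- 1) (xstar e)"
  "homogeneous n 0" "homogeneous 0 1" "homogeneous 0 (Poly_Mapping.single 0 c)"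
  by (auto simp: homogeneous_def xp_def xs_def xstar_def word_degree_def)

lemma degree_part_aug: "x \<in> aug \<Longrightarrow> degree_part n x \<in> aug"
  by (simp add: aug_def lookup_part)

lemma sum_degree_parts:
  assumes "finite N" "word_degree ` Poly_Mapping.keys x \<subseteq> N"
  shows "x = (\<Sum>n\<in>N. degree_part n x)"
proof (rule poly_mapping_eqI)
  fix w
  have "(\<Sum>n\<in>N. if word_degree w = n then Poly_Mapping.lookup x w else 0) = Poly_Mapping.lookup x w"
    using assms by (auto simp: in_keys_iff image_subset_iff)
  then show "Poly_Mapping.lookup x w = Poly_Mapping.lookup (\<Sum>n\<in>N. degree_part n x) w"
    by (simp add: lookup_sum lookup_part)
qed

lemma finite_degrees: "finite (word_degree ` Poly_Mapping.keys x)"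
  by simp

lemma graded_inI:
  assumes "lpa_ideal G J" "\<And>n. degree_part n x \<in> J"
  shows "x \<in> J"
  using lpa_ideal_sum[OF assms(1), of "word_degree ` Poly_Mapping.keys x" "\<lambda>n. degree_part n x"] assms(2)
    sum_degree_parts[OF finite_degrees[of x] subset_refl] by simp

context ultragraph
begin

text \<open>The element \<open>\<Sum>\<^bsub>e\<in>F\<^esub> s\<^sub>e s\<^sub>e\<^sup>*\<close> for a finite set \<open>F\<close> of edges, an idempotent of the path algebra.\<close>

definition range_sum :: "'e set \<Rightarrow> ('v, 'e, 'k::field) gen_poly" where
  "range_sum F = (\<Sum>e\<in>F. xs e * xstar e)"

lemma range_sum_s:
  assumes "finite F" "F \<subseteq> edges G" "e \<in> F"
  shows "(range_sum F * xs e :: ('v, 'e, 'k::field) gen_poly) \<approx> xs e"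
proof -
  have "(range_sum F * xs e :: ('v, 'e, 'k) gen_poly) = (\<Sum>f\<in>F. xs f * (xstar f * xs e))"
    by (simp add: range_sum_def sum_distrib_right mult.assoc)
  also have "\<dots> \<approx> (\<Sum>f\<in>F. xs f * (if f = e then xp (rng G f) else 0))"
    by (intro lpa_eq_sum lpa_eq_left t_s) (use assms in auto)
  also have "(\<Sum>f\<in>F. xs f * (if f = e then xp (rng G f) else 0)) =
      (\<Sum>f\<in>F. if f = e then xs e * xp (rng G e) else (0 :: ('v, 'e, 'k) gen_poly))"
    by (rule sum.cong) auto
  also have "\<dots> = xs e * xp (rng G e)"
    using assms by simp
  also have "\<dots> \<approx> xs e" using assms by (intro s_p) auto
  finally show ?thesis .
qed

lemma flip_range_sum [simp]: "flip (range_sum F) = range_sum F"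
  by (simp add: range_sum_def flip_sum)

lemma t_range_sum:
  assumes "finite F" "F \<subseteq> edges G" "e \<in> F"
  shows "(xstar e * range_sum F :: ('v, 'e, 'k::field) gen_poly) \<approx> xstar e"
  using lpa_eq_flip[OF range_sum_s[OF assms, where 'k = 'k]] by simp

lemma range_sum_idem:
  assumes "finite F" "F \<subseteq> edges G"
  shows "(range_sum F * range_sum F :: ('v, 'e, 'k::field) gen_poly) \<approx> range_sum F"
proof -
  have "(range_sum F * range_sum F :: ('v, 'e, 'k) gen_poly) = (\<Sum>e\<in>F. (range_sum F * xs e) * xstar e)"
    by (subst (2) range_sum_def) (simp add: sum_distrib_left mult.assoc)
  also have "\<dots> \<approx> (\<Sum>e\<in>F. xs e * xstar e)"
    by (intro lpa_eq_sum lpa_eq_right range_sum_s) (use assms in auto)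
  finally show ?thesis by (simp add: range_sum_def)
qed

lemma p_range_sum:
  assumes "A \<in> gverts G" "finite F" "F \<subseteq> edges G"
  shows "(xp A * range_sum F :: ('v, 'e, 'k::field) gen_poly) \<approx> range_sum {e\<in>F. src G e \<in> A}"
proof -
  have "(xp A * range_sum F :: ('v, 'e, 'k) gen_poly) = (\<Sum>e\<in>F. (xp A * xs e) * xstar e)"
    by (simp add: range_sum_def sum_distrib_left mult.assoc)
  also have "\<dots> \<approx> (\<Sum>e\<in>F. (if src G e \<in> A then xs e else 0) * xstar e)"
    by (intro lpa_eq_sum lpa_eq_right p_s_cases) (use assms in auto)
  also have "(\<Sum>e\<in>F. (if src G e \<in> A then xs e else 0) * xstar e) =
      (\<Sum>e\<in>F. if src G e \<in> A then xs e * xstar e else (0 :: ('v, 'e, 'k) gen_poly))"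
    by (rule sum.cong) auto
  also have "\<dots> = range_sum {e\<in>F. src G e \<in> A}"
    using assms by (simp add: range_sum_def sum.inter_filter)
  finally show ?thesis .
qed

lemma range_sum_p:
  assumes "A \<in> gverts G" "finite F" "F \<subseteq> edges G"
  shows "(range_sum F * xp A :: ('v, 'e, 'k::field) gen_poly) \<approx> range_sum {e\<in>F. src G e \<in> A}"
  using lpa_eq_flip[OF p_range_sum[OF assms, where 'k = 'k]] by simp

lemma t_range_sum_out:
  assumes "finite F" "F \<subseteq> edges G" "e \<in> edges G" "e \<notin> F"
  shows "(xstar e * range_sum F :: ('v, 'e, 'k::field) gen_poly) \<approx> 0"
proof -
  have "(xstar e * range_sum F :: ('v, 'e, 'k) gen_poly) = (\<Sum>f\<in>F. (xstar e * xs f) * xstar f)"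
    by (simp add: range_sum_def sum_distrib_left mult.assoc)
  also have "\<dots> \<approx> (\<Sum>f\<in>F. 0 * xstar f)"
    by (intro lpa_eq_sum lpa_eq_right t_s_other) (use assms in auto)
  finally show ?thesis by simp
qed

lemma range_sum_in_ideal:
  fixes J :: "('v, 'e, 'k::field) gen_poly set"
  assumes "lpa_ideal G J" "F \<subseteq> edges G" "\<And>e. e \<in> F \<Longrightarrow> xp (rng G e) \<in> J"
  shows "range_sum F \<in> J"
  unfolding range_sum_def
proof (rule lpa_ideal_sum[OF assms(1)])
  fix e assume e: "e \<in> F"
  have "xs e * xp (rng G e) * xstar e \<in> J"
    using assms e by (intro lpa_ideal_right[OF assms(1)] lpa_ideal_left[OF assms(1)]) auto
  moreover have "xs e * xp (rng G e) * xstar e \<approx> (xs e * xstar e :: ('v, 'e, 'k) gen_poly)"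
    using assms e by (intro lpa_eq_right s_p) auto
  ultimately show "xs e * xstar e \<in> J" using lpa_eq_ideal[OF _ assms(1)] by blast
qed

text \<open>Elements of positive degree are sums of elements \<open>s\<^sub>e y\<close>, elements of negative degree are
  sums of elements \<open>y s\<^sub>e\<^sup>*\<close>.\<close>

lemma positive_degree:
  fixes x :: "('v, 'e, 'k::field) gen_poly"
  assumes "x \<in> aug" "homogeneous n x" "n \<ge> 1"
  shows "\<exists>F. finite F \<and> F \<subseteq> edges G \<and> x \<approx> range_sum F * x"
proof -
  have "\<exists>F. finite F \<and> F \<subseteq> edges G \<and>
      (\<forall>F'. finite F' \<and> F' \<subseteq> edges G \<and> F \<subseteq> F' \<longrightarrow> range_sum F' * x \<approx> x)" (is "?P x")
    using assms(1)
  proof (rule homogeneous_induct[where Q = "\<lambda>n. n \<ge> 1" and P = ?P])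
    fix w assume "w \<in> Poly_Mapping.keys x"
    then show "word_degree w \<ge> 1" using assms by (auto simp: homogeneous_def)
  next
    fix x y assume xy: "x \<approx> y" and "?P y"
    then obtain F where F: "finite F" "F \<subseteq> edges G"
      "\<forall>F'. finite F' \<and> F' \<subseteq> edges G \<and> F \<subseteq> F' \<longrightarrow> range_sum F' * y \<approx> y" by (elim exE conjE)
    have "range_sum F' * x \<approx> x" if "finite F'" "F' \<subseteq> edges G" "F \<subseteq> F'" for F'
      using F(3)[rule_format, of F'] that lpa_eq_trans[OF lpa_eq_left[OF xy]] lpa_eq_trans[OF _ lpa_eq_sym[OF xy]]
      by metis
    then show "?P x" using F by (intro exI[of _ F]) simp
  next
    show "?P 0" by (intro exI[of _ "{}"]) simp
  next
    fix a b assume "?P a" "?P b"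
    then obtain F F' where F: "finite F" "F \<subseteq> edges G"
      "\<forall>E. finite E \<and> E \<subseteq> edges G \<and> F \<subseteq> E \<longrightarrow> range_sum E * a \<approx> a"
      and F': "finite F'" "F' \<subseteq> edges G"
      "\<forall>E. finite E \<and> E \<subseteq> edges G \<and> F' \<subseteq> E \<longrightarrow> range_sum E * b \<approx> b" by (elim exE conjE)
    show "?P (a + b)"
      using F F' by (intro exI[of _ "F \<union> F'"]) (auto simp: distrib_left intro!: lpa_eq_add)
  next
    fix c :: 'k and \<alpha> A \<beta>
    assume *: "set \<alpha> \<subseteq> edges G" "set \<beta> \<subseteq> edges G" "A \<in> gverts G" "int (length \<alpha>) - int (length \<beta>) \<ge> 1"
    then obtain e \<alpha>' where e: "\<alpha> = e # \<alpha>'" by (cases \<alpha>) auto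
    have "range_sum F' * (scal c * mono \<alpha> A \<beta>) \<approx> scal c * mono \<alpha> A \<beta>"
      if "finite F'" "F' \<subseteq> edges G" "{e} \<subseteq> F'" for F'
    proof -
      have "range_sum F' * (scal c * mono \<alpha> A \<beta>) = scal c * ((range_sum F' * xs e) * mono \<alpha>' A \<beta>)"
        by (simp add: e mono_Cons_left mult.assoc scal_left)
      also have "\<dots> \<approx> scal c * (xs e * mono \<alpha>' A \<beta>)"
        by (intro lpa_eq_left lpa_eq_right range_sum_s) (use that in auto)
      finally show ?thesis by (simp add: e mono_Cons_left)
    qed
    then show "?P (scal c * mono \<alpha> A \<beta>)"
      using * e by (intro exI[of _ "{e}"]) auto
  qed
  then obtain F where F: "finite F" "F \<subseteq> edges G"
      "\<forall>F'. finite F' \<and> F' \<subseteq> edges G \<and> F \<subseteq> F' \<longrightarrow> range_sum F' * x \<approx> x" by (elim exE conjE)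
  have "x \<approx> range_sum F * x" by (rule lpa_eq_sym[OF F(3)[rule_format]]) (use F in auto)
  then show ?thesis using F(1,2) by blast
qed

lemma word_degree_flip: "word_degree (flip_word w) = - word_degree w"
proof -
  have "gen_degree (flip_gen g) = - gen_degree g" for g :: "('a, 'b) gen" by (cases g) auto
  then have "sum_list (map gen_degree (rev (map flip_gen gs))) = - sum_list (map gen_degree gs)"
    for gs :: "('a, 'b) gen list" by (induction gs) auto
  then show ?thesis by (simp add: word_degree_def flip_word_def)
qed

lemma homogeneous_flip:
  assumes "homogeneous n x"
  shows "homogeneous (- n) (flip x)"
  using assms by (fastforce simp: homogeneous_def flip_def keys_map_key[OF inj_flip_word] word_degree_flip)

lemma negative_degree:
  fixes x :: "('v, 'e, 'k::field) gen_poly"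
  assumes "x \<in> aug" "homogeneous n x" "n \<le> - 1"
  shows "\<exists>F. finite F \<and> F \<subseteq> edges G \<and> x \<approx> x * range_sum F"
proof -
  obtain F where F: "finite F" "F \<subseteq> edges G" "flip x \<approx> range_sum F * flip x"
    using positive_degree[OF flip_aug[OF assms(1)] homogeneous_flip[OF assms(2)]] assms(3) by auto
  have "x \<approx> x * range_sum F" using lpa_eq_flip[OF F(3)] by simp
  then show ?thesis using F(1,2) by blast
qed


subsection \<open>Elements of degree zero\<close>

text \<open>The linear span, in the path algebra, of the elements \<open>s\<^sub>\<alpha> p\<^sub>A s\<^sub>\<beta>\<^sup>*\<close> of degree zero in which \<open>\<alpha>\<close> and \<open>\<beta>\<close>
  have length at most \<open>N\<close>.\<close>

inductive_set filt :: "nat \<Rightarrow> ('v, 'e, 'k::field) gen_poly set" for N where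
  eqv: "y \<in> filt N \<Longrightarrow> x \<approx> y \<Longrightarrow> x \<in> filt N"
| zero: "0 \<in> filt N"
| add: "x \<in> filt N \<Longrightarrow> y \<in> filt N \<Longrightarrow> x + y \<in> filt N"
| mono: "set \<alpha> \<subseteq> edges G \<Longrightarrow> set \<beta> \<subseteq> edges G \<Longrightarrow> A \<in> gverts G \<Longrightarrow> length \<alpha> = length \<beta> \<Longrightarrow>
    length \<alpha> \<le> N \<Longrightarrow> scal c * mono \<alpha> A \<beta> \<in> filt N"

lemma filt_mono: "x \<in> filt N \<Longrightarrow> N \<le> M \<Longrightarrow> x \<in> filt M"
  by (induction rule: filt.induct) (auto intro: filt.intros)

lemma degree_zero_filt:
  fixes x :: "('v, 'e, 'k::field) gen_poly"
  assumes "x \<in> aug" "homogeneous 0 x"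
  shows "\<exists>N. x \<in> filt N"
  using assms(1)
proof (rule homogeneous_induct[where Q = "\<lambda>n. n = 0"])
  show "w \<in> Poly_Mapping.keys x \<Longrightarrow> word_degree w = 0" for w
    using assms by (auto simp: homogeneous_def)
  show "\<exists>N. (0 :: ('v, 'e, 'k) gen_poly) \<in> filt N" using filt.zero by blast
  show "\<exists>N. x \<in> filt N" if "x \<approx> y" "\<exists>N. y \<in> filt N" for x y :: "('v, 'e, 'k) gen_poly"
    using that filt.eqv by blast
  show "\<exists>N. a + b \<in> filt N" if ab: "\<exists>N. a \<in> filt N" "\<exists>N. b \<in> filt N" for a b :: "('v, 'e, 'k) gen_poly"
  proof -
    obtain N M where "a \<in> filt N" "b \<in> filt M" using ab by blast
    then have "a + b \<in> filt (max N M)" by (intro filt.add) (auto intro: filt_mono)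
    then show ?thesis by blast
  qed
  show "\<exists>N. scal c * mono \<alpha> A \<beta> \<in> filt N"
    if "set \<alpha> \<subseteq> edges G" "set \<beta> \<subseteq> edges G" "A \<in> gverts G" "int (length \<alpha>) - int (length \<beta>) = 0" for c :: 'k and \<alpha> A \<beta>
    using that by (intro exI[of _ "length \<alpha>"] filt.mono) auto
qed

lemma filt_aug: "x \<in> filt N \<Longrightarrow> x \<in> aug"
proof (induction rule: filt.induct)
  case (eqv y x)
  then show ?case using lpa_eq_ideal[OF eqv(2) lpa_ideal_aug] by blast
next
  case (mono \<alpha> \<beta> A c)
  show ?case by (simp add: mono_def)
qed auto

lemma filt_p_mult:
  assumes "x \<in> filt N" "B \<in> gverts G"
  shows "xp B * x \<in> filt N"
  using assms(1)
proof (induction rule: filt.induct)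
  case (eqv y x)
  then show ?case using filt.eqv lpa_eq_left by blast
next
  case (add x y)
  then show ?case using filt.add by (simp add: distrib_left)
next
  case (mono \<alpha> \<beta> A c)
  have "xp B * (scal c * mono \<alpha> A \<beta>) = scal c * (xp B * mono \<alpha> A \<beta>)"
    by (rule scal_left)
  also have "\<dots> \<approx> scal c * (if \<alpha> = [] then mono [] (B \<inter> A) \<beta> else if src G (hd \<alpha>) \<in> B then mono \<alpha> A \<beta> else 0)"
    by (intro lpa_eq_left p_mono assms mono)
  finally have eq: "xp B * (scal c * mono \<alpha> A \<beta>) \<approx>
    scal c * (if \<alpha> = [] then mono [] (B \<inter> A) \<beta> else if src G (hd \<alpha>) \<in> B then mono \<alpha> A \<beta> else 0)" .
  have "scal c * (if \<alpha> = [] then mono [] (B \<inter> A) \<beta> else if src G (hd \<alpha>) \<in> B then mono \<alpha> A \<beta> else 0) \<in> filt N"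
    using mono gverts.inter[OF assms(2) mono(3)] filt.zero filt.mono[of "[]" \<beta> "B \<inter> A" N c] filt.mono[OF mono]
    by auto
  then show ?case by (rule filt.eqv[OF _ eq])
qed (auto intro: filt.zero)

lemma filt_flip:
  assumes "x \<in> filt N"
  shows "flip x \<in> filt N"
  using assms
proof (induction rule: filt.induct)
  case (eqv y x)
  then show ?case using filt.eqv lpa_eq_flip by blast
next
  case (mono \<alpha> \<beta> A c)
  have "flip (scal c * mono \<alpha> A \<beta>) = scal c * mono \<beta> A \<alpha>"
    using scalar_commute[of c "mono \<beta> A \<alpha>"] by (simp add: flip_word_def zero_word_def)
  then show ?case using filt.mono[of \<beta> \<alpha> A N c] mono by simp
qed (auto intro: filt.intros)

lemma filt_mult_p:
  assumes "x \<in> filt N" "B \<in> gverts G"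
  shows "x * xp B \<in> filt N"
  using filt_flip[OF filt_p_mult[OF filt_flip[OF assms(1)] assms(2)]] by simp

text \<open>Compressing by edges lowers the filtration degree.\<close>

lemma filt_compress:
  fixes x :: "('v, 'e, 'k::field) gen_poly"
  assumes "x \<in> filt (Suc N)" "e \<in> edges G" "f \<in> edges G"
  shows "xstar e * x * xs f \<in> filt N"
  using assms(1)
proof (induction rule: filt.induct)
  case (eqv y x)
  then show ?case using filt.eqv lpa_eq_right lpa_eq_left by blast
next
  case (add x y)
  then show ?case using filt.add by (simp add: distrib_left distrib_right)
next
  case (mono \<alpha> \<beta> A c)
  show ?case
  proof (cases \<alpha>)
    case Nil
    then have Nil': "\<beta> = []" using mono by simp
    have "xstar e * (scal c * mono \<alpha> A \<beta>) * xs f = scal c * ((xstar e * xp A) * xs f)"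
      by (simp add: Nil Nil' mult.assoc scal_left)
    also have "\<dots> \<approx> scal c * ((if src G e \<in> A then xstar e else 0) * xs f)"
      by (intro lpa_eq_left lpa_eq_right t_p_cases assms mono)
    finally have eq: "xstar e * (scal c * mono \<alpha> A \<beta>) * xs f \<approx> scal c * ((if src G e \<in> A then xstar e else 0) * xs f)" .
    show ?thesis
    proof (cases "src G e \<in> A \<and> e = f")
      case True
      then have "src G e \<in> A" and f: "f = e" by auto
      then have "xstar e * (scal c * mono \<alpha> A \<beta>) * xs f \<approx> scal c * (xstar e * xs e)"
        using eq by simp
      also have "\<dots> \<approx> scal c * mono [] (rng G e) []"
        unfolding mono_Nil by (rule lpa_eq_left[OF t_s_same[OF assms(2)]])
      finally have "xstar e * (scal c * mono \<alpha> A \<beta>) * xs f \<approx> scal c * mono [] (rng G e) []" .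
      then show ?thesis
        by (rule filt.eqv[rotated]) (rule filt.mono, use gverts.range assms in auto)
    next
      case False
      have "xstar e * (scal c * mono \<alpha> A \<beta>) * xs f \<approx> 0"
      proof (cases "src G e \<in> A")
        case True
        then have "xstar e * (scal c * mono \<alpha> A \<beta>) * xs f \<approx> scal c * (xstar e * xs f)"
          using eq by simp
        also have "\<dots> \<approx> scal c * 0"
          by (rule lpa_eq_left[OF t_s_other[OF assms(2,3)]]) (use False True in simp)
        finally show ?thesis by simp
      next
        case False
        then show ?thesis using eq by simp
      qed
      then show ?thesis using filt.eqv filt.zero by blast
    qed
  next
    case (Cons e' \<alpha>')
    then obtain f' \<beta>' where Cons': "\<beta> = f' # \<beta>'" using mono by (cases \<beta>) auto
    have ef': "e' \<in> edges G" "f' \<in> edges G" using mono Cons Cons' by auto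
    have "xstar e * (scal c * mono \<alpha> A \<beta>) * xs f = (xstar e * xs e') * (scal c * mono \<alpha>' A \<beta>') * (xstar f' * xs f)"
      by (simp add: Cons Cons' mono_Cons_left mono_Cons_right mult.assoc scal_left)
    also have "\<dots> \<approx> (if e = e' then xp (rng G e) else 0) * (scal c * mono \<alpha>' A \<beta>') * (if f' = f then xp (rng G f') else 0)"
      by (intro lpa_eq_mult t_s assms ef' lpa_eq_refl)
    finally have eq: "xstar e * (scal c * mono \<alpha> A \<beta>) * xs f \<approx>
      (if e = e' then xp (rng G e) else 0) * (scal c * mono \<alpha>' A \<beta>') * (if f' = f then xp (rng G f') else 0)" .
    have "scal c * mono \<alpha>' A \<beta>' \<in> filt N"
      using mono Cons Cons' by (intro filt.mono) auto
    then have "(if e = e' then xp (rng G e) else 0) * (scal c * mono \<alpha>' A \<beta>') * (if f' = f then xp (rng G f') else 0) \<in> filt N"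
      using filt_mult_p[OF filt_p_mult[OF _ gverts.range[OF assms(2)]] gverts.range[OF assms(3)]]
      by (auto intro: filt.zero)
    then show ?thesis by (rule filt.eqv[OF _ eq])
  qed
qed (auto intro: filt.zero)


lemma range_sum_commute:
  fixes z :: "('v, 'e, 'k::field) gen_poly"
  assumes "z \<in> filt 0" "finite F" "F \<subseteq> edges G"
  shows "range_sum F * z \<approx> z * range_sum F"
  using assms(1)
proof (induction rule: filt.induct)
  case (eqv y x)
  have "range_sum F * x \<approx> range_sum F * y" by (rule lpa_eq_left[OF eqv(2)])
  also have "\<dots> \<approx> y * range_sum F" by (rule eqv)
  also have "\<dots> \<approx> x * range_sum F" by (rule lpa_eq_right[OF lpa_eq_sym[OF eqv(2)]])
  finally show ?case .
next
  case (add x y)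
  then show ?case by (simp add: distrib_left distrib_right lpa_eq_add)
next
  case (mono \<alpha> \<beta> A c)
  have "range_sum F * xp A \<approx> (xp A * range_sum F :: ('v, 'e, 'k) gen_poly)"
    by (rule lpa_eq_trans[OF range_sum_p lpa_eq_sym[OF p_range_sum]]) (use assms mono in auto)
  from lpa_eq_left[OF this, of "scal c"] show ?case
    using mono by (simp add: scal_left mult.assoc)
qed simp

text \<open>An element of positive filtration degree is, up to a linear combination of
  elements \<open>p\<^sub>A\<close>, an element of a corner cut out by finitely many edges.\<close>

lemma filt_corner:
  fixes x :: "('v, 'e, 'k::field) gen_poly"
  assumes "x \<in> filt N"
  shows "\<exists>F z. finite F \<and> F \<subseteq> edges G \<and> z \<in> filt 0 \<and>
    (\<forall>E. finite E \<and> E \<subseteq> edges G \<and> F \<subseteq> E \<longrightarrow> range_sum E * (x - z) * range_sum E \<approx> x - z)"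
  using assms
proof (induction rule: filt.induct)
  case (eqv y x)
  then obtain F z where F: "finite F" "F \<subseteq> edges G" "z \<in> filt 0"
    "\<forall>E. finite E \<and> E \<subseteq> edges G \<and> F \<subseteq> E \<longrightarrow> range_sum E * (y - z) * range_sum E \<approx> y - z"
    by (elim exE conjE)
  have "range_sum E * (x - z) * range_sum E \<approx> x - z" if "finite E" "E \<subseteq> edges G" "F \<subseteq> E" for E
  proof -
    have "range_sum E * (x - z) * range_sum E \<approx> range_sum E * (y - z) * range_sum E"
      by (intro lpa_eq_right lpa_eq_left lpa_eq_diff eqv lpa_eq_refl)
    also have "\<dots> \<approx> y - z" using F(4) that by blast
    also have "y - z \<approx> x - z" by (intro lpa_eq_diff lpa_eq_sym[OF eqv(2)] lpa_eq_refl)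
    finally show ?thesis .
  qed
  then show ?case using F by (intro exI[of _ F] exI[of _ z]) simp
next
  case zero
  show ?case by (intro exI[of _ "{}"] exI[of _ 0]) (simp add: filt.zero)
next
  case (add x y)
  obtain F z where F: "finite F" "F \<subseteq> edges G" "z \<in> filt 0"
    "\<forall>E. finite E \<and> E \<subseteq> edges G \<and> F \<subseteq> E \<longrightarrow> range_sum E * (x - z) * range_sum E \<approx> x - z"
    using add.IH(1) by (elim exE conjE)
  obtain F' z' where F': "finite F'" "F' \<subseteq> edges G" "z' \<in> filt 0"
    "\<forall>E. finite E \<and> E \<subseteq> edges G \<and> F' \<subseteq> E \<longrightarrow> range_sum E * (y - z') * range_sum E \<approx> y - z'"
    using add.IH(2) by (elim exE conjE)
  have "range_sum E * (x + y - (z + z')) * range_sum E \<approx> x + y - (z + z')"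
    if "finite E" "E \<subseteq> edges G" "F \<union> F' \<subseteq> E" for E
  proof -
    have eq: "x + y - (z + z') = (x - z) + (y - z')" by simp
    have "range_sum E * (x - z) * range_sum E + range_sum E * (y - z') * range_sum E \<approx> (x - z) + (y - z')"
      by (intro lpa_eq_add F(4)[rule_format] F'(4)[rule_format]) (use that in auto)
    then show ?thesis unfolding eq by (simp only: distrib_left distrib_right)
  qed
  moreover have "finite (F \<union> F')" "F \<union> F' \<subseteq> edges G" "z + z' \<in> filt 0"
    using F F' by (auto intro: filt.add)
  ultimately show ?case by (intro exI[of _ "F \<union> F'"] exI[of _ "z + z'"]) simp
next
  case (mono \<alpha> \<beta> A c)
  show ?case
  proof (cases \<alpha>)
    case Nil
    then have "scal c * mono \<alpha> A \<beta> \<in> filt 0" using mono by (intro filt.mono) auto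
    then show ?thesis by (intro exI[of _ "{}"] exI[of _ "scal c * mono \<alpha> A \<beta>"]) simp
  next
    case (Cons e \<alpha>')
    then obtain f \<beta>' where Cons': "\<beta> = f # \<beta>'" using mono by (cases \<beta>) auto
    have "range_sum E * (scal c * mono \<alpha> A \<beta> - 0) * range_sum E \<approx> scal c * mono \<alpha> A \<beta> - 0"
      if "finite E" "E \<subseteq> edges G" "{e, f} \<subseteq> E" for E
    proof -
      have "range_sum E * (scal c * mono \<alpha> A \<beta> - 0) * range_sum E =
          (range_sum E * xs e) * (scal c * mono \<alpha>' A \<beta>') * (xstar f * range_sum E)"
        by (simp add: Cons Cons' mono_Cons_left mono_Cons_right mult.assoc scal_left)
      also have "\<dots> \<approx> xs e * (scal c * mono \<alpha>' A \<beta>') * xstar f"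
        by (intro lpa_eq_mult range_sum_s t_range_sum lpa_eq_refl) (use that in auto)
      also have "\<dots> = scal c * mono \<alpha> A \<beta> - 0"
        by (simp add: Cons Cons' mono_Cons_left mono_Cons_right mult.assoc scal_left)
      finally show ?thesis .
    qed
    then show ?thesis
      using mono Cons Cons' filt.zero by (intro exI[of _ "{e, f}"] exI[of _ 0]) simp
  qed
qed

text \<open>A linear combination \<open>z\<close> of elements \<open>p\<^sub>A\<close> is locally constant: every set is a finite union of sets \<open>D\<close>
  with \<open>p\<^sub>D z = c p\<^sub>D\<close>. Stated as an induction principle, this avoids disjoint representations of \<open>z\<close>.\<close>

lemma filt_zero_locally_scalar:
  fixes z :: "('v, 'e, 'k::field) gen_poly"
  assumes "z \<in> filt 0"
    and "\<And>D c. D \<in> gverts G \<Longrightarrow> xp D * z \<approx> scal c * xp D \<Longrightarrow> Q D"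
    and "\<And>D E. D \<in> gverts G \<Longrightarrow> E \<in> gverts G \<Longrightarrow> Q D \<Longrightarrow> Q E \<Longrightarrow> Q (D \<union> E)"
    and "B \<in> gverts G"
  shows "Q B"
  using assms
proof (induction arbitrary: Q B rule: filt.induct)
  case (eqv y x)
  show ?case
  proof (rule eqv.IH)
    show "Q D" if "D \<in> gverts G" "xp D * y \<approx> scal c * xp D" for D and c :: 'k
      by (rule eqv.prems(1)[OF that(1) lpa_eq_trans[OF lpa_eq_left[OF eqv.hyps(2)] that(2)]])
  qed (use eqv.prems in auto)
next
  case zero
  show ?case by (rule zero(1)[of B 0]) (use zero in auto)
next
  case (add x y)
  show ?case
  proof (rule add.IH(1))
    fix D and c :: 'k assume D: "D \<in> gverts G" "xp D * x \<approx> scal c * xp D"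
    have "Q (D \<inter> D)"
    proof (rule add.IH(2)[of "\<lambda>E. Q (E \<inter> D)"])
      fix E and d :: 'k assume E: "E \<in> gverts G" "xp E * y \<approx> scal d * xp E"
      have ED: "E \<inter> D \<in> gverts G" using D E by (intro gverts.inter)
      have eqx: "xp (E \<inter> D) * x \<approx> scal c * xp (E \<inter> D)"
      proof -
        have "xp (E \<inter> D) * x \<approx> (xp E * xp D) * x"
          by (rule lpa_eq_right[OF lpa_eq_sym[OF p_mult]]) (use D E in auto)
        also have "\<dots> \<approx> xp E * (scal c * xp D)"
          unfolding mult.assoc by (rule lpa_eq_left[OF D(2)])
        also have "\<dots> = scal c * (xp E * xp D)" by (rule scal_left)
        also have "\<dots> \<approx> scal c * xp (E \<inter> D)"
          by (rule lpa_eq_left[OF p_mult]) (use D E in auto)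
        finally show ?thesis .
      qed
      have eqy: "xp (E \<inter> D) * y \<approx> scal d * xp (E \<inter> D)"
      proof -
        have "xp (E \<inter> D) * y \<approx> (xp D * xp E) * y"
          using lpa_eq_right[OF lpa_eq_sym[OF p_mult[OF D(1) E(1), where 'k = 'k]], of y]
          by (simp add: Int_commute)
        also have "\<dots> \<approx> xp D * (scal d * xp E)"
          unfolding mult.assoc by (rule lpa_eq_left[OF E(2)])
        also have "\<dots> = scal d * (xp D * xp E)" by (rule scal_left)
        also have "\<dots> \<approx> scal d * xp (D \<inter> E)"
          by (rule lpa_eq_left[OF p_mult]) (use D E in auto)
        finally show ?thesis by (simp add: Int_commute)
      qed
      have "xp (E \<inter> D) * (x + y) \<approx> scal (c + d) * xp (E \<inter> D)"
        unfolding single_add distrib_left distrib_right by (rule lpa_eq_add[OF eqx eqy])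
      then show "Q (E \<inter> D)" by (rule add.prems(1)[OF ED])
    next
      fix E E' assume *: "E \<in> gverts G" "E' \<in> gverts G" "Q (E \<inter> D)" "Q (E' \<inter> D)"
      then have "Q (E \<inter> D \<union> E' \<inter> D)"
        using D by (intro add.prems(2) gverts.inter)
      then show "Q ((E \<union> E') \<inter> D)" by (simp add: Int_Un_distrib2)
    qed (rule D(1))
    then show "Q D" by simp
  qed (use add.prems in auto)
next
  case (mono \<alpha> \<beta> A c)
  then have x: "scal c * mono \<alpha> A \<beta> = scal c * (xp A :: ('v, 'e, 'k) gen_poly)" by simp
  have "Q (B \<inter> A)"
  proof (rule mono.prems(1))
    show "B \<inter> A \<in> gverts G" using mono by (intro gverts.inter)
    have "xp (B \<inter> A) * (scal c * xp A) = scal c * (xp (B \<inter> A) * (xp A :: ('v, 'e, 'k) gen_poly))"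
      by (rule scal_left)
    also have "\<dots> \<approx> scal c * xp (B \<inter> A \<inter> A)"
      by (intro lpa_eq_left p_mult) (use mono gverts.inter in auto)
    also have "B \<inter> A \<inter> A = B \<inter> A" by auto
    finally show "xp (B \<inter> A) * (scal c * mono \<alpha> A \<beta>) \<approx> scal c * xp (B \<inter> A)" unfolding x .
  qed
  moreover have "Q (B - A)"
  proof (rule mono.prems(1))
    show "B - A \<in> gverts G" using mono by (intro gverts.diff)
    have "xp (B - A) * (scal c * xp A) = scal c * (xp (B - A) * (xp A :: ('v, 'e, 'k) gen_poly))"
      by (rule scal_left)
    also have "\<dots> \<approx> scal c * xp ((B - A) \<inter> A)"
      by (intro lpa_eq_left p_mult) (use mono gverts.diff in auto)
    also have "(B - A) \<inter> A = {}" by auto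
    also have "scal c * xp {} \<approx> (scal c * 0 :: ('v, 'e, 'k) gen_poly)" by (rule lpa_eq_left[OF p_empty])
    finally show "xp (B - A) * (scal c * mono \<alpha> A \<beta>) \<approx> scal 0 * xp (B - A)" unfolding x by simp
  qed
  moreover have "B = (B \<inter> A) \<union> (B - A)" by auto
  ultimately show ?case
    using mono.prems(2)[of "B \<inter> A" "B - A"] gverts.inter[OF mono.prems(3) mono.hyps(3)]
      gverts.diff[OF mono.prems(3) mono.hyps(3)] by simp
qed

lemma ideal_p_union:
  fixes y :: "('v, 'e, 'k::field) gen_poly"
  assumes "lpa_ideal G J" "A \<in> gverts G" "B \<in> gverts G" "xp A * y \<in> J" "xp B * y \<in> J"
  shows "xp (A \<union> B) * y \<in> J"
proof -
  have "xp (A \<union> B) * y \<approx> (xp A + xp B - xp (A \<inter> B)) * y"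
    by (rule lpa_eq_right[OF p_union[OF assms(2,3)]])
  also have "\<dots> = (xp A * y + xp B * y) - xp (A \<inter> B) * y"
    by (simp add: algebra_simps)
  also have "\<dots> \<approx> (xp A * y + xp B * y) - (xp A * xp B) * y"
    by (rule lpa_eq_diff[OF lpa_eq_refl lpa_eq_right[OF lpa_eq_sym[OF p_mult[OF assms(2,3)]]]])
  finally have eq: "xp (A \<union> B) * y \<approx> (xp A * y + xp B * y) - xp A * (xp B * y)"
    by (simp add: mult.assoc)
  have "(xp A * y + xp B * y) - xp A * (xp B * y) \<in> J"
    using lpa_ideal_left[OF assms(1,5), of "xp A"] assms(1,4,5)
    by (intro lpa_ideal_diff[OF assms(1)] lpa_ideal_add[OF assms(1)])
  then show ?thesis using lpa_eq_ideal[OF eq assms(1)] by blast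
qed

lemma ideal_p_sub:
  fixes y :: "('v, 'e, 'k::field) gen_poly"
  assumes "lpa_ideal G J" "A \<in> gverts G" "B \<in> gverts G" "B \<subseteq> A" "xp A * y \<in> J"
  shows "xp B * y \<in> J"
proof -
  have "B \<inter> A = B" using assms by auto
  then have "(xp B * xp A) * y \<approx> xp B * y"
    using lpa_eq_right[OF p_mult[OF assms(3,2), where 'k = 'k], of y] by simp
  moreover have "xp B * (xp A * y) \<in> J" by (rule lpa_ideal_left[OF assms(1,5)])
  ultimately show ?thesis using lpa_eq_ideal[OF _ assms(1)] by (metis mult.assoc)
qed

lemma ideal_p_sub':
  assumes "lpa_ideal G (J :: ('v, 'e, 'k::field) gen_poly set)"
    "A \<in> gverts G" "B \<in> gverts G" "B \<subseteq> A" "xp A \<in> J"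
  shows "xp B \<in> J"
  using ideal_p_sub[OF assms(1-4), of 1] assms(5) by simp

text \<open>The sets \<open>A\<close> with \<open>p\<^sub>A \<in> I\<close>.\<close>

definition ideal_sets :: "('v, 'e, 'k::field) gen_poly set \<Rightarrow> 'v set set" where
  "ideal_sets I = {A \<in> gverts G. xp A \<in> I}"

text \<open>If \<open>p\<^sub>w (1 - \<Sum>\<^bsub>e\<in>F\<^esub> s\<^sub>e s\<^sub>e\<^sup>*)\<close> lies in an ideal, then so does \<open>p\<^bsub>r(f)\<^esub>\<close> for every other edge \<open>f\<close> emitted
  by \<open>w\<close>; hence all but finitely many edges emitted by \<open>w\<close> have their range in the hereditary collection.\<close>

lemma t_vertex_s:
  fixes w :: 'v
  assumes "finite F" "F \<subseteq> edges G" "f \<in> emitted G w" "f \<notin> F"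
  shows "xstar f * (xp {w} * (1 - range_sum F)) * xs f \<approx> (xp (rng G f) :: ('v, 'e, 'k::field) gen_poly)"
proof -
  have f: "f \<in> edges G" "src G f = w" using assms by (auto simp: emitted_def)
  have "xstar f * (xp {w} * (1 - range_sum F)) * xs f =
    ((xstar f * xp {w}) * xs f) - ((xstar f * xp {w}) * range_sum F) * (xs f :: ('v, 'e, 'k) gen_poly)"
    by (simp add: algebra_simps)
  also have "\<dots> \<approx> xstar f * xs f - (xstar f * range_sum F) * xs f"
    using t_p[OF f(1)] f(2) by (intro lpa_eq_diff lpa_eq_right) auto
  also have "\<dots> \<approx> xp (rng G f) - 0 * xs f"
    by (intro lpa_eq_diff lpa_eq_right t_range_sum_out t_s_same f assms)
  finally show ?thesis by simp
qed

lemma gverts_subset: "A \<in> gverts G \<Longrightarrow> A \<subseteq> verts G"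
  by (induction rule: gverts.induct) (use rng_subset_verts in auto)

text \<open>Let \<open>J\<close> contain the elements \<open>p\<^sub>A\<close> and \<open>p\<^sub>w\<^sup>H\<close> of \<open>I\<close>. The following lemmas show that \<open>J\<close> contains larger
  and larger classes of elements of \<open>I\<close>.\<close>

context
  fixes I J :: "('v, 'e, 'k::field) gen_poly set"
  assumes I: "lpa_ideal G I" and J: "lpa_ideal G J"
    and sets: "\<And>A. A \<in> gverts G \<Longrightarrow> xp A \<in> I \<Longrightarrow> xp A \<in> J"
    and breaking: "\<And>w. w \<in> breaking G (ideal_sets I) \<Longrightarrow>
      breaking_gen G (ideal_sets I) w \<in> I \<Longrightarrow> breaking_gen G (ideal_sets I) w \<in> J"
begin

text \<open>The heart of the matter: at a vertex \<open>w\<close>, an element \<open>p\<^sub>w - \<Sum> s\<^sub>e s\<^sub>e\<^sup>*\<close> of \<open>I\<close> comes from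
  the elements \<open>p\<^sub>A\<close> and \<open>p\<^sub>w\<^sup>H\<close> of \<open>I\<close>.\<close>

lemma vertex_gap:
  assumes w: "w \<in> verts G" and F: "finite F" "F \<subseteq> edges G"
    and y: "xp {w} * (1 - range_sum F) \<in> I"
  shows "xp {w} * (1 - range_sum F) \<in> J"
proof -
  let ?H = "ideal_sets I"
  define T where "T = {e\<in>F. src G e \<in> {w}}"
  have T: "T = F \<inter> emitted G w" using F by (auto simp: T_def emitted_def)
  have Tf: "finite T" "T \<subseteq> edges G" using F by (auto simp: T_def)
  have wG: "{w} \<in> gverts G" by (rule gverts.vertex[OF w])
  have yeq: "xp {w} * (1 - range_sum F) \<approx> (xp {w} - range_sum T :: ('v, 'e, 'k) gen_poly)"
    using lpa_eq_diff[OF lpa_eq_refl p_range_sum[OF wG F, where 'k = 'k], of "xp {w}"]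
    by (simp add: T_def right_diff_distrib)
  have out: "rng G f \<in> ?H" if "f \<in> emitted G w" "f \<notin> F" for f
  proof -
    have "xstar f * (xp {w} * (1 - range_sum F)) * xs f \<in> I"
      by (intro lpa_ideal_right[OF I] lpa_ideal_left[OF I] y)
    then have "xp (rng G f) \<in> I"
      using lpa_eq_ideal[OF t_vertex_s[OF F that, where 'k = 'k] I] by blast
    then show ?thesis using that by (auto simp: ideal_sets_def emitted_def gverts.range)
  qed
  have yT: "xp {w} - range_sum T \<in> I" using lpa_eq_ideal[OF yeq I] y by blast
  have "xp {w} - range_sum T \<in> J"
  proof (cases "emitted G w \<noteq> {} \<and> finite (emitted G w)")
    case True
    have "xp {w} - range_sum T \<approx> (range_sum (emitted G w) - range_sum T :: ('v, 'e, 'k) gen_poly)"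
      unfolding range_sum_def by (intro lpa_eq_diff lpa_eq_refl ck w) (use True in auto)
    also have "\<dots> = range_sum (emitted G w - T)"
      unfolding range_sum_def by (rule sum_diff[symmetric]) (use True T in auto)
    finally have eq: "xp {w} - range_sum T \<approx> (range_sum (emitted G w - T) :: ('v, 'e, 'k) gen_poly)" .
    have "(range_sum (emitted G w - T) :: ('v, 'e, 'k) gen_poly) \<in> J"
      by (rule range_sum_in_ideal[OF J]) (use out T sets in \<open>auto simp: emitted_def ideal_sets_def\<close>)
    then show ?thesis using lpa_eq_ideal[OF eq J] by blast
  next
    case False
    \<comment> \<open>\<open>E\<close> is contained in \<open>T\<close>, so \<open>w\<close> is a breaking vertex unless \<open>E\<close> is empty. Edges in \<open>T - E\<close> do not
      matter, since their ranges are in \<open>H\<close>.\<close>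
    define E where "E = {e. e \<in> emitted G w \<and> rng G e \<notin> ?H}"
    have ET: "E \<subseteq> T" using out by (auto simp: E_def T)
    then have Ef: "finite E" using Tf finite_subset by blast
    have split: "range_sum T = range_sum (T - E) + (range_sum E :: ('v, 'e, 'k) gen_poly)"
      unfolding range_sum_def by (rule sum.subset_diff[OF ET Tf(1)])
    have TE_H: "xp (rng G e) \<in> I" if "e \<in> T - E" for e
      using that by (auto simp: E_def T ideal_sets_def)
    have TE_I: "(range_sum (T - E) :: ('v, 'e, 'k) gen_poly) \<in> I"
      by (rule range_sum_in_ideal[OF I]) (use Tf TE_H in auto)
    have TE_J: "(range_sum (T - E) :: ('v, 'e, 'k) gen_poly) \<in> J"
      by (rule range_sum_in_ideal[OF J]) (use Tf sets[OF gverts.range TE_H] in auto)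
    have bI: "xp {w} - range_sum E \<in> I"
      using lpa_ideal_add[OF I yT TE_I] by (simp add: split)
    have "xp {w} - range_sum E \<in> J"
    proof (cases "E = {}")
      case True
      then show ?thesis using bI sets[OF wG] by (simp add: range_sum_def)
    next
      case E: False
      then have "infinite (emitted G w)" using False by (auto simp: E_def)
      then have "w \<in> breaking G ?H"
        using w E Ef by (auto simp: breaking_def E_def)
      moreover have "breaking_gen G ?H w = (xp {w} - range_sum E :: ('v, 'e, 'k) gen_poly)"
        by (simp add: breaking_gen_def range_sum_def E_def)
      ultimately show ?thesis using breaking bI by metis
    qed
    then have "(xp {w} - range_sum E) - range_sum (T - E) \<in> J"
      by (rule lpa_ideal_diff[OF J _ TE_J])
    then show ?thesis by (simp add: split algebra_simps)
  qed
  then show ?thesis using lpa_eq_ideal[OF yeq J] by blast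
qed

lemma set_gap:
  assumes D: "D \<in> gverts G" "D \<subseteq> verts G" and F: "finite F" "F \<subseteq> edges G"
    and y: "xp D * (1 - range_sum F) \<in> I"
  shows "xp D * (1 - range_sum F) \<in> J"
proof -
  let ?q = "range_sum F :: ('v, 'e, 'k) gen_poly"
  \<comment> \<open>Away from the finitely many sources of edges in \<open>F\<close>, the factor \<open>1 - q\<close> acts as the identity.\<close>
  define W where "W = D \<inter> src G ` F"
  have sub: "xp V * (1 - ?q) \<in> I" if "V \<in> gverts G" "V \<subseteq> D" for V
    by (rule ideal_p_sub[OF I D(1) that y])
  have fin: "V \<in> gverts G \<and> xp V * (1 - ?q) \<in> J" if "finite V" "V \<subseteq> D" for V
    using that
  proof (induction V rule: finite_induct)
    case empty
    have "xp {} * (1 - ?q) \<approx> 0 * (1 - ?q)" by (rule lpa_eq_right[OF p_empty])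
    then show ?case using lpa_eq_ideal[OF _ J] lpa_ideal_zero[OF J] by (auto intro: gverts.empty)
  next
    case (insert v V)
    have v: "v \<in> verts G" using insert D by auto
    have "xp {v} * (1 - ?q) \<in> J"
      by (rule vertex_gap[OF v F]) (use insert sub gverts.vertex[OF v] in auto)
    then have "xp ({v} \<union> V) * (1 - ?q) \<in> J"
      by (intro ideal_p_union[OF J]) (use insert v gverts.vertex in auto)
    moreover have "{v} \<union> V \<in> gverts G" by (rule gverts.union) (use insert v gverts.vertex in auto)
    ultimately show ?case by simp
  qed
  have W: "W \<in> gverts G" "xp W * (1 - ?q) \<in> J" using fin[of W] F by (auto simp: W_def)
  have DW: "D - W \<in> gverts G" using D W by (intro gverts.diff)
  have "xp (D - W) * ?q \<approx> range_sum {e \<in> F. src G e \<in> D - W}"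
    by (rule p_range_sum[OF DW F])
  also have "{e \<in> F. src G e \<in> D - W} = {}" by (auto simp: W_def)
  finally have "xp (D - W) * ?q \<approx> 0" by (simp add: range_sum_def)
  then have eq: "xp (D - W) * (1 - ?q) \<approx> xp (D - W)"
    using lpa_eq_diff[OF lpa_eq_refl, of G "xp (D - W) * ?q" 0 "xp (D - W)"] by (simp add: right_diff_distrib)
  have "xp (D - W) \<in> I" using sub[OF DW] lpa_eq_ideal[OF eq I] by auto
  then have "xp (D - W) \<in> J" by (rule sets[OF DW])
  then have "xp (D - W) * (1 - ?q) \<in> J" using lpa_eq_ideal[OF eq J] by blast
  then have "xp (D - W \<union> W) * (1 - ?q) \<in> J" using W DW by (intro ideal_p_union[OF J])
  moreover have "D - W \<union> W = D" by (auto simp: W_def)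
  ultimately show ?thesis by simp
qed

lemma filt_zero_gap:
  assumes z: "z \<in> filt 0" and F: "finite F" "F \<subseteq> edges G"
    and zI: "z * (1 - range_sum F) \<in> I"
  shows "z * (1 - range_sum F) \<in> J"
proof -
  let ?q = "range_sum F :: ('v, 'e, 'k) gen_poly"
  have loc: "xp B * (z * (1 - ?q)) \<in> J" if "B \<in> gverts G" for B
    using z _ _ that
  proof (rule filt_zero_locally_scalar)
    fix D and c :: 'k assume D: "D \<in> gverts G" "xp D * z \<approx> scal c * xp D"
    have eq: "xp D * (z * (1 - ?q)) \<approx> scal c * (xp D * (1 - ?q))"
      using lpa_eq_right[OF D(2), of "1 - ?q"] by (simp add: mult.assoc)
    show "xp D * (z * (1 - ?q)) \<in> J"
    proof (cases "c = 0")
      case True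
      then show ?thesis using lpa_eq_ideal[OF eq J] lpa_ideal_zero[OF J] by simp
    next
      case False
      have "xp D * (z * (1 - ?q)) \<in> I" by (rule lpa_ideal_left[OF I zI])
      then have "scal c * (xp D * (1 - ?q)) \<in> I" using lpa_eq_ideal[OF eq I] by blast
      then have "scal (1 / c) * (scal c * (xp D * (1 - ?q))) \<in> I" by (rule lpa_ideal_left[OF I])
      also have "scal (1 / c) * (scal c * (xp D * (1 - ?q))) = xp D * (1 - ?q)"
        using False by (simp add: mult.assoc[symmetric] mult_single)
      finally have "xp D * (1 - ?q) \<in> I" .
      then have "xp D * (1 - ?q) \<in> J"
        by (intro set_gap[OF D(1) gverts_subset[OF D(1)] F]) auto
      then have "scal c * (xp D * (1 - ?q)) \<in> J" by (rule lpa_ideal_left[OF J])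
      then show ?thesis using lpa_eq_ideal[OF eq J] by blast
    qed
  next
    show "xp (D \<union> E) * (z * (1 - ?q)) \<in> J"
      if "D \<in> gverts G" "E \<in> gverts G" "xp D * (z * (1 - ?q)) \<in> J" "xp E * (z * (1 - ?q)) \<in> J" for D E
      using that by (intro ideal_p_union[OF J])
  qed
  obtain A where A: "A \<in> gverts G" "xp A * z \<approx> z"
    using local_units[OF filt_aug[OF z]] by blast
  have "xp A * (z * (1 - ?q)) \<approx> z * (1 - ?q)"
    using lpa_eq_right[OF A(2), of "1 - ?q"] by (simp add: mult.assoc)
  then show ?thesis using loc[OF A(1)] lpa_eq_ideal[OF _ J] by blast
qed

text \<open>Induction on the length of the paths: \<open>q x q\<close> is handled by the induction hypothesis, and \<open>x - q x q\<close>
  equals \<open>z (1 - q)\<close> for a linear combination \<open>z\<close> of elements \<open>p\<^sub>A\<close>.\<close>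

lemma filt_gap:
  assumes "x \<in> filt N" "x \<in> I"
  shows "x \<in> J"
  using assms
proof (induction N arbitrary: x)
  case 0
  then show ?case
    using filt_zero_gap[of x "{}"] by (simp add: range_sum_def)
next
  case (Suc N)
  obtain F z where F: "finite F" "F \<subseteq> edges G" "z \<in> filt 0"
    "\<forall>E. finite E \<and> E \<subseteq> edges G \<and> F \<subseteq> E \<longrightarrow> range_sum E * (x - z) * range_sum E \<approx> x - z"
    using filt_corner[OF Suc.prems(1)] by (elim exE conjE)
  let ?q = "range_sum F :: ('v, 'e, 'k) gen_poly"
  have corner: "?q * (x - z) * ?q \<approx> x - z" using F by blast
  have "?q * x * ?q = (\<Sum>f\<in>F. \<Sum>e\<in>F. xs e * (xstar e * x * xs f) * xstar f)"
    by (simp add: range_sum_def sum_distrib_left sum_distrib_right mult.assoc)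
  also have "\<dots> \<in> J"
  proof (intro lpa_ideal_sum[OF J], rule lpa_ideal_right[OF J], rule lpa_ideal_left[OF J])
    fix f e assume ef: "e \<in> F" "f \<in> F"
    show "xstar e * x * xs f \<in> J"
    proof (rule Suc.IH)
      show "xstar e * x * xs f \<in> filt N" by (rule filt_compress[OF Suc.prems(1)]) (use ef F in auto)
      show "xstar e * x * xs f \<in> I"
        by (intro lpa_ideal_right[OF I] lpa_ideal_left[OF I] Suc.prems)
    qed
  qed
  finally have qxq: "?q * x * ?q \<in> J" .
  have qzq: "?q * z * ?q \<approx> z * ?q"
  proof -
    have "?q * z * ?q \<approx> z * ?q * ?q"
      by (rule lpa_eq_right[OF range_sum_commute[OF F(3,1,2)]])
    also have "\<dots> \<approx> z * ?q"
      unfolding mult.assoc by (rule lpa_eq_left[OF range_sum_idem[OF F(1,2)]])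
    finally show ?thesis .
  qed
  have "x - ?q * x * ?q = (x - z) - ?q * (x - z) * ?q + (z - ?q * z * ?q)"
    by (simp add: algebra_simps)
  also have "\<dots> \<approx> (x - z) - (x - z) + (z - z * ?q)"
    by (intro lpa_eq_add lpa_eq_diff lpa_eq_refl corner qzq)
  finally have eq: "x - ?q * x * ?q \<approx> z * (1 - ?q)" by (simp add: right_diff_distrib)
  have "x - ?q * x * ?q \<in> I"
    by (intro lpa_ideal_diff[OF I] lpa_ideal_right[OF I] lpa_ideal_left[OF I] Suc.prems)
  then have "z * (1 - ?q) \<in> I" using lpa_eq_ideal[OF eq I] by blast
  then have "z * (1 - ?q) \<in> J" by (intro filt_zero_gap[OF F(3,1,2)]) auto
  then have "x - ?q * x * ?q \<in> J" using lpa_eq_ideal[OF eq J] by blast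
  then have "(x - ?q * x * ?q) + ?q * x * ?q \<in> J" using qxq by (intro lpa_ideal_add[OF J])
  then show ?case by simp
qed

lemma homogeneous_gap:
  assumes "homogeneous n x" "x \<in> I"
  shows "x \<in> J"
  using assms
proof (induction "nat \<bar>n\<bar>" arbitrary: n x)
  case 0
  then have "x \<in> aug" using lpa_ideal_subset_aug[OF I] by auto
  then obtain N where "x \<in> filt N" using degree_zero_filt 0 by fastforce
  then show ?case using filt_gap 0 by blast
next
  case (Suc k)
  have aug: "x \<in> aug" using lpa_ideal_subset_aug[OF I] Suc by auto
  show ?case
  proof (cases "n \<ge> 1")
    case True
    obtain F where F: "finite F" "F \<subseteq> edges G" "x \<approx> range_sum F * x"
      using positive_degree[OF aug Suc.prems(1) True] by blast
    have "range_sum F * x = (\<Sum>e\<in>F. xs e * (xstar e * x))"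
      by (simp add: range_sum_def sum_distrib_right mult.assoc)
    also have "\<dots> \<in> J"
    proof (rule lpa_ideal_sum[OF J], rule lpa_ideal_left[OF J])
      fix e
      have "k = nat \<bar>- 1 + n\<bar>" using Suc.hyps(2) True by simp
      moreover have "homogeneous (- 1 + n) (xstar e * x)"
        by (rule homogeneous_mult[OF _ Suc.prems(1)]) simp
      moreover have "xstar e * x \<in> I" by (rule lpa_ideal_left[OF I Suc.prems(2)])
      ultimately show "xstar e * x \<in> J" by (rule Suc.hyps(1))
    qed
    finally show ?thesis using lpa_eq_ideal[OF F(3) J] by blast
  next
    case False
    then have neg: "n \<le> - 1" using Suc.hyps(2) by simp
    obtain F where F: "finite F" "F \<subseteq> edges G" "x \<approx> x * range_sum F"
      using negative_degree[OF aug Suc.prems(1) neg] by blast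
    have "x * range_sum F = (\<Sum>e\<in>F. (x * xs e) * xstar e)"
      by (simp add: range_sum_def sum_distrib_left mult.assoc)
    also have "\<dots> \<in> J"
    proof (rule lpa_ideal_sum[OF J], rule lpa_ideal_right[OF J])
      fix e
      have "k = nat \<bar>n + 1\<bar>" using Suc.hyps(2) neg by simp
      moreover have "homogeneous (n + 1) (x * xs e)"
        by (rule homogeneous_mult[OF Suc.prems(1)]) simp
      moreover have "x * xs e \<in> I" by (rule lpa_ideal_right[OF I Suc.prems(2)])
      ultimately show "x * xs e \<in> J" by (rule Suc.hyps(1))
    qed
    finally show ?thesis using lpa_eq_ideal[OF F(3) J] by blast
  qed
qed

end

theorem graded_ideal_subset:
  fixes I J :: "('v, 'e, 'k::field) gen_poly set"
  assumes I: "lpa_ideal G I" "graded I" and J: "lpa_ideal G J"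
    and sets: "\<And>A. A \<in> gverts G \<Longrightarrow> xp A \<in> I \<Longrightarrow> xp A \<in> J"
    and breaking: "\<And>w. w \<in> breaking G (ideal_sets I) \<Longrightarrow>
      breaking_gen G (ideal_sets I) w \<in> I \<Longrightarrow> breaking_gen G (ideal_sets I) w \<in> J"
  shows "I \<subseteq> J"
proof
  fix x assume x: "x \<in> I"
  show "x \<in> J"
  proof (rule graded_inI[OF J])
    fix n
    have "degree_part n x \<in> I" using x I(2) by (auto simp: graded_def)
    then show "degree_part n x \<in> J"
      by (intro homogeneous_gap[OF I(1) J sets breaking homogeneous_degree_part]) auto
  qed
qed

end


section \<open>Prime ideals\<close>

text \<open>Primeness in terms of elements. As \<open>x\<close> ranges over a unital ring, the premise includes \<open>a b \<in> I\<close>.\<close>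

definition prime_lpa_ideal :: "('v, 'e) ultragraph \<Rightarrow> ('v, 'e, 'k::field) gen_poly set \<Rightarrow> bool" where
  "prime_lpa_ideal G I \<longleftrightarrow> lpa_ideal G I \<and> I \<noteq> aug \<and>
     (\<forall>a\<in>aug. \<forall>b\<in>aug. (\<forall>x. a * x * b \<in> I) \<longrightarrow> a \<in> I \<or> b \<in> I)"

text \<open>The encoding of \<open>I\<^bsub>(H,S)\<^esub>\<close>.\<close>

definition pair_ideal ::
  "('v, 'e) ultragraph \<Rightarrow> 'v set set \<Rightarrow> 'v set \<Rightarrow> ('v, 'e, 'k::field) gen_poly set" where
  "pair_ideal G H S = lpa_gen G (xp ` H \<union> breaking_gen G H ` S)"

text \<open>If \<open>a x b \<in> I\<close> for all \<open>x\<close>, then the product of the ideals generated by \<open>a\<close> and \<open>b\<close> over \<open>I\<close> is contained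
  in \<open>I\<close>.\<close>

lemma product_gen:
  assumes I: "lpa_ideal G I" and ab: "a \<in> aug" "b \<in> aug" "\<And>x. a * x * b \<in> I"
    and u: "u \<in> lpa_gen G (insert a I)" and v: "v \<in> lpa_gen G (insert b I)"
  shows "u * v \<in> I"
proof -
  define J where "J = {x\<in>aug. \<forall>y. x * y * b \<in> I}"
  define K where "K = {z\<in>aug. \<forall>x\<in>J. \<forall>y. x * y * z \<in> I}"
  have sub: "I \<subseteq> aug" by (rule lpa_ideal_subset_aug[OF I])
  note ideal = lpa_ideal_zero[OF I] lpa_ideal_add[OF I] lpa_ideal_left[OF I] lpa_ideal_right[OF I]
  have IJ: "I \<subseteq> J" using sub by (auto simp: J_def intro: ideal)
  have "c * x * y * b \<in> I \<and> x * c * y * b \<in> I" if "x \<in> J" for x y c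
  proof -
    have "c * (x * y * b) \<in> I" "x * (c * y) * b \<in> I" using that by (auto simp: J_def intro: ideal)
    then show ?thesis by (simp add: mult.assoc)
  qed
  then have "ring_ideal J"
    unfolding ring_ideal_def using ring_ideal_aug
    by (auto simp: J_def distrib_right ideal)
  then have J: "lpa_ideal G J"
    using I IJ unfolding lpa_ideal_def by (auto simp: J_def)
  have IK: "I \<subseteq> K" using sub by (auto simp: K_def intro: ideal)
  have "x * y * (c * z) \<in> I \<and> x * y * (z * c) \<in> I" if "x \<in> J" "z \<in> K" for x y z c
  proof -
    have "x * (y * c) * z \<in> I" "x * y * z * c \<in> I" using that by (auto simp: K_def intro: ideal)
    then show ?thesis by (simp add: mult.assoc)
  qed
  then have "ring_ideal K"
    unfolding ring_ideal_def using ring_ideal_aug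
    by (auto simp: K_def distrib_left ideal)
  then have K: "lpa_ideal G K"
    using I IK unfolding lpa_ideal_def by (auto simp: K_def)
  have "u \<in> J" using lpa_gen_least[OF J, of "insert a I"] u IJ ab by (auto simp: J_def)
  moreover have "b \<in> K" using ab by (auto simp: K_def J_def)
  then have "v \<in> K" using lpa_gen_least[OF K, of "insert b I"] v IK by auto
  ultimately have "u * 1 * v \<in> I" unfolding K_def by blast
  then show ?thesis by simp
qed

lemma prime_lpa_ideal_iff:
  "prime_lpa_ideal G I \<longleftrightarrow> lpa_ideal G I \<and> I \<noteq> aug \<and>
     (\<forall>J K. lpa_ideal G J \<and> lpa_ideal G K \<and> (\<forall>a\<in>J. \<forall>b\<in>K. a * b \<in> I) \<longrightarrow> J \<subseteq> I \<or> K \<subseteq> I)"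
  (is "?L \<longleftrightarrow> ?R")
proof
  assume L: ?L
  have "J \<subseteq> I \<or> K \<subseteq> I" if JK: "lpa_ideal G J" "lpa_ideal G K" "\<forall>a\<in>J. \<forall>b\<in>K. a * b \<in> I" for J K
  proof (rule ccontr)
    assume "\<not> (J \<subseteq> I \<or> K \<subseteq> I)"
    then obtain a b where ab: "a \<in> J" "a \<notin> I" "b \<in> K" "b \<notin> I" by blast
    have "a * x * b \<in> I" for x using JK(3) lpa_ideal_right[OF JK(1) ab(1)] ab(3) by blast
    moreover have "a \<in> aug" "b \<in> aug" using ab JK lpa_ideal_subset_aug by blast+
    ultimately show False using L ab unfolding prime_lpa_ideal_def by blast
  qed
  then show ?R using L unfolding prime_lpa_ideal_def by blast
next
  assume R: ?R
  have "a \<in> I \<or> b \<in> I" if ab: "a \<in> aug" "b \<in> aug" "\<forall>x. a * x * b \<in> I" for a b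
  proof -
    have I: "lpa_ideal G I" using R by blast
    have sub: "insert a I \<subseteq> aug" "insert b I \<subseteq> aug" using ab lpa_ideal_subset_aug[OF I] by auto
    have "\<forall>u\<in>lpa_gen G (insert a I). \<forall>v\<in>lpa_gen G (insert b I). u * v \<in> I"
      using product_gen[OF I ab(1,2)] ab(3) by blast
    then have "lpa_gen G (insert a I) \<subseteq> I \<or> lpa_gen G (insert b I) \<subseteq> I"
      using R lpa_gen_ideal[OF sub(1)] lpa_gen_ideal[OF sub(2)] by blast
    then show ?thesis using lpa_gen_superset[of "insert a I" G] lpa_gen_superset[of "insert b I" G] by blast
  qed
  then show ?L using R unfolding prime_lpa_ideal_def by blast
qed

context ultragraph
begin

lemma breaking_gen_aug [simp]: "breaking_gen G H w \<in> aug"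
  unfolding breaking_gen_def by (intro aug_diff aug_sum aug_right) simp_all

lemma ideal_sets_hereditary:
  fixes I :: "('v, 'e, 'k::field) gen_poly set"
  assumes I: "lpa_ideal G I"
  shows "hereditary G (ideal_sets I)"
  unfolding hereditary_def
proof (intro conjI ballI impI)
  show "ideal_sets I \<subseteq> gverts G" by (auto simp: ideal_sets_def)
  show "{} \<in> ideal_sets I"
    using lpa_eq_ideal[OF p_empty I] lpa_ideal_zero[OF I] by (simp add: ideal_sets_def gverts.empty)
next
  fix e assume e: "e \<in> edges G" "{src G e} \<in> ideal_sets I"
  have "xstar e * xp {src G e} * xs e \<in> I"
    using e by (intro lpa_ideal_right[OF I] lpa_ideal_left[OF I]) (auto simp: ideal_sets_def)
  moreover have "xstar e * xp {src G e} * xs e \<approx> (xp (rng G e) :: ('v, 'e, 'k) gen_poly)"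
    using lpa_eq_trans[OF lpa_eq_right[OF t_p[OF e(1)]] t_s_same[OF e(1)]] .
  ultimately show "rng G e \<in> ideal_sets I"
    using lpa_eq_ideal[OF _ I] gverts.range[OF e(1)] by (auto simp: ideal_sets_def)
next
  fix A B assume "A \<in> ideal_sets I" "B \<in> ideal_sets I"
  then show "A \<union> B \<in> ideal_sets I"
    using ideal_p_union[OF I, of A B 1] by (auto simp: ideal_sets_def intro: gverts.union)
next
  fix A B assume "A \<in> ideal_sets I" "B \<in> gverts G" "B \<subseteq> A"
  then show "B \<in> ideal_sets I"
    using ideal_p_sub'[OF I, of A B] by (auto simp: ideal_sets_def)
qed

lemma ideal_sets_saturated:
  fixes I :: "('v, 'e, 'k::field) gen_poly set"
  assumes I: "lpa_ideal G I"
  shows "saturated G (ideal_sets I)"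
  unfolding saturated_def
proof (intro ballI impI, elim conjE)
  fix v assume v: "v \<in> verts G" "emitted G v \<noteq> {}" "finite (emitted G v)"
    "\<forall>e\<in>emitted G v. rng G e \<in> ideal_sets I"
  have "(range_sum (emitted G v) :: ('v, 'e, 'k) gen_poly) \<in> I"
    by (rule range_sum_in_ideal[OF I]) (use v in \<open>auto simp: emitted_def ideal_sets_def\<close>)
  then have "xp {v} \<in> I"
    using lpa_eq_ideal[OF ck[OF v(1-3)] I] by (simp add: range_sum_def)
  then show "{v} \<in> ideal_sets I" using v by (simp add: ideal_sets_def gverts.vertex)
qed

text \<open>A graded ideal is generated by the elements \<open>p\<^sub>A\<close> and \<open>p\<^sub>w\<^sup>H\<close> that it contains.\<close>

theorem graded_ideal_eq_pair_ideal:
  fixes I :: "('v, 'e, 'k::field) gen_poly set"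
  assumes "lpa_ideal G I" "graded I"
  shows "I = pair_ideal G (ideal_sets I)
    {w \<in> breaking G (ideal_sets I). breaking_gen G (ideal_sets I) w \<in> I}" (is "I = pair_ideal G ?H ?S")
proof
  have aug: "xp ` ?H \<union> breaking_gen G ?H ` ?S \<subseteq> (aug :: ('v, 'e, 'k) gen_poly set)" by auto
  have sup: "xp ` ?H \<union> breaking_gen G ?H ` ?S \<subseteq> (pair_ideal G ?H ?S :: ('v, 'e, 'k) gen_poly set)"
    unfolding pair_ideal_def by (rule lpa_gen_superset)
  show "I \<subseteq> pair_ideal G ?H ?S"
  proof (rule graded_ideal_subset[OF assms])
    show "lpa_ideal G (pair_ideal G ?H ?S :: ('v, 'e, 'k) gen_poly set)" unfolding pair_ideal_def by (rule lpa_gen_ideal[OF aug])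
  qed (use sup in \<open>auto simp: ideal_sets_def\<close>)
  show "pair_ideal G ?H ?S \<subseteq> I"
    unfolding pair_ideal_def by (rule lpa_gen_least[OF assms(1)]) (auto simp: ideal_sets_def)
qed


subsection \<open>Paths in monomials\<close>

lemma reaches_subset: "reaches G A B \<Longrightarrow> C \<subseteq> B \<Longrightarrow> reaches G A C"
  unfolding reaches_def by blast

lemma reaches_path:
  assumes "is_path G es" "src G (hd es) \<in> A" "B \<subseteq> rng G (last es)"
  shows "reaches G A B"
  using assms unfolding reaches_def by blast

lemma not_path_step:
  assumes "e \<in> edges G" "f \<in> edges G" "src G f \<notin> rng G e"
  shows "xs e * xs f \<approx> (0 :: ('v, 'e, 'k::field) gen_poly)"
proof -
  have "xs e * xs f \<approx> (xs e * xp (rng G e)) * (xs f :: ('v, 'e, 'k) gen_poly)"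
    by (rule lpa_eq_right[OF lpa_eq_sym[OF s_p[OF assms(1)]]])
  also have "\<dots> = xs e * (xp (rng G e) * xs f)" by (simp add: mult.assoc)
  also have "\<dots> \<approx> xs e * 0"
    using lpa_eq_left[OF p_s_cases[OF gverts.range[OF assms(1)] assms(2)]] assms(3) by simp
  finally show ?thesis by simp
qed

lemma is_path_Cons: "is_path G (e # f # es) \<longleftrightarrow> e \<in> edges G \<and> src G f \<in> rng G e \<and> is_path G (f # es)"
  by (auto simp: is_path_def)

lemma mono_not_path_left:
  assumes "set \<alpha> \<subseteq> edges G" "\<alpha> \<noteq> []" "\<not> is_path G \<alpha>"
  shows "(mono \<alpha> D \<beta> :: ('v, 'e, 'k::field) gen_poly) \<approx> 0"
  using assms
proof (induction \<alpha> rule: induct_list012)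
  case (3 e f es)
  show ?case
  proof (cases "src G f \<in> rng G e")
    case True
    then have "mono (f # es) D \<beta> \<approx> (0 :: ('v, 'e, 'k) gen_poly)"
      using 3 by (intro "3.IH"(2)) (auto simp: is_path_Cons)
    from lpa_eq_left[OF this, of "xs e"] show ?thesis by (simp add: mono_Cons_left)
  next
    case False
    then have "(xs e * xs f) * mono es D \<beta> \<approx> (0 * mono es D \<beta> :: ('v, 'e, 'k) gen_poly)"
      using 3 by (intro lpa_eq_right not_path_step) auto
    then show ?thesis by (simp add: mono_Cons_left mult.assoc)
  qed
qed (auto simp: is_path_def)

lemma mono_range_left:
  assumes "set \<alpha> \<subseteq> edges G" "\<alpha> \<noteq> []" "D \<in> gverts G"
  shows "(mono \<alpha> D \<beta> :: ('v, 'e, 'k::field) gen_poly) \<approx> mono \<alpha> (rng G (last \<alpha>) \<inter> D) \<beta>"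
  using assms(2,1)
proof (induction \<alpha> rule: list_nonempty_induct)
  case (single e)
  then have e: "e \<in> edges G" by simp
  have "(mono [e] D \<beta> :: ('v, 'e, 'k) gen_poly) \<approx> (xs e * xp (rng G e)) * mono [] D \<beta>"
    unfolding mono_Cons_left by (rule lpa_eq_right[OF lpa_eq_sym[OF s_p[OF e]]])
  also have "\<dots> \<approx> xs e * mono [] (rng G e \<inter> D) \<beta>"
    unfolding mult.assoc using lpa_eq_left[OF p_mono[OF gverts.range[OF e] assms(3), of "[]" \<beta>]] by simp
  finally show ?case by (simp add: mono_Cons_left)
next
  case (cons e es)
  then show ?case using lpa_eq_left[OF cons.IH, of "xs e"] by (simp add: mono_Cons_left)
qed

text \<open>Multiplying \<open>s\<^sub>\<alpha> p\<^sub>D s\<^sub>\<beta>\<^sup>*\<close> by \<open>p\<^sub>A\<close> kills it or leaves \<open>s\<^sub>\<alpha> p\<^bsub>D'\<^esub> s\<^sub>\<beta>\<^sup>*\<close> with \<open>A \<ge> D'\<close>.\<close>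

lemma p_mono_reaches:
  assumes "A \<in> gverts G" "D \<in> gverts G" "set \<alpha> \<subseteq> edges G"
  shows "(xp A * mono \<alpha> D \<beta> :: ('v, 'e, 'k::field) gen_poly) \<approx> 0 \<or>
    (\<exists>D'\<in>gverts G. D' \<subseteq> D \<and> reaches G A D' \<and>
      (xp A * mono \<alpha> D \<beta> :: ('v, 'e, 'k) gen_poly) \<approx> mono \<alpha> D' \<beta>)"
proof -
  note eq = p_mono[OF assms, of \<beta>, where 'k = 'k]
  consider "\<alpha> = []" | "\<alpha> \<noteq> []" "is_path G \<alpha>" "src G (hd \<alpha>) \<in> A" |
    "\<alpha> \<noteq> []" "src G (hd \<alpha>) \<notin> A" | "\<alpha> \<noteq> []" "\<not> is_path G \<alpha>" by blast
  then show ?thesis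
  proof cases
    case 1
    then show ?thesis
      using eq gverts.inter[OF assms(1,2)] by (intro disjI2 bexI[of _ "A \<inter> D"]) (auto simp: reaches_def)
  next
    case 2
    let ?D = "rng G (last \<alpha>) \<inter> D"
    have "last \<alpha> \<in> edges G" using 2 assms by auto
    then have D: "?D \<in> gverts G" using assms by (intro gverts.inter gverts.range)
    have "reaches G A ?D" by (rule reaches_path[OF 2(2,3)]) simp
    moreover have "(xp A * mono \<alpha> D \<beta> :: ('v, 'e, 'k) gen_poly) \<approx> mono \<alpha> ?D \<beta>"
      using lpa_eq_trans[OF _ mono_range_left[OF assms(3) 2(1) assms(2)]] eq 2 by simp
    ultimately show ?thesis using D by blast
  next
    case 3
    then show ?thesis using eq by simp
  next
    case 4
    then show ?thesis
      using lpa_eq_left[OF mono_not_path_left[OF assms(3) 4, where 'k = 'k], where x = "xp A"] by simp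
  qed
qed

lemma mono_p_reaches:
  assumes "B \<in> gverts G" "D \<in> gverts G" "set \<beta> \<subseteq> edges G"
  shows "(mono \<alpha> D \<beta> * xp B :: ('v, 'e, 'k::field) gen_poly) \<approx> 0 \<or>
    (\<exists>D'\<in>gverts G. D' \<subseteq> D \<and> reaches G B D' \<and>
      (mono \<alpha> D \<beta> * xp B :: ('v, 'e, 'k) gen_poly) \<approx> mono \<alpha> D' \<beta>)"
proof -
  have flip: "mono \<alpha> D \<beta> * xp B \<approx> (flip y :: ('v, 'e, 'k) gen_poly)" if "xp B * mono \<beta> D \<alpha> \<approx> y" for y
    using lpa_eq_flip[OF that] by simp
  from p_mono_reaches[OF assms, of \<alpha>, where 'k = 'k] show ?thesis
    using flip[of 0] flip[of "mono \<beta> D' \<alpha>" for D'] by auto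
qed

lemma mono_in_ideal:
  assumes "lpa_ideal G I" "xp D \<in> I"
  shows "mono \<alpha> D \<beta> \<in> I"
  unfolding mono_def by (intro lpa_ideal_right[OF assms(1)] lpa_ideal_left[OF assms(1)] assms(2))


subsection \<open>Necessary conditions for primeness\<close>

text \<open>Any two elements outside a prime ideal are linked by some \<open>s\<^sub>\<alpha> p\<^sub>D s\<^sub>\<beta>\<^sup>*\<close>.\<close>

lemma prime_mono:
  fixes I :: "('v, 'e, 'k::field) gen_poly set"
  assumes "prime_lpa_ideal G I" and a: "a \<in> aug" "a \<notin> I" and b: "b \<in> aug" "b \<notin> I"
  obtains \<alpha> D \<beta> where "set \<alpha> \<subseteq> edges G" "set \<beta> \<subseteq> edges G" "D \<in> gverts G" "a * mono \<alpha> D \<beta> * b \<notin> I"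
proof -
  have I: "lpa_ideal G I" using assms by (simp add: prime_lpa_ideal_def)
  obtain x where x: "a * x * b \<notin> I" using assms unfolding prime_lpa_ideal_def by blast
  obtain A where A: "A \<in> gverts G" "a * xp A \<approx> a" using local_units[OF a(1)] by blast
  have eq: "a * (xp A * x) * b \<approx> a * x * b"
    using lpa_eq_right[OF lpa_eq_right[OF A(2), of x], of b] by (simp add: mult.assoc)
  have x': "a * (xp A * x) * b \<notin> I" using x lpa_eq_ideal[OF eq I] by blast
  have "\<exists>\<alpha> D \<beta>. set \<alpha> \<subseteq> edges G \<and> set \<beta> \<subseteq> edges G \<and> D \<in> gverts G \<and> a * mono \<alpha> D \<beta> * b \<notin> I"
  proof (rule ccontr)
    assume *: "\<nexists>\<alpha> D \<beta>. set \<alpha> \<subseteq> edges G \<and> set \<beta> \<subseteq> edges G \<and> D \<in> gverts G \<and> a * mono \<alpha> D \<beta> * b \<notin> I"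
    have "xp A * x \<in> aug" by simp
    then have "a * (xp A * x) * b \<in> I"
    proof (rule homogeneous_induct[where Q = "\<lambda>_. True" and P = "\<lambda>y. a * y * b \<in> I"])
      show "a * y * b \<in> I" if "y \<approx> z" "a * z * b \<in> I" for y z
        using that lpa_eq_ideal[OF lpa_eq_right[OF lpa_eq_left[OF that(1)]] I] by blast
      show "a * 0 * b \<in> I" using lpa_ideal_zero[OF I] by simp
      show "a * (y + z) * b \<in> I" if "a * y * b \<in> I" "a * z * b \<in> I" for y z
        using lpa_ideal_add[OF I that] by (simp add: algebra_simps)
      show "a * (scal c * mono \<alpha> D \<beta>) * b \<in> I"
        if "set \<alpha> \<subseteq> edges G" "set \<beta> \<subseteq> edges G" "D \<in> gverts G" for c :: 'k and \<alpha> D \<beta>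
      proof -
        have "a * mono \<alpha> D \<beta> * b \<in> I" using * that by blast
        then have "scal c * (a * mono \<alpha> D \<beta> * b) \<in> I" by (rule lpa_ideal_left[OF I])
        then show ?thesis by (simp add: scal_left mult.assoc)
      qed
    qed simp
    then show False using x' by blast
  qed
  then show ?thesis using that by blast
qed

lemma prime_downward_directed:
  fixes I :: "('v, 'e, 'k::field) gen_poly set"
  assumes "prime_lpa_ideal G I"
  shows "downward_directed G (gverts G - ideal_sets I)"
  unfolding downward_directed_def
proof (intro conjI ballI)
  have I: "lpa_ideal G I" using assms by (simp add: prime_lpa_ideal_def)
  show "gverts G - ideal_sets I \<noteq> {}"
  proof
    assume *: "gverts G - ideal_sets I = {}"
    have "aug \<subseteq> I"
    proof
      fix x :: "('v, 'e, 'k) gen_poly" assume "x \<in> aug"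
      then obtain A where A: "A \<in> gverts G" "xp A * x \<approx> x" using local_units by blast
      have "xp A * x \<in> I" using * A by (intro lpa_ideal_right[OF I]) (auto simp: ideal_sets_def)
      then show "x \<in> I" using lpa_eq_ideal[OF A(2) I] by blast
    qed
    then show False using assms lpa_ideal_subset_aug[OF I] by (auto simp: prime_lpa_ideal_def)
  qed
  show "gverts G - ideal_sets I \<subseteq> gverts G" by blast
  fix A B assume A: "A \<in> gverts G - ideal_sets I" and B: "B \<in> gverts G - ideal_sets I"
  have AB: "xp A \<notin> I" "xp B \<notin> I" using A B by (auto simp: ideal_sets_def)
  obtain \<alpha> D \<beta> where m: "set \<alpha> \<subseteq> edges G" "set \<beta> \<subseteq> edges G" "D \<in> gverts G"
    "xp A * mono \<alpha> D \<beta> * xp B \<notin> I"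
    by (rule prime_mono[OF assms aug_simps(1) AB(1) aug_simps(1) AB(2)])
  have "\<not> xp A * mono \<alpha> D \<beta> \<approx> (0 :: ('v, 'e, 'k) gen_poly)"
  proof
    assume "xp A * mono \<alpha> D \<beta> \<approx> (0 :: ('v, 'e, 'k) gen_poly)"
    then have "xp A * mono \<alpha> D \<beta> * xp B \<approx> (0 * xp B :: ('v, 'e, 'k) gen_poly)" by (rule lpa_eq_right)
    then show False using m(4) lpa_eq_ideal[OF _ I] lpa_ideal_zero[OF I] by auto
  qed
  then obtain D' where D': "D' \<in> gverts G" "reaches G A D'"
    "xp A * mono \<alpha> D \<beta> \<approx> (mono \<alpha> D' \<beta> :: ('v, 'e, 'k) gen_poly)"
    using p_mono_reaches[OF _ m(3,1), of A \<beta>, where 'k = 'k] A by blast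
  have "mono \<alpha> D' \<beta> * xp B \<notin> I"
    using m(4) lpa_eq_ideal[OF lpa_eq_right[OF D'(3)] I] by blast
  then obtain D'' where D'': "D'' \<in> gverts G" "D'' \<subseteq> D'" "reaches G B D''"
    "mono \<alpha> D' \<beta> * xp B \<approx> (mono \<alpha> D'' \<beta> :: ('v, 'e, 'k) gen_poly)"
    using mono_p_reaches[OF _ D'(1) m(2), of B \<alpha>, where 'k = 'k] B
      lpa_eq_ideal[OF _ I] lpa_ideal_zero[OF I] by blast
  have "xp D'' \<notin> I"
    using \<open>mono \<alpha> D' \<beta> * xp B \<notin> I\<close> lpa_eq_ideal[OF D''(4) I] mono_in_ideal[OF I] by blast
  then have "D'' \<in> gverts G - ideal_sets I" using D'' by (auto simp: ideal_sets_def)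
  moreover have "D'' \<noteq> {}" using \<open>xp D'' \<notin> I\<close> lpa_eq_ideal[OF p_empty I] lpa_ideal_zero[OF I] by auto
  ultimately show "\<exists>C\<in>gverts G - ideal_sets I. C \<noteq> {} \<and> reaches G A C \<and> reaches G B C"
    using D'' reaches_subset[OF D'(2) D''(2)] by blast
qed

lemma breaking_gen_eq: "breaking_gen G H w = xp {w} - range_sum {e \<in> emitted G w. rng G e \<notin> H}"
  by (simp add: breaking_gen_def range_sum_def)

lemma breaking_edges:
  assumes "w \<in> breaking G H"
  shows "finite {e \<in> emitted G w. rng G e \<notin> H}" "{e \<in> emitted G w. rng G e \<notin> H} \<subseteq> edges G"
    "w \<in> verts G" "{w} \<in> gverts G"
  using assms by (auto simp: breaking_def emitted_def gverts.vertex)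

lemma p_breaking_gen:
  assumes "w \<in> breaking G H" "D \<in> gverts G"
  shows "xp D * breaking_gen G H w \<approx> (if w \<in> D then breaking_gen G H w else (0 :: ('v, 'e, 'k::field) gen_poly))"
proof -
  note fin = breaking_edges[OF assms(1)]
  let ?E = "{e \<in> emitted G w. rng G e \<notin> H}"
  have "xp D * breaking_gen G H w = xp D * xp {w} - xp D * (range_sum ?E :: ('v, 'e, 'k) gen_poly)"
    by (simp add: breaking_gen_eq right_diff_distrib)
  also have "\<dots> \<approx> xp (D \<inter> {w}) - range_sum {e \<in> ?E. src G e \<in> D}"
    by (intro lpa_eq_diff p_mult p_range_sum fin assms)
  finally have eq: "xp D * breaking_gen G H w \<approx>
    (xp (D \<inter> {w}) - range_sum {e \<in> ?E. src G e \<in> D} :: ('v, 'e, 'k) gen_poly)" .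
  show ?thesis
  proof (cases "w \<in> D")
    case True
    then have "{e \<in> ?E. src G e \<in> D} = ?E" "D \<inter> {w} = {w}" by (auto simp: emitted_def)
    then show ?thesis using eq True by (simp add: breaking_gen_eq)
  next
    case False
    then have s: "{e \<in> ?E. src G e \<in> D} = {}" "D \<inter> {w} = {}" by (auto simp: emitted_def)
    have "xp D * breaking_gen G H w \<approx> (xp {} :: ('v, 'e, 'k) gen_poly)"
      using eq unfolding s by (simp add: range_sum_def)
    also have "\<dots> \<approx> 0" by (rule p_empty)
    finally show ?thesis using False by simp
  qed
qed

lemma flip_breaking_gen [simp]: "flip (breaking_gen G H w) = breaking_gen G H w"
  by (simp add: breaking_gen_eq)

lemma breaking_gen_p:
  assumes "w \<in> breaking G H" "D \<in> gverts G"
  shows "breaking_gen G H w * xp D \<approx> (if w \<in> D then breaking_gen G H w else (0 :: ('v, 'e, 'k::field) gen_poly))"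
  using lpa_eq_flip[OF p_breaking_gen[OF assms, where 'k = 'k]] by (auto split: if_splits)

lemma t_breaking_gen_zero:
  assumes w: "w \<in> breaking G H" and f: "f \<in> edges G" "rng G f \<notin> H"
  shows "xstar f * breaking_gen G H w \<approx> (0 :: ('v, 'e, 'k::field) gen_poly)"
proof -
  note fin = breaking_edges[OF w]
  let ?E = "{e \<in> emitted G w. rng G e \<notin> H}"
  have "xstar f * breaking_gen G H w = xstar f * xp {w} - xstar f * (range_sum ?E :: ('v, 'e, 'k) gen_poly)"
    by (simp add: breaking_gen_eq right_diff_distrib)
  also have "\<dots> \<approx> (if src G f \<in> {w} then xstar f else 0) - (if f \<in> ?E then xstar f else 0)"
    using t_range_sum[OF fin(1,2), of f] t_range_sum_out[OF fin(1,2) f(1)]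
    by (intro lpa_eq_diff t_p_cases fin f) auto
  also have "\<dots> = 0" using f by (auto simp: emitted_def)
  finally show ?thesis .
qed

text \<open>Modulo an ideal, \<open>p\<^sub>w\<^sup>H\<close> is annihilated by all edges: those with range in \<open>H\<close> lie in the ideal, the others
  annihilate it already in the path algebra.\<close>

lemma t_breaking_gen:
  fixes I :: "('v, 'e, 'k::field) gen_poly set"
  assumes I: "lpa_ideal G I" "H = ideal_sets I" and w: "w \<in> breaking G H" and f: "f \<in> edges G"
  shows "xstar f * breaking_gen G H w \<in> I" "breaking_gen G H w * xs f \<in> I"
proof -
  have "xstar f * breaking_gen G H w \<in> I \<and> breaking_gen G H w * xs f \<in> I"
  proof (cases "rng G f \<in> H")
    case True
    then have r: "xp (rng G f) \<in> I" using I by (simp add: ideal_sets_def)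
    have "xp (rng G f) * xstar f \<in> I" "xs f * xp (rng G f) \<in> I"
      by (intro lpa_ideal_right[OF I(1)] r, intro lpa_ideal_left[OF I(1)] r)
    then have "xstar f \<in> I" "xs f \<in> I"
      using lpa_eq_ideal[OF p_t[OF f] I(1)] lpa_eq_ideal[OF s_p[OF f] I(1)] by auto
    then show ?thesis using lpa_ideal_left[OF I(1)] lpa_ideal_right[OF I(1)] by blast
  next
    case False
    note eq = t_breaking_gen_zero[OF w f False, where 'k = 'k]
    show ?thesis
      using lpa_eq_ideal[OF eq I(1)] lpa_eq_ideal[OF lpa_eq_flip[OF eq] I(1)] lpa_ideal_zero[OF I(1)]
      by simp
  qed
  then show "xstar f * breaking_gen G H w \<in> I" "breaking_gen G H w * xs f \<in> I" by auto
qed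

lemma mono_breaking_gen:
  fixes I :: "('v, 'e, 'k::field) gen_poly set"
  assumes I: "lpa_ideal G I" "H = ideal_sets I" and w: "w \<in> breaking G H"
    and m: "set \<beta> \<subseteq> edges G" "D \<in> gverts G" "mono \<alpha> D \<beta> * breaking_gen G H w \<notin> I"
  shows "\<beta> = []" "w \<in> D"
proof -
  show \<beta>: "\<beta> = []"
  proof (rule ccontr)
    assume "\<beta> \<noteq> []"
    then obtain f \<beta>' where f: "\<beta> = f # \<beta>'" by (cases \<beta>) auto
    have "mono \<alpha> D \<beta>' * (xstar f * breaking_gen G H w) \<in> I"
      by (rule lpa_ideal_left[OF I(1) t_breaking_gen(1)[OF I w]]) (use m f in auto)
    then show False using m f by (simp add: mono_Cons_right mult.assoc)
  qed
  show "w \<in> D"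
  proof (rule ccontr)
    assume "w \<notin> D"
    then have "prod_list (map xs \<alpha>) * (xp D * breaking_gen G H w) \<approx> (prod_list (map xs \<alpha>) * 0 :: ('v, 'e, 'k) gen_poly)"
      using lpa_eq_left[OF p_breaking_gen[OF w m(2)]] by simp
    then have "mono \<alpha> D [] * breaking_gen G H w \<approx> (0 :: ('v, 'e, 'k) gen_poly)"
      by (simp add: mono_def mult.assoc)
    then show False using m(3) lpa_eq_ideal[OF _ I(1)] lpa_ideal_zero[OF I(1)] \<beta> by blast
  qed
qed

lemma prime_breaking_reaches:
  fixes I :: "('v, 'e, 'k::field) gen_poly set"
  assumes prime: "prime_lpa_ideal G I" and H: "H = ideal_sets I"
    and w: "w \<in> breaking G H" "breaking_gen G H w \<notin> I" and A: "A \<in> gverts G - H"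
  shows "reaches G A {w}"
proof -
  have I: "lpa_ideal G I" using prime by (simp add: prime_lpa_ideal_def)
  have nA: "xp A \<notin> I" using A H by (auto simp: ideal_sets_def)
  obtain \<alpha> D \<beta> where m: "set \<alpha> \<subseteq> edges G" "set \<beta> \<subseteq> edges G" "D \<in> gverts G"
    "xp A * mono \<alpha> D \<beta> * breaking_gen G H w \<notin> I"
    by (rule prime_mono[OF prime aug_simps(1) nA breaking_gen_aug w(2)])
  have "\<not> xp A * mono \<alpha> D \<beta> \<approx> (0 :: ('v, 'e, 'k) gen_poly)"
  proof
    assume "xp A * mono \<alpha> D \<beta> \<approx> (0 :: ('v, 'e, 'k) gen_poly)"
    then have "xp A * mono \<alpha> D \<beta> * breaking_gen G H w \<approx> (0 * breaking_gen G H w :: ('v, 'e, 'k) gen_poly)"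
      by (rule lpa_eq_right)
    then show False using m(4) lpa_eq_ideal[OF _ I] lpa_ideal_zero[OF I] by auto
  qed
  then obtain D' where D': "D' \<in> gverts G" "reaches G A D'"
    "xp A * mono \<alpha> D \<beta> \<approx> (mono \<alpha> D' \<beta> :: ('v, 'e, 'k) gen_poly)"
    using p_mono_reaches[OF _ m(3,1), of A \<beta>, where 'k = 'k] A by blast
  have "mono \<alpha> D' \<beta> * breaking_gen G H w \<notin> I"
    using m(4) lpa_eq_ideal[OF lpa_eq_right[OF D'(3)] I] by blast
  then have "w \<in> D'" using mono_breaking_gen[OF I H w(1) m(2) D'(1)] by blast
  then show ?thesis using reaches_subset[OF D'(2)] by blast
qed

lemma prime_breaking_unique:
  fixes I :: "('v, 'e, 'k::field) gen_poly set"
  assumes prime: "prime_lpa_ideal G I" and H: "H = ideal_sets I"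
    and w: "w \<in> breaking G H" "breaking_gen G H w \<notin> I"
    and v: "v \<in> breaking G H" "breaking_gen G H v \<notin> I"
  shows "v = w"
proof (rule ccontr)
  assume "v \<noteq> w"
  have I: "lpa_ideal G I" using prime by (simp add: prime_lpa_ideal_def)
  obtain \<alpha> D \<beta> where m: "set \<alpha> \<subseteq> edges G" "set \<beta> \<subseteq> edges G" "D \<in> gverts G"
    "breaking_gen G H v * mono \<alpha> D \<beta> * breaking_gen G H w \<notin> I"
    by (rule prime_mono[OF prime breaking_gen_aug v(2) breaking_gen_aug w(2)])
  have "mono \<alpha> D \<beta> * breaking_gen G H w \<notin> I"
    using m(4) lpa_ideal_left[OF I, of "mono \<alpha> D \<beta> * breaking_gen G H w" "breaking_gen G H v"]
    by (auto simp: mult.assoc)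
  then have \<beta>: "\<beta> = []" "w \<in> D" using mono_breaking_gen[OF I H w(1) m(2,3)] by blast+
  have \<alpha>: "\<alpha> = []"
  proof (rule ccontr)
    assume "\<alpha> \<noteq> []"
    then obtain f \<alpha>' where f: "\<alpha> = f # \<alpha>'" by (cases \<alpha>) auto
    have "(breaking_gen G H v * xs f) * (mono \<alpha>' D \<beta> * breaking_gen G H w) \<in> I"
      by (rule lpa_ideal_right[OF I t_breaking_gen(2)[OF I H v(1)]]) (use m f in auto)
    then show False using m f by (simp add: mono_Cons_left mult.assoc)
  qed
  note wG = breaking_edges(4)[OF w(1)]
  have "breaking_gen G H v * mono \<alpha> D \<beta> * breaking_gen G H w =
      breaking_gen G H v * (xp D * (breaking_gen G H w :: ('v, 'e, 'k) gen_poly))"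
    by (simp add: \<alpha> \<beta> mult.assoc)
  also have "\<dots> \<approx> breaking_gen G H v * breaking_gen G H w"
    using lpa_eq_left[OF p_breaking_gen[OF w(1) m(3)]] \<beta> by simp
  also have "\<dots> \<approx> breaking_gen G H v * (xp {w} * breaking_gen G H w)"
    using lpa_eq_left[OF lpa_eq_sym[OF p_breaking_gen[OF w(1) wG]]] by simp
  also have "\<dots> = (breaking_gen G H v * xp {w}) * breaking_gen G H w" by (simp add: mult.assoc)
  also have "\<dots> \<approx> 0 * breaking_gen G H w"
    using lpa_eq_right[OF breaking_gen_p[OF v(1) wG]] \<open>v \<noteq> w\<close> by simp
  finally show False using m(4) lpa_eq_ideal[OF _ I] lpa_ideal_zero[OF I] by simp
qed

theorem graded_prime_cases:
  fixes I :: "('v, 'e, 'k::field) gen_poly set"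
  assumes prime: "prime_lpa_ideal G I" and "graded I"
  obtains H where "hereditary G H" "saturated G H" "downward_directed G (gverts G - H)"
      "I = pair_ideal G H (breaking G H)"
  | H w where "hereditary G H" "saturated G H" "w \<in> breaking G H"
      "\<forall>A\<in>gverts G - H. reaches G A {w}" "I = pair_ideal G H (breaking G H - {w})"
proof -
  define H where "H = ideal_sets I"
  define S where "S = {w \<in> breaking G H. breaking_gen G H w \<in> I}"
  have I: "lpa_ideal G I" using prime by (simp add: prime_lpa_ideal_def)
  have H: "hereditary G H" "saturated G H" unfolding H_def
    using ideal_sets_hereditary[OF I] ideal_sets_saturated[OF I] by auto
  have eq: "I = pair_ideal G H S"
    unfolding H_def S_def by (rule graded_ideal_eq_pair_ideal[OF I assms(2)])
  show ?thesis
  proof (cases "S = breaking G H")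
    case True
    show ?thesis
    proof (rule that(1)[OF H])
      show "downward_directed G (gverts G - H)"
        unfolding H_def by (rule prime_downward_directed[OF prime])
      show "I = pair_ideal G H (breaking G H)" using eq unfolding True .
    qed
  next
    case False
    then obtain w where w: "w \<in> breaking G H" "breaking_gen G H w \<notin> I" by (auto simp: S_def)
    have S: "S = breaking G H - {w}"
      unfolding S_def using prime_breaking_unique[OF prime H_def w] w(2) by blast
    show ?thesis
    proof (rule that(2)[OF H w(1)])
      show "\<forall>A\<in>gverts G - H. reaches G A {w}"
        using prime_breaking_reaches[OF prime H_def w] by blast
      show "I = pair_ideal G H (breaking G H - {w})" using eq unfolding S .
    qed
  qed
qed

end


section \<open>Graded ideals and primeness\<close>

lemma degree_part_single_mult:
  "degree_part n (Poly_Mapping.single w c * x) =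
     Poly_Mapping.single w c * degree_part (n - word_degree w) x"
  "degree_part n (x * Poly_Mapping.single w c) =
     degree_part (n - word_degree w) x * Poly_Mapping.single w c"
  by (induction x rule: poly_induct; simp add: part_single mult_single algebra_simps)+

lemma lpa_gen_graded:
  fixes Y :: "('v, 'e, 'k::field) gen_poly set"
  assumes Y: "Y \<subseteq> aug" and parts: "\<And>y n. y \<in> Y \<Longrightarrow> degree_part n y \<in> lpa_gen G Y"
    and rel: "\<And>y n. y \<in> lpa_relators G \<Longrightarrow> degree_part n y \<in> lpa_gen G Y"
  shows "graded (lpa_gen G Y)"
proof -
  define J where "J = {x\<in>aug. \<forall>n. degree_part n x \<in> lpa_gen G Y}"
  have I: "lpa_ideal G (lpa_gen G Y)" by (rule lpa_gen_ideal[OF Y])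
  have "ring_ideal J"
    by (rule ring_idealI_poly)
      (auto simp: J_def degree_part_single_mult lpa_ideal_zero[OF I] lpa_ideal_add[OF I]
        intro: lpa_ideal_left[OF I] lpa_ideal_right[OF I])
  moreover have "lpa_relators G \<subseteq> J" using rel lpa_relators_aug by (auto simp: J_def)
  moreover have "letter g \<in> J" if "g \<notin> gens G" for g
    using I that by (auto simp: J_def part_single lpa_ideal_def lpa_ideal_zero[OF I])
  ultimately have J: "lpa_ideal G J" by (auto simp: lpa_ideal_def J_def)
  have "lpa_gen G Y \<subseteq> J"
    by (rule lpa_gen_least[OF J]) (use Y parts in \<open>auto simp: J_def\<close>)
  then show ?thesis by (auto simp: graded_def J_def)
qed

lemma homogeneous_graded_part:
  assumes "homogeneous m y" "y \<in> I" "0 \<in> I"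
  shows "degree_part n y \<in> I"
  using assms degree_part_homogeneous[OF assms(1)] by simp

lemma homogeneous_products:
  "homogeneous 0 (xp A * xp B)" "homogeneous 0 (xs e * xstar f)" "homogeneous 0 (xstar e * xs f)"
  "homogeneous 1 (xp A * xs e)" "homogeneous 1 (xs e * xp A)"
  "homogeneous (- 1) (xp A * xstar e)" "homogeneous (- 1) (xstar e * xp A)"
  using homogeneous_mult[of 0 "xp A" 0 "xp B"] homogeneous_mult[of 1 "xs e" "- 1" "xstar f"]
    homogeneous_mult[of "- 1" "xstar e" 1 "xs f"]
    homogeneous_mult[of 0 "xp A" 1 "xs e"] homogeneous_mult[of 1 "xs e" 0 "xp A"]
    homogeneous_mult[of 0 "xp A" "- 1" "xstar e"] homogeneous_mult[of "- 1" "xstar e" 0 "xp A"]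
  by simp_all

lemma relators_homogeneous:
  assumes "y \<in> lpa_relators G"
  shows "\<exists>n. homogeneous n y"
proof -
  have "homogeneous 0 y \<or> homogeneous 1 y \<or> homogeneous (- 1) y"
    using assms unfolding lpa_relators_def
    by (auto simp: homogeneous_diff homogeneous_add homogeneous_sum homogeneous_products)
  then show ?thesis by blast
qed

lemma lpa_gen_homogeneous_graded:
  fixes Y :: "('v, 'e, 'k::field) gen_poly set"
  assumes Y: "Y \<subseteq> aug" "\<And>y. y \<in> Y \<Longrightarrow> \<exists>n. homogeneous n y"
  shows "graded (lpa_gen G Y)"
proof (rule lpa_gen_graded[OF Y(1)])
  have I: "lpa_ideal G (lpa_gen G Y)" by (rule lpa_gen_ideal[OF Y(1)])
  show "degree_part n y \<in> lpa_gen G Y" if "y \<in> Y" for y n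
    using Y(2)[OF that] homogeneous_graded_part[OF _ _ lpa_ideal_zero[OF I]] lpa_gen_superset[of Y G] that
    by blast
  show "degree_part n y \<in> lpa_gen G Y" if "y \<in> lpa_relators G" for y n
    using relators_homogeneous[OF that] homogeneous_graded_part[OF _ _ lpa_ideal_zero[OF I]] I that
    by (auto simp: lpa_ideal_def)
qed

lemma insert_homogeneous_graded:
  fixes I :: "('v, 'e, 'k::field) gen_poly set"
  assumes I: "lpa_ideal G I" "graded I" and a: "a \<in> aug" "homogeneous m a"
  shows "graded (lpa_gen G (insert a I))"
proof (rule lpa_gen_graded)
  show sub: "insert a I \<subseteq> aug" using a lpa_ideal_subset_aug[OF I(1)] by auto
  have J: "lpa_ideal G (lpa_gen G (insert a I))" by (rule lpa_gen_ideal[OF sub])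
  have sup: "insert a I \<subseteq> lpa_gen G (insert a I)" by (rule lpa_gen_superset)
  show "degree_part n y \<in> lpa_gen G (insert a I)" if "y \<in> insert a I" for y n
    using that I(2) sup homogeneous_graded_part[OF a(2) _ lpa_ideal_zero[OF J]] by (auto simp: graded_def)
  show "degree_part n y \<in> lpa_gen G (insert a I)" if "y \<in> lpa_relators G" for y n
    using relators_homogeneous[OF that] homogeneous_graded_part[OF _ _ lpa_ideal_zero[OF J]] J that
    by (auto simp: lpa_ideal_def)
qed

lemma top_part_mult:
  fixes a b :: "('v, 'e, 'k::field) gen_poly"
  assumes "\<forall>w\<in>Poly_Mapping.keys a. word_degree w \<le> n" "\<forall>w\<in>Poly_Mapping.keys b. word_degree w \<le> m"
  shows "degree_part (n + m) (a * b) = degree_part n a * degree_part m b"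
  using assms(1)
proof (induction a rule: poly_induct_keys)
  case (single u c)
  show ?case
    using assms(2)
  proof (induction b rule: poly_induct_keys)
    case (single v d)
    then show ?case using \<open>word_degree u \<le> n\<close> by (auto simp: part_single mult_single)
  qed (auto simp: algebra_simps)
qed (auto simp: algebra_simps)

text \<open>Modulo an ideal \<open>I\<close>, an element outside \<open>I\<close> agrees with one whose homogeneous component of highest
  degree is not in \<open>I\<close>.\<close>

lemma leading_part:
  fixes I :: "('v, 'e, 'k::field) gen_poly set"
  assumes I: "lpa_ideal G I" and a: "a \<notin> I"
  obtains n a0 where "a - a0 \<in> I" "\<forall>w\<in>Poly_Mapping.keys a0. word_degree w \<le> n"
    "degree_part n a0 = degree_part n a" "degree_part n a \<notin> I"
proof -
  let ?N = "{n. degree_part n a \<notin> I}"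
  have "?N \<subseteq> word_degree ` Poly_Mapping.keys a"
  proof
    fix n assume "n \<in> ?N"
    show "n \<in> word_degree ` Poly_Mapping.keys a"
    proof (rule ccontr)
      assume "n \<notin> word_degree ` Poly_Mapping.keys a"
      then have "degree_part n a = 0" by (intro part_none) auto
      then show False using \<open>n \<in> ?N\<close> lpa_ideal_zero[OF I] by auto
    qed
  qed
  then have fin: "finite ?N" by (rule finite_subset) simp
  have ne: "?N \<noteq> {}" using graded_inI[OF I, of a] a by auto
  define n where "n = Max ?N"
  have n: "n \<in> ?N" "\<And>k. k > n \<Longrightarrow> degree_part k a \<in> I"
    using Max_in[OF fin ne] Max_ge[OF fin] by (auto simp: n_def not_le[symmetric])
  let ?a0 = "part (\<lambda>w. word_degree w \<le> n) a"
  have "a - ?a0 \<in> I"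
  proof (rule graded_inI[OF I])
    fix k
    have "degree_part k (a - ?a0) = (if k > n then degree_part k a else 0)"
      by (rule poly_mapping_eqI) (auto simp: lookup_part lookup_minus)
    then show "degree_part k (a - ?a0) \<in> I" using n lpa_ideal_zero[OF I] by simp
  qed
  moreover have "degree_part n ?a0 = degree_part n a"
    by (rule poly_mapping_eqI) (auto simp: lookup_part)
  ultimately show ?thesis using n(1) by (intro that[of ?a0 n]) (auto simp: keys_part)
qed

text \<open>Primeness of a graded ideal may be tested on homogeneous elements. If \<open>a\<close> and \<open>b\<close> have leading components
  \<open>a\<^sub>n\<close> and \<open>b\<^sub>m\<close> modulo \<open>I\<close>, then \<open>a\<^sub>n x b\<^sub>m\<close> is the leading component of \<open>a x b\<close> for homogeneous \<open>x\<close>.\<close>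

lemma graded_prime_criterion:
  fixes I :: "('v, 'e, 'k::field) gen_poly set"
  assumes I: "lpa_ideal G I" "graded I" "I \<noteq> aug"
    and hom: "\<And>a b n m. a \<in> aug \<Longrightarrow> b \<in> aug \<Longrightarrow> homogeneous n a \<Longrightarrow> homogeneous m b \<Longrightarrow>
      (\<And>x. a * x * b \<in> I) \<Longrightarrow> a \<in> I \<or> b \<in> I"
  shows "prime_lpa_ideal G I"
  unfolding prime_lpa_ideal_def
proof (intro conjI ballI impI)
  fix a b assume ab: "a \<in> aug" "b \<in> aug" "\<forall>x. a * x * b \<in> I"
  show "a \<in> I \<or> b \<in> I"
  proof (rule ccontr)
    assume "\<not> (a \<in> I \<or> b \<in> I)"
    then have nab: "a \<notin> I" "b \<notin> I" by auto
    obtain n a0 where a0: "a - a0 \<in> I" "\<forall>w\<in>Poly_Mapping.keys a0. word_degree w \<le> n"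
      "degree_part n a0 = degree_part n a" "degree_part n a \<notin> I" by (rule leading_part[OF I(1) nab(1)])
    obtain m b0 where b0: "b - b0 \<in> I" "\<forall>w\<in>Poly_Mapping.keys b0. word_degree w \<le> m"
      "degree_part m b0 = degree_part m b" "degree_part m b \<notin> I" by (rule leading_part[OF I(1) nab(2)])
    have mem: "a0 * x * b0 \<in> I" for x
    proof -
      have "a * x * b - (a - a0) * (x * b) - (a0 * x) * (b - b0) \<in> I"
        using ab(3) a0(1) b0(1)
        by (intro lpa_ideal_diff[OF I(1)] lpa_ideal_left[OF I(1) b0(1)] lpa_ideal_right[OF I(1) a0(1)]) auto
      also have "a * x * b - (a - a0) * (x * b) - (a0 * x) * (b - b0) = a0 * x * b0"
        by (simp add: algebra_simps)
      finally show ?thesis .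
    qed
    have "degree_part n a * x * degree_part m b \<in> I" for x
    proof (induction x rule: poly_induct)
      case zero
      show ?case using lpa_ideal_zero[OF I(1)] by simp
    next
      case (add x y)
      then show ?case using lpa_ideal_add[OF I(1)] by (simp add: distrib_left distrib_right)
    next
      case (single u c)
      let ?x = "Poly_Mapping.single u c" and ?d = "word_degree u"
      have x: "\<forall>w\<in>Poly_Mapping.keys ?x. word_degree w \<le> ?d" by simp
      have ax: "\<forall>w\<in>Poly_Mapping.keys (a0 * ?x). word_degree w \<le> n + ?d"
        using keys_mult[of a0 ?x] a0(2) x by fastforce
      have "degree_part (n + ?d + m) (a0 * ?x * b0) = degree_part n a0 * ?x * degree_part m b0"
        using top_part_mult[OF ax b0(2)] top_part_mult[OF a0(2) x] by (simp add: part_single)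
      moreover have "degree_part (n + ?d + m) (a0 * ?x * b0) \<in> I"
        using mem I(2) by (auto simp: graded_def)
      ultimately show ?case using a0(3) b0(3) by simp
    qed
    then have "degree_part n a \<in> I \<or> degree_part m b \<in> I"
      by (rule hom[OF degree_part_aug[OF ab(1)] degree_part_aug[OF ab(2)]
        homogeneous_degree_part homogeneous_degree_part])
    then show False using a0 b0 by blast
  qed
qed (use I in auto)

context ultragraph
begin

lemma pair_gens_aug: "xp ` H \<union> breaking_gen G H ` S \<subseteq> aug"
  by auto

lemma pair_ideal_ideal: "lpa_ideal G (pair_ideal G H S)"
  unfolding pair_ideal_def by (rule lpa_gen_ideal[OF pair_gens_aug])

lemma pair_ideal_graded: "graded (pair_ideal G H S)"
  unfolding pair_ideal_def
proof (rule lpa_gen_homogeneous_graded[OF pair_gens_aug])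
  fix y :: "('v, 'e, 'k::field) gen_poly" assume "y \<in> xp ` H \<union> breaking_gen G H ` S"
  then have "homogeneous 0 y"
    by (auto simp: breaking_gen_def intro!: homogeneous_diff homogeneous_sum homogeneous_products)
  then show "\<exists>n. homogeneous n y" ..
qed

text \<open>A graded ideal that is strictly larger than the ideal of a pair \<open>(H, S)\<close> contains a new
  element \<open>p\<^sub>A\<close> or \<open>p\<^sub>w\<^sup>H\<close>.\<close>

lemma larger_graded_ideal:
  fixes J :: "('v, 'e, 'k::field) gen_poly set"
  assumes H: "hereditary G H" and sub: "pair_ideal G H S \<subseteq> J" "\<not> J \<subseteq> pair_ideal G H S"
    and J: "lpa_ideal G J" "graded J"
  shows "(\<exists>A\<in>gverts G - H. xp A \<in> J) \<or> (\<exists>w\<in>breaking G H - S. breaking_gen G H w \<in> J)"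
proof (rule ccontr)
  assume *: "\<not> ?thesis"
  have gens: "xp ` H \<union> breaking_gen G H ` S \<subseteq> (pair_ideal G H S :: ('v, 'e, 'k) gen_poly set)"
    unfolding pair_ideal_def by (rule lpa_gen_superset)
  have HJ: "ideal_sets J = H"
    using * H gens sub(1) by (auto simp: ideal_sets_def hereditary_def)
  have "J \<subseteq> pair_ideal G H S"
  proof (rule graded_ideal_subset[OF J pair_ideal_ideal])
    show "(xp A :: ('v, 'e, 'k) gen_poly) \<in> pair_ideal G H S" if "A \<in> gverts G" "xp A \<in> J" for A
    proof -
      have "A \<in> H" using that HJ by (auto simp: ideal_sets_def)
      then show ?thesis by (intro subsetD[OF gens] UnI1 imageI)
    qed
    show "(breaking_gen G (ideal_sets J) w :: ('v, 'e, 'k) gen_poly) \<in> pair_ideal G H S"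
      if "w \<in> breaking G (ideal_sets J)" "breaking_gen G (ideal_sets J) w \<in> J" for w
    proof -
      have "w \<in> S" using that * unfolding HJ by blast
      then show ?thesis unfolding HJ by (intro subsetD[OF gens] UnI2 imageI)
    qed
  qed
  then show False using sub by blast
qed

lemma path_in_ideal:
  fixes J :: "('v, 'e, 'k::field) gen_poly set"
  assumes J: "lpa_ideal G J" and "is_path G es" "{src G (hd es)} \<in> ideal_sets J"
  shows "rng G (last es) \<in> ideal_sets J"
  using assms(2,3)
proof (induction es rule: induct_list012)
  case (2 e)
  then show ?case using ideal_sets_hereditary[OF J] by (auto simp: is_path_def hereditary_def)
next
  case (3 e f es)
  have e: "e \<in> edges G" "src G f \<in> rng G e" and p: "is_path G (f # es)"
    using "3.prems" by (auto simp: is_path_Cons)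
  have f: "f \<in> edges G" using p by (auto simp: is_path_def)
  have "rng G e \<in> ideal_sets J"
    using "3.prems" e ideal_sets_hereditary[OF J] by (auto simp: hereditary_def)
  then have "{src G f} \<in> ideal_sets J"
    using e gverts_src[OF f] ideal_sets_hereditary[OF J] unfolding hereditary_def by blast
  then show ?case using "3.IH"(2)[OF p] by simp
qed (simp add: is_path_def)

lemma reaches_in_ideal:
  fixes J :: "('v, 'e, 'k::field) gen_poly set"
  assumes J: "lpa_ideal G J" and A: "A \<in> gverts G" "xp A \<in> J" and B: "B \<in> gverts G" "reaches G A B"
  shows "xp B \<in> J"
proof -
  note her = ideal_sets_hereditary[OF J]
  have AJ: "A \<in> ideal_sets J" using A by (simp add: ideal_sets_def)
  have "B \<in> ideal_sets J"
    using B(2) unfolding reaches_def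
  proof (elim disjE exE conjE)
    assume "B \<subseteq> A"
    then show ?thesis using her AJ B(1) unfolding hereditary_def by blast
  next
    fix es assume es: "is_path G es" "src G (hd es) \<in> A" "B \<subseteq> rng G (last es)"
    then have "hd es \<in> edges G" by (cases es) (auto simp: is_path_def)
    then have "{src G (hd es)} \<in> ideal_sets J"
      using her AJ es(2) gverts_src unfolding hereditary_def by blast
    then show ?thesis
      using path_in_ideal[OF J es(1)] her B(1) es(3) unfolding hereditary_def by blast
  qed
  then show ?thesis by (simp add: ideal_sets_def)
qed

text \<open>By \<open>larger_graded_ideal\<close>, it suffices to find an element with square outside \<open>I\<^bsub>(H,S)\<^esub>\<close> in the
  intersection of any two ideals that contain such new elements.\<close>

lemma pair_ideal_prime:
  fixes H S
  defines "I \<equiv> (pair_ideal G H S :: ('v, 'e, 'k::field) gen_poly set)"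
  assumes H: "hereditary G H" and sets: "ideal_sets I = H" and ne: "I \<noteq> aug"
    and meet: "\<And>J K :: ('v, 'e, 'k) gen_poly set. lpa_ideal G J \<Longrightarrow> lpa_ideal G K \<Longrightarrow>
      (\<exists>A\<in>gverts G - H. xp A \<in> J) \<or> (\<exists>w\<in>breaking G H - S. breaking_gen G H w \<in> J) \<Longrightarrow>
      (\<exists>A\<in>gverts G - H. xp A \<in> K) \<or> (\<exists>w\<in>breaking G H - S. breaking_gen G H w \<in> K) \<Longrightarrow>
      \<exists>x. x \<in> J \<and> x \<in> K \<and> x * x \<notin> I"
  shows "prime_lpa_ideal G I"
proof (rule graded_prime_criterion)
  show I: "lpa_ideal G I" "graded I" unfolding I_def by (rule pair_ideal_ideal pair_ideal_graded)+
  show "I \<noteq> aug" by (rule ne)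
  fix a b :: "('v, 'e, 'k) gen_poly" and n m
  assume ab: "a \<in> aug" "b \<in> aug" "homogeneous n a" "homogeneous m b" "\<And>x. a * x * b \<in> I"
  show "a \<in> I \<or> b \<in> I"
  proof (rule ccontr)
    assume *: "\<not> (a \<in> I \<or> b \<in> I)"
    let ?J = "lpa_gen G (insert a I)" and ?K = "lpa_gen G (insert b I)"
    have sub: "insert a I \<subseteq> aug" "insert b I \<subseteq> aug" using ab lpa_ideal_subset_aug[OF I(1)] by auto
    have J: "lpa_ideal G ?J" "lpa_ideal G ?K" using lpa_gen_ideal sub by blast+
    have gr: "graded ?J" "graded ?K" using insert_homogeneous_graded[OF I] ab by blast+
    have sup: "I \<subseteq> ?J" "I \<subseteq> ?K" "\<not> ?J \<subseteq> I" "\<not> ?K \<subseteq> I"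
      using lpa_gen_superset[of "insert a I" G] lpa_gen_superset[of "insert b I" G] * by auto
    obtain x where "x \<in> ?J" "x \<in> ?K" "x * x \<notin> I"
      using meet[OF J larger_graded_ideal[OF H _ _ J(1) gr(1)] larger_graded_ideal[OF H _ _ J(2) gr(2)]]
        sup unfolding I_def by blast
    then show False using product_gen[OF I(1) ab(1,2,5)] by blast
  qed
qed

end


section \<open>Branching systems\<close>

text \<open>A partial action of the generators on a set of points, which gives rise to a representation
  of the path algebra on the functions on this set. The edge \<open>e\<close> is associated with a bijection
  \<open>\<sigma> e\<close> from \<open>D (rng G e)\<close> to \<open>R e\<close>, with inverse \<open>\<tau> e\<close>.\<close>

locale branching_system = ultragraph G for G :: "('v, 'e) ultragraph" +
  fixes D :: "'v set \<Rightarrow> 'x set" and R :: "'e \<Rightarrow> 'x set"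
    and \<sigma> \<tau> :: "'e \<Rightarrow> 'x \<Rightarrow> 'x"
  assumes D_empty: "D {} = {}"
    and D_Int: "A \<in> gverts G \<Longrightarrow> B \<in> gverts G \<Longrightarrow> D (A \<inter> B) = D A \<inter> D B"
    and D_Un: "A \<in> gverts G \<Longrightarrow> B \<in> gverts G \<Longrightarrow> D (A \<union> B) = D A \<union> D B"
    and R_src: "e \<in> edges G \<Longrightarrow> R e \<subseteq> D {src G e}"
    and R_disjoint: "e \<in> edges G \<Longrightarrow> f \<in> edges G \<Longrightarrow> e \<noteq> f \<Longrightarrow> R e \<inter> R f = {}"
    and \<sigma>: "e \<in> edges G \<Longrightarrow> y \<in> D (rng G e) \<Longrightarrow> \<sigma> e y \<in> R e \<and> \<tau> e (\<sigma> e y) = y"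
    and \<tau>: "e \<in> edges G \<Longrightarrow> y \<in> R e \<Longrightarrow> \<tau> e y \<in> D (rng G e) \<and> \<sigma> e (\<tau> e y) = y"
    and D_regular: "v \<in> verts G \<Longrightarrow> emitted G v \<noteq> {} \<Longrightarrow> finite (emitted G v) \<Longrightarrow>
      D {v} = (\<Union>e\<in>emitted G v. R e)"
begin

text \<open>The point \<open>None\<close> is the result of applying a letter outside its domain.\<close>

fun step :: "('v, 'e) gen \<Rightarrow> 'x option \<Rightarrow> 'x option" where
  "step g None = None"
| "step (GenP A) (Some y) = (if A \<in> gverts G \<and> y \<in> D A then Some y else None)"
| "step (GenS e) (Some y) = (if e \<in> edges G \<and> y \<in> R e then Some (\<tau> e y) else None)"
| "step (GenStar e) (Some y) = (if e \<in> edges G \<and> y \<in> D (rng G e) then Some (\<sigma> e y) else None)"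

text \<open>Words act on points from left to right, hence on functions from right to left.\<close>

definition run :: "('v, 'e) gen word \<Rightarrow> 'x option \<Rightarrow> 'x option" where
  "run w = fold step (letters w)"

text \<open>The action of a polynomial on a function \<open>f\<close>, evaluated at the point \<open>x\<close>. Functions are
  extended by the value \<open>0\<close> at \<open>None\<close>.\<close>

definition act :: "('v, 'e, 'k::field) gen_poly \<Rightarrow> ('x option \<Rightarrow> 'k) \<Rightarrow> 'x option \<Rightarrow> 'k" where
  "act a f x = (\<Sum>w\<in>Poly_Mapping.keys a. Poly_Mapping.lookup a w * f (run w x))"

lemma act_superset:
  assumes "finite S" "Poly_Mapping.keys a \<subseteq> S"
  shows "act a f x = (\<Sum>w\<in>S. Poly_Mapping.lookup a w * f (run w x))"
  unfolding act_def using assms by (intro sum.mono_neutral_left) (auto simp: in_keys_iff)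

lemma act_zero [simp]: "act 0 f x = 0"
  by (simp add: act_def)

lemma act_add [simp]: "act (a + b) f x = act a f x + act b f x"
proof -
  let ?S = "Poly_Mapping.keys a \<union> Poly_Mapping.keys b"
  have "Poly_Mapping.keys (a + b) \<subseteq> ?S" by (rule Poly_Mapping.keys_add)
  then show ?thesis
    by (simp add: act_superset[of ?S] lookup_add distrib_right sum.distrib)
qed

lemma act_uminus [simp]: "act (- a) f x = - act a f x"
  using act_add[of a "- a" f x] by (simp add: eq_neg_iff_add_eq_0 add.commute)

lemma act_diff [simp]: "act (a - b) f x = act a f x - act b f x"
  using act_add[of a "- b" f x] by simp

lemma act_sum: "act (sum g S) f x = (\<Sum>i\<in>S. act (g i) f x)"
  by (induction S rule: infinite_finite_induct) auto

lemma act_single [simp]: "act (Poly_Mapping.single w c) f x = c * f (run w x)"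
  using act_superset[of "{w}" "Poly_Mapping.single w c" f x] by simp

lemma step_None_fold: "fold step gs None = None"
  by (induction gs) auto

lemma run_None [simp]: "run w None = None"
  by (simp add: run_def step_None_fold)

lemma run_plus [simp]: "run (u + v) x = run v (run u x)"
  by (simp add: run_def)

lemma act_single_mult: "act (Poly_Mapping.single w c * a) f x = c * act a f (run w x)"
  by (induction a rule: poly_induct) (simp_all add: mult_single algebra_simps)

lemma act_mult_single: "act (a * Poly_Mapping.single w c) f x = act a (\<lambda>y. c * f (run w y)) x"
  by (induction a rule: poly_induct) (simp_all add: mult_single algebra_simps)

text \<open>The polynomials without constant term that act as zero.\<close>

definition kernel :: "('v, 'e, 'k::field) gen_poly set" where
  "kernel = {a\<in>aug. \<forall>f x. f None = 0 \<longrightarrow> act a f x = 0}"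

lemma kernelI:
  assumes "a \<in> aug" "\<And>f y. f None = 0 \<Longrightarrow> act a f (Some y) = 0" "\<And>f. f None = 0 \<Longrightarrow> act a f None = 0"
  shows "a \<in> kernel"
proof -
  have "act a f x = 0" if "f None = 0" for f x using assms(2,3) that by (cases x) auto
  then show ?thesis using assms(1) by (simp add: kernel_def)
qed

lemma act_None: "f None = 0 \<Longrightarrow> act a f None = 0"
  by (simp add: act_def)

lemma ring_ideal_kernel: "ring_ideal kernel"
  by (rule ring_idealI_poly) (auto simp: kernel_def act_single_mult act_mult_single)

lemma act_xp: "act (xp A) f (Some y) = (if A \<in> gverts G \<and> y \<in> D A then f (Some y) else f None)"
  by (simp add: xp_def run_def)

lemma act_xs: "act (xs e) f (Some y) = (if e \<in> edges G \<and> y \<in> R e then f (Some (\<tau> e y)) else f None)"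
  by (simp add: xs_def run_def)

lemma act_xstar:
  "act (xstar e) f (Some y) = (if e \<in> edges G \<and> y \<in> D (rng G e) then f (Some (\<sigma> e y)) else f None)"
  by (simp add: xstar_def run_def)

lemma act_letter_mult:
  "act (xp A * a) f (Some y) = (if A \<in> gverts G \<and> y \<in> D A then act a f (Some y) else act a f None)"
  "act (xs e * a) f (Some y) = (if e \<in> edges G \<and> y \<in> R e then act a f (Some (\<tau> e y)) else act a f None)"
  "act (xstar e * a) f (Some y) =
     (if e \<in> edges G \<and> y \<in> D (rng G e) then act a f (Some (\<sigma> e y)) else act a f None)"
  by (simp_all add: xp_def xs_def xstar_def act_single_mult run_def)

lemmas act_simps = act_xp act_xs act_xstar act_letter_mult act_None

text \<open>The idempotents \<open>s\<^sub>e s\<^sub>e\<^sup>*\<close> act as multiplication by the indicator function of \<open>R e\<close>.\<close>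

lemma act_edge_sum:
  assumes "finite F" "F \<subseteq> edges G" "f None = 0"
  shows "act (\<Sum>e\<in>F. xs e * xstar e) f (Some y) = (if y \<in> (\<Union>e\<in>F. R e) then f (Some y) else 0)"
proof -
  have "act (\<Sum>e\<in>F. xs e * xstar e) f (Some y) = (\<Sum>e\<in>F. if y \<in> R e then f (Some y) else 0)"
    unfolding act_sum
  proof (rule sum.cong[OF refl])
    fix e assume "e \<in> F"
    then have e: "e \<in> edges G" using assms by auto
    show "act (xs e * xstar e) f (Some y) = (if y \<in> R e then f (Some y) else 0)"
      using e \<tau>[OF e] assms(3) by (auto simp: act_simps)
  qed
  also have "\<dots> = (if y \<in> (\<Union>e\<in>F. R e) then f (Some y) else 0)"
  proof (cases "\<exists>e\<in>F. y \<in> R e")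
    case True
    then obtain e where e: "e \<in> F" "y \<in> R e" by blast
    have "y \<in> R i \<longleftrightarrow> i = e" if "i \<in> F" for i
    proof -
      have "R i \<inter> R e = {}" if "i \<noteq> e" using \<open>i \<in> F\<close> e assms that by (intro R_disjoint) auto
      then show ?thesis using e by blast
    qed
    then have "(\<Sum>i\<in>F. if y \<in> R i then f (Some y) else 0) = (\<Sum>i\<in>F. if i = e then f (Some y) else 0)"
      by (intro sum.cong) auto
    then show ?thesis using e assms by auto
  qed auto
  finally show ?thesis .
qed

lemma kernel_ideal: "lpa_ideal G kernel"
  unfolding lpa_ideal_def
proof (intro conjI allI impI)
  show "ring_ideal kernel" by (rule ring_ideal_kernel)
  show "kernel \<subseteq> aug" by (auto simp: kernel_def)
next
  fix g assume g: "g \<notin> gens G"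
  have "step g (Some y) = None" for y using g by (cases g) (auto simp: gens_def)
  then show "letter g \<in> kernel"
    by (intro kernelI) (auto simp: run_def act_None)
next
  show "lpa_relators G \<subseteq> kernel"
  proof
    fix r :: "('v, 'e, 'k::field) gen_poly" assume r: "r \<in> lpa_relators G"
    then have aug: "r \<in> aug" using lpa_relators_aug by blast
    show "r \<in> kernel"
    proof (rule kernelI[OF aug _ act_None])
      fix f :: "'x option \<Rightarrow> 'k" and y assume f: "f None = 0"
      show "act r f (Some y) = 0"
        using r
      proof (cases rule: lpa_relators_cases)
        case 1
        then show ?thesis using f D_empty by (simp add: act_simps)
      next
        case 2
        then show ?thesis using f D_Int[OF 2(2,3)] gverts.inter[OF 2(2,3)] by (simp add: act_simps)
      next
        case 3
        then show ?thesis
          using f D_Int[OF 3(2,3)] D_Un[OF 3(2,3)] gverts.inter[OF 3(2,3)] gverts.union[OF 3(2,3)]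
          by (simp add: act_simps)
      next
        case 4
        then show ?thesis using f R_src[OF 4(2)] gverts_src[OF 4(2)] by (auto simp: act_simps)
      next
        case 5
        then show ?thesis using f \<tau>[OF 5(2)] gverts.range[OF 5(2)] by (auto simp: act_simps)
      next
        case 6
        then show ?thesis using f gverts.range[OF 6(2)] by (auto simp: act_simps)
      next
        case 7
        then show ?thesis using f \<sigma>[OF 7(2)] R_src[OF 7(2)] gverts_src[OF 7(2)] by (auto simp: act_simps)
      next
        case 8
        then show ?thesis
          using f \<sigma>[OF 8(2)] R_disjoint[OF 8(2,3)] gverts.range[OF 8(2)] by (auto simp: act_simps)
      next
        case (9 v)
        have sub: "emitted G v \<subseteq> edges G" by (auto simp: emitted_def)
        show ?thesis
          using 9 f act_edge_sum[where f = f, OF 9(4) sub f] D_regular[OF 9(2-4)] gverts.vertex[OF 9(2)]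
          by (simp add: act_simps)
      qed
    qed
  qed
qed

lemma xp_kernel_iff:
  assumes "A \<in> gverts G"
  shows "(xp A :: ('v, 'e, 'k::field) gen_poly) \<in> kernel \<longleftrightarrow> D A = {}"
proof
  assume *: "(xp A :: ('v, 'e, 'k) gen_poly) \<in> kernel"
  show "D A = {}"
  proof (rule ccontr)
    assume "D A \<noteq> {}"
    then obtain y where y: "y \<in> D A" by blast
    define f :: "'x option \<Rightarrow> 'k" where "f = (\<lambda>z. if z = None then 0 else 1)"
    have "act (xp A) f (Some y) = 0" using * by (auto simp: kernel_def f_def)
    then show False using y assms by (simp add: act_simps f_def)
  qed
next
  assume "D A = {}"
  then show "(xp A :: ('v, 'e, 'k) gen_poly) \<in> kernel"
    by (intro kernelI) (auto simp: act_simps)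
qed

lemma breaking_gen_kernel_iff:
  assumes "w \<in> breaking G H"
  shows "(breaking_gen G H w :: ('v, 'e, 'k::field) gen_poly) \<in> kernel \<longleftrightarrow>
    D {w} = (\<Union>e\<in>{e \<in> emitted G w. rng G e \<notin> H}. R e)" (is "?L \<longleftrightarrow> D {w} = ?U")
proof -
  note fin = breaking_edges[OF assms]
  have "?U \<subseteq> D {w}" using R_src by (auto simp: emitted_def)
  then have act: "act (breaking_gen G H w) f (Some y) = (if y \<in> D {w} - ?U then f (Some y) else 0)"
    if "f None = 0" for f :: "'x option \<Rightarrow> 'k" and y
    unfolding breaking_gen_def act_diff act_edge_sum[where f = f, OF fin(1,2) that] using that fin(4)
    by (auto simp: act_simps)
  show ?thesis
  proof
    assume *: ?L
    have "y \<in> ?U" if y: "y \<in> D {w}" for y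
    proof (rule ccontr)
      assume n: "y \<notin> ?U"
      define f :: "'x option \<Rightarrow> 'k" where "f = (\<lambda>z. if z = None then 0 else 1)"
      have "act (breaking_gen G H w) f (Some y) = 0" using * by (auto simp: kernel_def f_def)
      then show False using act[of f y] y n by (simp add: f_def)
    qed
    then show "D {w} = ?U" using \<open>?U \<subseteq> D {w}\<close> by blast
  next
    assume "D {w} = ?U"
    then show ?L by (intro kernelI) (auto simp: act act_None)
  qed
qed

end


subsection \<open>A branching system for an admissible pair\<close>

context ultragraph
begin

lemma countable_gverts: "countable (gverts G)"
proof -
  define base where "base = insert {} ((\<lambda>v. {v}) ` verts G \<union> rng G ` edges G)"
  define next_stage :: "'v set set \<Rightarrow> 'v set set" where
    "next_stage X = X \<union> (\<lambda>(A, B). A \<union> B) ` (X \<times> X) \<union> (\<lambda>(A, B). A \<inter> B) ` (X \<times> X) \<union>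
       (\<lambda>(A, B). A - B) ` (X \<times> X)" for X
  define stage where "stage n = (next_stage ^^ n) base" for n
  have stage_Suc: "stage (Suc n) = next_stage (stage n)" for n by (simp add: stage_def)
  have mono: "stage n \<subseteq> stage m" if "n \<le> m" for n m
    using that by (induction rule: dec_induct) (auto simp: stage_Suc next_stage_def)
  have "countable (stage n)" for n
  proof (induction n)
    case 0
    then show ?case using countable_verts countable_edges by (simp add: stage_def base_def)
  next
    case (Suc n)
    then show ?case by (simp add: stage_Suc next_stage_def)
  qed
  then have "countable (\<Union>n. stage n)" by simp
  moreover have base: "base \<subseteq> (\<Union>n. stage n)"
  proof -
    have "stage 0 \<subseteq> (\<Union>n. stage n)" by blast
    moreover have "stage 0 = base" by (simp add: stage_def)
    ultimately show ?thesis by simp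
  qed
  have step: "A \<union> B \<in> (\<Union>n. stage n) \<and> A \<inter> B \<in> (\<Union>n. stage n) \<and> A - B \<in> (\<Union>n. stage n)"
    if AB: "A \<in> (\<Union>n. stage n)" "B \<in> (\<Union>n. stage n)" for A B
  proof -
    obtain n m where "A \<in> stage n" "B \<in> stage m" using AB by blast
    then have "A \<in> stage (max n m)" "B \<in> stage (max n m)"
      using mono[of n "max n m"] mono[of m "max n m"] by auto
    then have "A \<union> B \<in> stage (Suc (max n m)) \<and> A \<inter> B \<in> stage (Suc (max n m)) \<and> A - B \<in> stage (Suc (max n m))"
      unfolding stage_Suc next_stage_def by blast
    then show ?thesis by blast
  qed
  have "A \<in> (\<Union>n. stage n)" if "A \<in> gverts G" for A
    using that
  proof induction
    case empty
    show ?case by (rule subsetD[OF base]) (simp add: base_def)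
  next
    case (vertex v)
    then show ?case by (intro subsetD[OF base]) (auto simp: base_def)
  next
    case (range e)
    then show ?case by (intro subsetD[OF base]) (auto simp: base_def)
  qed (use step in blast)+
  then have "gverts G \<subseteq> (\<Union>n. stage n)" by blast
  ultimately show ?thesis using countable_subset by blast
qed

text \<open>Ideals of the Boolean algebra, possibly improper.\<close>

definition set_ideal :: "'v set set \<Rightarrow> bool" where
  "set_ideal M \<longleftrightarrow> M \<subseteq> gverts G \<and> {} \<in> M \<and> (\<forall>A\<in>M. \<forall>B\<in>M. A \<union> B \<in> M) \<and>
     (\<forall>A\<in>M. \<forall>B\<in>gverts G. B \<subseteq> A \<longrightarrow> B \<in> M)"

lemma set_ideal_Un: "set_ideal M \<Longrightarrow> A \<in> M \<Longrightarrow> B \<in> M \<Longrightarrow> A \<union> B \<in> M"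
  and set_ideal_subset: "set_ideal M \<Longrightarrow> A \<in> M \<Longrightarrow> B \<in> gverts G \<Longrightarrow> B \<subseteq> A \<Longrightarrow> B \<in> M"
  and set_ideal_gverts: "set_ideal M \<Longrightarrow> A \<in> M \<Longrightarrow> A \<in> gverts G"
  and set_ideal_empty: "set_ideal M \<Longrightarrow> {} \<in> M"
  by (auto simp: set_ideal_def)

lemma prime_set_ideal_exists:
  assumes H: "set_ideal H" and B: "B \<in> gverts G" "B \<notin> H"
  obtains M where "set_ideal M" "H \<subseteq> M" "B \<notin> M"
    "\<And>A A'. A \<in> gverts G \<Longrightarrow> A' \<in> gverts G \<Longrightarrow> A \<inter> A' \<in> M \<Longrightarrow> A \<in> M \<or> A' \<in> M"
proof -
  \<comment> \<open>An ideal that is maximal among those omitting \<open>B\<close> is prime.\<close>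
  let ?\<A> = "{M. set_ideal M \<and> H \<subseteq> M \<and> B \<notin> M}"
  have "\<exists>M\<in>?\<A>. \<forall>X\<in>?\<A>. M \<subseteq> X \<longrightarrow> X = M"
  proof (rule subset_Zorn_nonempty)
    show "?\<A> \<noteq> {}" using assms by blast
    fix C assume C: "C \<noteq> {}" "subset.chain ?\<A> C"
    have mem: "set_ideal M \<and> H \<subseteq> M \<and> B \<notin> M" if "M \<in> C" for M
      using C that by (auto simp: subset.chain_def)
    have "A \<union> A' \<in> \<Union>C" if AA: "A \<in> \<Union>C" "A' \<in> \<Union>C" for A A'
    proof -
      obtain M M' where M: "M \<in> C" "A \<in> M" "M' \<in> C" "A' \<in> M'" using AA by blast
      then have "M \<subseteq> M' \<or> M' \<subseteq> M" using C by (auto simp: subset.chain_def)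
      then consider "A \<in> M'" | "A' \<in> M" using M by blast
      then show ?thesis
      proof cases
        case 1
        then have "A \<union> A' \<in> M'" using M(4) mem[OF M(3)] by (intro set_ideal_Un) auto
        then show ?thesis using M(3) by blast
      next
        case 2
        then have "A \<union> A' \<in> M" using M(2) mem[OF M(1)] by (intro set_ideal_Un) auto
        then show ?thesis using M(1) by blast
      qed
    qed
    moreover have "\<Union>C \<subseteq> gverts G" using mem set_ideal_gverts by blast
    moreover have "{} \<in> \<Union>C" using mem C(1) set_ideal_empty by blast
    moreover have "A' \<in> \<Union>C" if AA: "A \<in> \<Union>C" "A' \<in> gverts G" "A' \<subseteq> A" for A A'
    proof -
      obtain M where M: "M \<in> C" "A \<in> M" using AA by blast
      then have "A' \<in> M" using set_ideal_subset[of M A A'] mem[OF M(1)] AA M(2) by blast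
      then show ?thesis using M by blast
    qed
    ultimately have "set_ideal (\<Union>C)" unfolding set_ideal_def by (intro conjI ballI impI)
    moreover have "H \<subseteq> \<Union>C" "B \<notin> \<Union>C" using mem C(1) by blast+
    ultimately show "\<Union>C \<in> ?\<A>" by blast
  qed
  then obtain M where M': "M \<in> ?\<A>" and max': "\<forall>X\<in>?\<A>. M \<subseteq> X \<longrightarrow> X = M"
    by (elim bexE)
  then have M: "set_ideal M" "H \<subseteq> M" "B \<notin> M" by auto
  have max: "X = M" if "set_ideal X" "H \<subseteq> X" "B \<notin> X" "M \<subseteq> X" for X
    using bspec[OF max', of X] that by simp
  have extend: "\<exists>h\<in>M. B \<subseteq> h \<union> A" if A: "A \<in> gverts G" "A \<notin> M" for A
  proof (rule ccontr)
    assume *: "\<not> (\<exists>h\<in>M. B \<subseteq> h \<union> A)"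
    let ?X = "{Z \<in> gverts G. \<exists>h\<in>M. Z \<subseteq> h \<union> A}"
    have "Z \<union> Z' \<in> ?X" if ZZ: "Z \<in> ?X" "Z' \<in> ?X" for Z Z'
    proof -
      obtain h h' where h: "h \<in> M" "Z \<subseteq> h \<union> A" "h' \<in> M" "Z' \<subseteq> h' \<union> A" using ZZ by blast
      then have "h \<union> h' \<in> M" using M(1) by (intro set_ideal_Un)
      moreover have "Z \<union> Z' \<subseteq> (h \<union> h') \<union> A" using h by blast
      moreover have "Z \<union> Z' \<in> gverts G" using ZZ by (auto intro: gverts.union)
      ultimately show ?thesis by blast
    qed
    moreover have "{} \<in> ?X" using set_ideal_empty[OF M(1)] gverts.empty by blast
    moreover have "Z' \<in> ?X" if "Z \<in> ?X" "Z' \<in> gverts G" "Z' \<subseteq> Z" for Z Z' using that by blast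
    ultimately have "set_ideal ?X" unfolding set_ideal_def by (intro conjI ballI impI) auto
    moreover have "M \<subseteq> ?X" using set_ideal_gverts[OF M(1)] by blast
    moreover have "B \<notin> ?X" using * by blast
    ultimately have "?X = M" using M(2) by (intro max) auto
    moreover have "A \<in> ?X" using A set_ideal_empty[OF M(1)] by blast
    ultimately show False using A by blast
  qed
  have "A \<in> M \<or> A' \<in> M" if A: "A \<in> gverts G" "A' \<in> gverts G" "A \<inter> A' \<in> M" for A A'
  proof (rule ccontr)
    assume "\<not> (A \<in> M \<or> A' \<in> M)"
    then obtain h h' where h: "h \<in> M" "B \<subseteq> h \<union> A" "h' \<in> M" "B \<subseteq> h' \<union> A'"
      using extend A by blast
    have "(h \<union> h') \<union> (A \<inter> A') \<in> M" using h A(3) M(1) by (intro set_ideal_Un)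
    moreover have "B \<subseteq> (h \<union> h') \<union> (A \<inter> A')" using h by blast
    ultimately have "B \<in> M" using set_ideal_subset[OF M(1)] B by blast
    then show False using M by blast
  qed
  then show ?thesis using that[OF M] by blast
qed

text \<open>The points are pairs of a prime ideal of the Boolean algebra that contains \<open>H\<close> (represented by a set not
  in \<open>H\<close> which it omits) and a natural number; \<open>D A\<close> consists of the points whose ideal omits \<open>A\<close>. It is
  countably infinite if \<open>A \<notin> H\<close>, so \<open>D {v}\<close> can be divided into infinite pieces, one for each edge emitted by \<open>v\<close> with
  range outside \<open>H\<close>, and an additional one if \<open>v \<in> W\<close>, which makes \<open>p\<^sub>v\<^sup>H\<close> act nontrivially.\<close>

lemma branching_system_exists:
  assumes H: "hereditary G H" "saturated G H" and W: "W \<subseteq> breaking G H"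
  obtains D :: "'v set \<Rightarrow> ('v set \<times> nat) set" and R \<sigma> \<tau> where
    "branching_system G D R \<sigma> \<tau>"
    "\<And>A. A \<in> gverts G \<Longrightarrow> D A = {} \<longleftrightarrow> A \<in> H"
    "\<And>w. w \<in> breaking G H \<Longrightarrow> D {w} = (\<Union>e\<in>{e \<in> emitted G w. rng G e \<notin> H}. R e) \<longleftrightarrow> w \<notin> W"
proof -
  have HI: "set_ideal H" using H(1) unfolding hereditary_def set_ideal_def by blast
  have "\<exists>M. set_ideal M \<and> H \<subseteq> M \<and> B \<notin> M \<and>
    (\<forall>A\<in>gverts G. \<forall>A'\<in>gverts G. A \<inter> A' \<in> M \<longrightarrow> A \<in> M \<or> A' \<in> M)" if "B \<in> gverts G - H" for B
    using prime_set_ideal_exists[OF HI, of B] that by (metis DiffD1 DiffD2)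
  then obtain M where M: "\<And>B. B \<in> gverts G - H \<Longrightarrow> set_ideal (M B) \<and> H \<subseteq> M B \<and> B \<notin> M B \<and>
    (\<forall>A\<in>gverts G. \<forall>A'\<in>gverts G. A \<inter> A' \<in> M B \<longrightarrow> A \<in> M B \<or> A' \<in> M B)" by metis
  define D where "D A = {B \<in> gverts G - H. A \<notin> M B} \<times> (UNIV :: nat set)" for A
  have D_iff: "D A = {} \<longleftrightarrow> A \<in> H" if "A \<in> gverts G" for A
    using M that unfolding D_def by blast
  have D_Int: "D (A \<inter> A') = D A \<inter> D A'" if A: "A \<in> gverts G" "A' \<in> gverts G" for A A'
  proof -
    have "A \<inter> A' \<in> M B \<longleftrightarrow> A \<in> M B \<or> A' \<in> M B" if B: "B \<in> gverts G - H" for B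
    proof -
      have "set_ideal (M B)" using M[OF B] by blast
      then have "A \<inter> A' \<in> M B" if "A \<in> M B \<or> A' \<in> M B"
        using that gverts.inter[OF A] set_ideal_subset by (metis inf_le1 inf_le2)
      then show ?thesis using M[OF B] A by blast
    qed
    then show ?thesis unfolding D_def by blast
  qed
  have D_Un: "D (A \<union> A') = D A \<union> D A'" if A: "A \<in> gverts G" "A' \<in> gverts G" for A A'
  proof -
    have "A \<union> A' \<in> M B \<longleftrightarrow> A \<in> M B \<and> A' \<in> M B" if B: "B \<in> gverts G - H" for B
    proof -
      have "set_ideal (M B)" using M[OF B] by blast
      then show ?thesis using A set_ideal_subset set_ideal_Un by (metis Un_upper1 Un_upper2)
    qed
    then show ?thesis unfolding D_def by blast
  qed
  have count: "countable (D A)" for A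
    using countable_gverts unfolding D_def by (intro countable_SIGMA) auto
  have inf: "infinite (D A)" if "A \<in> gverts G" "A \<notin> H" for A
    using D_iff[OF that(1)] that(2) unfolding D_def by (auto simp: finite_cartesian_product_iff)
  \<comment> \<open>The piece with index \<open>None\<close> belongs to no edge.\<close>
  define E where "E v = {e \<in> emitted G v. rng G e \<notin> H}" for v
  define pieces where "pieces v = (Some ` E v \<union> (if v \<in> W then {None} else {})) \<times> (UNIV :: nat set)" for v
  define b where "b v = from_nat_into (pieces v) \<circ> to_nat_on (D {v})" for v
  define c where "c A = to_nat_on (D A)" for A
  have E_edges: "e \<in> E (src G e) \<longleftrightarrow> e \<in> edges G \<and> rng G e \<notin> H" for e
    by (auto simp: E_def emitted_def)
  have src_notin: "{src G e} \<notin> H" if "e \<in> edges G" "rng G e \<notin> H" for e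
    using H(1) that unfolding hereditary_def by blast
  have b: "bij_betw (b v) (D {v}) (pieces v)" if v: "v \<in> verts G" "E v \<noteq> {}" for v
  proof -
    obtain e where e: "e \<in> edges G" "rng G e \<notin> H" "src G e = v" using v by (auto simp: E_def emitted_def)
    have "infinite (D {v})" using inf gverts.vertex[OF v(1)] src_notin e by blast
    then have 1: "bij_betw (to_nat_on (D {v})) (D {v}) UNIV" by (rule to_nat_on_infinite[OF count])
    have "countable (E v)" using countable_edges by (rule countable_subset[rotated]) (auto simp: E_def emitted_def)
    then have "countable (pieces v)" unfolding pieces_def by (intro countable_SIGMA) auto
    moreover have "infinite (pieces v)" using v unfolding pieces_def by (auto simp: finite_cartesian_product_iff)
    ultimately have 2: "bij_betw (from_nat_into (pieces v)) UNIV (pieces v)" by (rule bij_betw_from_nat_into)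
    show ?thesis unfolding b_def by (rule bij_betw_trans[OF 1 2])
  qed
  have c: "bij_betw (c A) (D A) UNIV" if "A \<in> gverts G" "A \<notin> H" for A
    unfolding c_def by (rule to_nat_on_infinite[OF count inf[OF that]])
  define R where "R e = {x \<in> D {src G e}. rng G e \<notin> H \<and> fst (b (src G e) x) = Some e}" for e
  define \<tau> where "\<tau> e x = inv_into (D (rng G e)) (c (rng G e)) (snd (b (src G e) x))" for e x
  define \<sigma> where "\<sigma> e y = inv_into (D {src G e}) (b (src G e)) (Some e, c (rng G e) y)" for e y
  have bc: "bij_betw (b (src G e)) (D {src G e}) (pieces (src G e))" "bij_betw (c (rng G e)) (D (rng G e)) UNIV"
    "(Some e, n) \<in> pieces (src G e)" if e: "e \<in> edges G" "rng G e \<notin> H" for e n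
  proof -
    have "e \<in> E (src G e)" using e E_edges by blast
    then show "bij_betw (b (src G e)) (D {src G e}) (pieces (src G e))"
      using src_in_verts[OF e(1)] by (intro b) auto
    show "bij_betw (c (rng G e)) (D (rng G e)) UNIV" using c[OF gverts.range[OF e(1)] e(2)] .
    show "(Some e, n) \<in> pieces (src G e)" using \<open>e \<in> E (src G e)\<close> by (auto simp: pieces_def)
  qed
  have R_union: "D {v} = (\<Union>e\<in>E v. R e) \<longleftrightarrow> v \<notin> W" if v: "v \<in> verts G" "E v \<noteq> {}" for v
  proof -
    note bv = b[OF v]
    have sub: "(\<Union>e\<in>E v. R e) = {x \<in> D {v}. fst (b v x) \<in> Some ` E v}"
      by (auto simp: R_def E_def emitted_def)
    have "v \<notin> W" if eq: "D {v} = (\<Union>e\<in>E v. R e)"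
    proof
      assume "v \<in> W"
      then have "(None, 0) \<in> pieces v" by (simp add: pieces_def)
      then obtain x where x: "x \<in> D {v}" "b v x = (None, 0)" using bv unfolding bij_betw_def by (metis imageE)
      have "x \<in> (\<Union>e\<in>E v. R e)" using x(1) eq by blast
      then have "fst (b v x) \<in> Some ` E v" unfolding sub by blast
      then show False using x(2) by auto
    qed
    moreover have "D {v} = (\<Union>e\<in>E v. R e)" if "v \<notin> W"
    proof -
      have "b v x \<in> pieces v" if "x \<in> D {v}" for x using bv that by (rule bij_betwE[rule_format])
      then show ?thesis using that unfolding sub pieces_def by force
    qed
    ultimately show ?thesis by blast
  qed
  have bs: "branching_system G D R \<sigma> \<tau>"
  proof
    show "D {} = {}" using D_iff[OF gverts.empty] set_ideal_empty[OF HI] by blast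
    show "D (A \<inter> B) = D A \<inter> D B" "D (A \<union> B) = D A \<union> D B" if "A \<in> gverts G" "B \<in> gverts G" for A B
      using D_Int[OF that] D_Un[OF that] by auto
    show "R e \<subseteq> D {src G e}" for e by (auto simp: R_def)
    show "R e \<inter> R f = {}" if "e \<in> edges G" "f \<in> edges G" "e \<noteq> f" for e f
    proof (cases "src G e = src G f")
      case True
      then show ?thesis using \<open>e \<noteq> f\<close> by (auto simp: R_def)
    next
      case False
      then have "D {src G e} \<inter> D {src G f} = D {}"
        using D_Int[OF gverts_src[OF that(1)] gverts_src[OF that(2)]] by simp
      also have "D {} = {}" using D_iff[OF gverts.empty] set_ideal_empty[OF HI] by blast
      finally show ?thesis by (auto simp: R_def)
    qed
    show "\<sigma> e y \<in> R e \<and> \<tau> e (\<sigma> e y) = y" if e: "e \<in> edges G" "y \<in> D (rng G e)" for e y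
    proof -
      have r: "rng G e \<notin> H" using e D_iff[OF gverts.range[OF e(1)]] by blast
      note bce = bc[OF e(1) r]
      have s: "\<sigma> e y \<in> D {src G e}" "b (src G e) (\<sigma> e y) = (Some e, c (rng G e) y)"
        using bce(1) bce(3)[of "c (rng G e) y"] unfolding \<sigma>_def bij_betw_def
        by (metis inv_into_into, metis f_inv_into_f)
      have "\<tau> e (\<sigma> e y) = y"
        using bce(2) e(2) s(2) unfolding \<tau>_def bij_betw_def by simp
      then show ?thesis using s r by (simp add: R_def)
    qed
    show "\<tau> e y \<in> D (rng G e) \<and> \<sigma> e (\<tau> e y) = y" if e: "e \<in> edges G" "y \<in> R e" for e y
    proof -
      have y: "y \<in> D {src G e}" "rng G e \<notin> H" "fst (b (src G e) y) = Some e" using e by (auto simp: R_def)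
      note bce = bc[OF e(1) y(2)]
      have t: "\<tau> e y \<in> D (rng G e)" "c (rng G e) (\<tau> e y) = snd (b (src G e) y)"
        using bce(2) unfolding \<tau>_def bij_betw_def
        by (metis UNIV_I inv_into_into, metis UNIV_I f_inv_into_f)
      have "(Some e, c (rng G e) (\<tau> e y)) = b (src G e) y" using t(2) y(3) by (simp add: prod_eq_iff)
      then have "\<sigma> e (\<tau> e y) = y"
        using bce(1) y(1) unfolding \<sigma>_def bij_betw_def by simp
      then show ?thesis using t by blast
    qed
    show "D {v} = (\<Union>e\<in>emitted G v. R e)"
      if v: "v \<in> verts G" "emitted G v \<noteq> {}" "finite (emitted G v)" for v
    proof -
      have R: "(\<Union>e\<in>emitted G v. R e) = (\<Union>e\<in>E v. R e)" by (auto simp: R_def E_def)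
      show ?thesis
      proof (cases "E v = {}")
        case True
        then have "\<forall>e\<in>emitted G v. rng G e \<in> H" by (auto simp: E_def)
        then have "{v} \<in> H" using H(2) v unfolding saturated_def by blast
        then show ?thesis using D_iff[OF gverts.vertex[OF v(1)]] R True by simp
      next
        case False
        have "v \<notin> W" using W v by (auto simp: breaking_def)
        then show ?thesis using R_union[OF v(1) False] R by simp
      qed
    qed
  qed
  have "D {w} = (\<Union>e\<in>{e \<in> emitted G w. rng G e \<notin> H}. R e) \<longleftrightarrow> w \<notin> W" if "w \<in> breaking G H" for w
    using R_union[of w] that unfolding E_def breaking_def by blast
  then show ?thesis using that[OF bs] D_iff by blast
qed

text \<open>An admissible pair is determined by its ideal.\<close>

theorem pair_ideal_faithful:
  fixes S
  defines "I \<equiv> \<lambda>H. (pair_ideal G H S :: ('v, 'e, 'k::field) gen_poly set)"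
  assumes H: "hereditary G H" "saturated G H" and S: "S \<subseteq> breaking G H"
  shows "ideal_sets (I H) = H"
    and "w \<in> breaking G H \<Longrightarrow> (breaking_gen G H w :: ('v, 'e, 'k) gen_poly) \<in> I H \<longleftrightarrow> w \<in> S"
proof -
  obtain D :: "'v set \<Rightarrow> ('v set \<times> nat) set" and R \<sigma> \<tau> where bs: "branching_system G D R \<sigma> \<tau>"
    and D: "\<And>A. A \<in> gverts G \<Longrightarrow> D A = {} \<longleftrightarrow> A \<in> H"
    and R: "\<And>w. w \<in> breaking G H \<Longrightarrow>
      D {w} = (\<Union>e\<in>{e \<in> emitted G w. rng G e \<notin> H}. R e) \<longleftrightarrow> w \<notin> breaking G H - S"
    by (rule branching_system_exists[OF H, of "breaking G H - S"]) auto
  interpret branching_system G D R \<sigma> \<tau> by (rule bs)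
  have gens: "xp ` H \<union> breaking_gen G H ` S \<subseteq> I H"
    unfolding I_def pair_ideal_def by (rule lpa_gen_superset)
  have HG: "H \<subseteq> gverts G" using H by (simp add: hereditary_def)
  have sub: "I H \<subseteq> kernel"
    unfolding I_def pair_ideal_def
  proof (rule lpa_gen_least[OF kernel_ideal])
    have "xp A \<in> (kernel :: ('v, 'e, 'k) gen_poly set)" if "A \<in> H" for A
      using that HG D xp_kernel_iff by blast
    moreover have "breaking_gen G H v \<in> (kernel :: ('v, 'e, 'k) gen_poly set)" if "v \<in> S" for v
    proof -
      have v: "v \<in> breaking G H" using that S by blast
      show ?thesis using R[OF v] that breaking_gen_kernel_iff[OF v, where 'k = 'k] by simp
    qed
    ultimately show "xp ` H \<union> breaking_gen G H ` S \<subseteq> (kernel :: ('v, 'e, 'k) gen_poly set)" by blast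
  qed
  show "ideal_sets (I H) = H"
  proof
    show "ideal_sets (I H) \<subseteq> H"
    proof
      fix A assume "A \<in> ideal_sets (I H)"
      then have A: "A \<in> gverts G" "xp A \<in> (kernel :: ('v, 'e, 'k) gen_poly set)"
        using sub by (auto simp: ideal_sets_def)
      then show "A \<in> H" using xp_kernel_iff[OF A(1)] D by blast
    qed
    show "H \<subseteq> ideal_sets (I H)" using gens HG by (auto simp: ideal_sets_def)
  qed
  show "(breaking_gen G H w :: ('v, 'e, 'k) gen_poly) \<in> I H \<longleftrightarrow> w \<in> S" if w: "w \<in> breaking G H"
  proof
    assume "w \<in> S"
    then show "(breaking_gen G H w :: ('v, 'e, 'k) gen_poly) \<in> I H" by (intro subsetD[OF gens] UnI2 imageI)
  next
    assume "(breaking_gen G H w :: ('v, 'e, 'k) gen_poly) \<in> I H"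
    then have "(breaking_gen G H w :: ('v, 'e, 'k) gen_poly) \<in> kernel" using sub by blast
    then show "w \<in> S" using breaking_gen_kernel_iff[OF w, where 'k = 'k] R[OF w] w by blast
  qed
qed

end


section \<open>The quotient algebra\<close>

context ultragraph
begin

text \<open>Erasing the words that involve letters other than the generators.\<close>

abbreviation clean :: "('v, 'e, 'k::field) gen_poly \<Rightarrow> ('v, 'e, 'k) gen_poly" where
  "clean \<equiv> part (gen_word G)"

text \<open>The free non-unital algebra of which the path algebra is a quotient, and its cosets.\<close>

abbreviation polys :: "('v, 'e, 'k::field) gen_poly set" where
  "polys \<equiv> carrier (free_algebra (gens G))"

abbreviation cls :: "('v, 'e, 'k::field) gen_poly \<Rightarrow> ('v, 'e, 'k) lpa_elem" where
  "cls \<equiv> lpa_class G"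

lemma clean_mult: "clean (x * y) = clean x * clean y"
  by (rule part_mult) simp

lemma polys_iff: "x \<in> polys \<longleftrightarrow> x \<in> aug \<and> clean x = x"
proof
  assume x: "x \<in> polys"
  then show "x \<in> aug \<and> clean x = x"
    by (auto simp: free_algebra_def aug_def gen_word_def in_keys_iff intro!: part_id)
next
  assume x: "x \<in> aug \<and> clean x = x"
  then have "gen_word G w \<and> w \<noteq> 0" if "w \<in> Poly_Mapping.keys x" for w
    using keys_part_imp[of "gen_word G" x w] that by (auto simp: aug_def in_keys_iff)
  then show "x \<in> polys" by (auto simp: free_algebra_def gen_word_def)
qed

lemma clean_aug: "x \<in> aug \<Longrightarrow> clean x \<in> aug"
  by (simp add: aug_def lookup_part)

lemma clean_clean [simp]: "clean (clean x) = clean x"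
  by (rule poly_mapping_eqI) (simp add: lookup_part)

lemma clean_polys: "x \<in> aug \<Longrightarrow> clean x \<in> polys"
  by (simp add: polys_iff clean_aug)

lemma polys_aug: "x \<in> polys \<Longrightarrow> x \<in> aug"
  by (simp add: polys_iff)

lemma polys_zero: "0 \<in> polys"
  and polys_add: "x \<in> polys \<Longrightarrow> y \<in> polys \<Longrightarrow> x + y \<in> polys"
  and polys_diff: "x \<in> polys \<Longrightarrow> y \<in> polys \<Longrightarrow> x - y \<in> polys"
  and polys_mult: "x \<in> polys \<Longrightarrow> y \<in> polys \<Longrightarrow> x * y \<in> polys"
  by (simp_all add: polys_iff clean_mult)

lemma polys_uminus: "x \<in> polys \<Longrightarrow> - x \<in> polys"
  using polys_diff[OF polys_zero, of x] by simp

lemma polys_sum: "(\<And>i. i \<in> A \<Longrightarrow> f i \<in> polys) \<Longrightarrow> sum f A \<in> polys"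
  by (induction A rule: infinite_finite_induct) (auto intro: polys_zero polys_add)

lemma polys_scale: "x \<in> polys \<Longrightarrow> scal c * x \<in> polys"
  by (simp add: polys_iff clean_mult part_single)

lemma polys_generators:
  "A \<in> gverts G \<Longrightarrow> xp A \<in> polys" "e \<in> edges G \<Longrightarrow> xs e \<in> polys" "e \<in> edges G \<Longrightarrow> xstar e \<in> polys"
  unfolding polys_iff by (auto simp: xp_def xs_def xstar_def part_single gen_word_def gens_def)

lemma relators_polys: "lpa_relators G \<subseteq> polys"
  unfolding lpa_relators_def
  by (auto intro!: polys_diff polys_add polys_mult polys_sum polys_zero polys_generators
      gverts.empty gverts.inter gverts.union gverts.range gverts.vertex src_in_verts simp: emitted_def)

lemma polys_degree_part: "x \<in> polys \<Longrightarrow> degree_part n x \<in> polys"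
  by (auto simp: free_algebra_def keys_part)

lemma rel_ideal_polys: "x \<in> lpa_rel_ideal G \<Longrightarrow> x \<in> polys"
  unfolding lpa_rel_ideal_def
proof (induction rule: algebra_ideal.induct)
  case (rel a)
  then show ?case using relators_polys by blast
qed (auto intro: polys_zero polys_add polys_scale polys_mult)

lemma rel_ideal_uminus: "x \<in> lpa_rel_ideal G \<Longrightarrow> - x \<in> lpa_rel_ideal G"
  using algebra_ideal.scale[of x "gens G" "lpa_relators G" "- 1"]
  by (simp add: lpa_rel_ideal_def single_uminus)

lemma rel_ideal_zero: "0 \<in> lpa_rel_ideal G"
  and rel_ideal_add: "x \<in> lpa_rel_ideal G \<Longrightarrow> y \<in> lpa_rel_ideal G \<Longrightarrow> x + y \<in> lpa_rel_ideal G"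
  and rel_ideal_left: "x \<in> lpa_rel_ideal G \<Longrightarrow> y \<in> polys \<Longrightarrow> y * x \<in> lpa_rel_ideal G"
  and rel_ideal_right: "x \<in> lpa_rel_ideal G \<Longrightarrow> y \<in> polys \<Longrightarrow> x * y \<in> lpa_rel_ideal G"
  and rel_ideal_scale: "x \<in> lpa_rel_ideal G \<Longrightarrow> scal c * x \<in> lpa_rel_ideal G"
  by (auto simp: lpa_rel_ideal_def intro: algebra_ideal.intros)

lemma rel_ideal_diff: "x \<in> lpa_rel_ideal G \<Longrightarrow> y \<in> lpa_rel_ideal G \<Longrightarrow> x - y \<in> lpa_rel_ideal G"
  using rel_ideal_add[OF _ rel_ideal_uminus, of x y] by simp

lemma superfluous_word:
  assumes "\<not> gen_word G w"
  shows "Poly_Mapping.single w c \<approx> (0 :: ('v, 'e, 'k::field) gen_poly)"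
proof -
  obtain g where g: "g \<in> set (letters w)" "g \<notin> gens G" using assms by (auto simp: gen_word_def)
  obtain us vs where "letters w = us @ g # vs" using split_list[OF g(1)] by blast
  then have "w = Word us + Word [g] + Word vs" by (cases w) (simp add: plus_word_def)
  then have eq: "Poly_Mapping.single w c = Poly_Mapping.single (Word us) c * letter g * Poly_Mapping.single (Word vs) 1"
    by (simp add: mult_single)
  have "Poly_Mapping.single (Word us) c * letter g * Poly_Mapping.single (Word vs) 1 \<approx>
      Poly_Mapping.single (Word us) c * 0 * (Poly_Mapping.single (Word vs) 1 :: ('v, 'e, 'k) gen_poly)"
    by (intro lpa_eq_right lpa_eq_left superfluous_letter g)
  then show ?thesis unfolding eq by simp
qed

lemma clean_eqv: "clean x \<approx> x"
proof (induction x rule: poly_induct)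
  case (single w c)
  then show ?case using lpa_eq_sym[OF superfluous_word[of w c]] by (simp add: part_single)
next
  case (add a b)
  then show ?case by (simp add: lpa_eq_add)
qed simp

text \<open>On polynomials in the generators, both descriptions of the ideal of relations agree.\<close>

lemma rel_ideal_iff:
  fixes x :: "('v, 'e, 'k::field) gen_poly"
  assumes "x \<in> polys"
  shows "x \<in> lpa_rel_ideal G \<longleftrightarrow> x \<approx> 0"
proof
  assume "x \<in> lpa_rel_ideal G"
  then have "x \<in> lpa_gen G {}"
    unfolding lpa_rel_ideal_def
  proof (induction rule: algebra_ideal.induct)
    case (rel a)
    then show ?case using lpa_ideal_rel by (auto simp: lpa_ideal_def)
  qed (auto intro: lpa_ideal_zero[OF lpa_ideal_rel] lpa_ideal_add[OF lpa_ideal_rel]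
      lpa_ideal_left[OF lpa_ideal_rel] lpa_ideal_right[OF lpa_ideal_rel])
  then show "x \<approx> 0" by (simp add: lpa_eq_def)
next
  define J where "J = {y\<in>aug. clean y \<in> (lpa_rel_ideal G :: ('v, 'e, 'k) gen_poly set)}"
  have mult: "clean y * a \<in> lpa_rel_ideal G \<and> a * clean y \<in> lpa_rel_ideal G"
    if a: "a \<in> (lpa_rel_ideal G :: ('v, 'e, 'k) gen_poly set)" for y a
  proof -
    define c where "c = Poly_Mapping.lookup y 0"
    define y' where "y' = clean y - scal c"
    have "y' \<in> aug" by (simp add: y'_def c_def aug_def lookup_minus lookup_part)
    moreover have "clean y' = y'" by (simp add: y'_def part_single)
    ultimately have y': "y' \<in> polys" by (simp add: polys_iff)
    have eq: "clean y = scal c + y'" by (simp add: y'_def)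
    have "scal c * a + y' * a \<in> lpa_rel_ideal G" "scal c * a + a * y' \<in> lpa_rel_ideal G"
      by (intro rel_ideal_add rel_ideal_scale rel_ideal_left rel_ideal_right a y')+
    then show ?thesis using scalar_commute[of c a] by (simp add: eq distrib_left distrib_right)
  qed
  have "ring_ideal J"
    unfolding ring_ideal_def using mult rel_ideal_zero rel_ideal_add
    by (auto simp: J_def clean_mult)
  moreover have "lpa_relators G \<subseteq> J"
  proof
    fix r :: "('v, 'e, 'k) gen_poly" assume r: "r \<in> lpa_relators G"
    then have "r \<in> aug" "clean r = r" using relators_polys polys_iff by blast+
    then show "r \<in> J" using r by (simp add: J_def lpa_rel_ideal_def algebra_ideal.rel)
  qed
  moreover have "letter g \<in> J" if "g \<notin> gens G" for g
    using that rel_ideal_zero by (auto simp: J_def part_single gen_word_def)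
  ultimately have J: "lpa_ideal G J" by (auto simp: lpa_ideal_def J_def)
  assume "x \<approx> 0"
  then have "x \<in> J" using lpa_gen_least[OF J, of "{}"] by (auto simp: lpa_eq_def)
  then show "x \<in> lpa_rel_ideal G" using assms by (simp add: J_def polys_iff)
qed

lemma cls_def': "cls x = (\<lambda>r. r + x) ` lpa_rel_ideal G"
  by (auto simp: lpa_class_def a_r_coset_def' free_algebra_def)

lemma mem_cls: "y \<in> cls x \<longleftrightarrow> y - x \<in> lpa_rel_ideal G"
proof
  assume "y - x \<in> lpa_rel_ideal G"
  then show "y \<in> cls x" unfolding cls_def' by (intro image_eqI[of _ _ "y - x"]) auto
qed (auto simp: cls_def')

lemma cls_eq_iff: "cls x = cls y \<longleftrightarrow> x - y \<in> lpa_rel_ideal G"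
proof
  assume "cls x = cls y"
  moreover have "x \<in> cls x" by (simp add: mem_cls rel_ideal_zero)
  ultimately show "x - y \<in> lpa_rel_ideal G" by (simp add: mem_cls)
next
  assume *: "x - y \<in> lpa_rel_ideal G"
  show "cls x = cls y"
  proof (intro Set.set_eqI)
    fix z
    have "z - x \<in> lpa_rel_ideal G \<longleftrightarrow> z - y \<in> lpa_rel_ideal G"
      using rel_ideal_add[OF _ *, of "z - x"] rel_ideal_diff[OF _ *, of "z - y"] by auto
    then show "z \<in> cls x \<longleftrightarrow> z \<in> cls y" by (simp add: mem_cls)
  qed
qed

lemma cls_eq_polys: "x \<in> polys \<Longrightarrow> y \<in> polys \<Longrightarrow> cls x = cls y \<longleftrightarrow> x \<approx> y"
  using rel_ideal_iff[OF polys_diff, of x y] by (simp add: cls_eq_iff lpa_eq_def)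

lemma cls_clean_eq:
  assumes "x \<in> aug" "y \<in> aug" "x \<approx> y"
  shows "cls (clean x) = cls (clean y)"
  using cls_eq_polys[OF clean_polys[OF assms(1)] clean_polys[OF assms(2)]]
    lpa_eq_trans[OF lpa_eq_trans[OF clean_eqv assms(3)] lpa_eq_sym[OF clean_eqv]] by blast

lemma lpa_carrier: "carrier (lpa G) = cls ` polys"
  by (auto simp: lpa_def FactRing_def A_RCOSETS_def' lpa_class_def)

lemma lpa_zero: "\<zero>\<^bsub>lpa G\<^esub> = cls 0"
  by (simp add: lpa_def FactRing_def cls_def')

lemma lpa_add: "cls x \<oplus>\<^bsub>lpa G\<^esub> cls y = cls (x + y)"
proof -
  have "cls x \<oplus>\<^bsub>lpa G\<^esub> cls y = (\<Union>h\<in>cls x. \<Union>k\<in>cls y. {h + k})"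
    by (simp add: lpa_def FactRing_def set_add_def') (simp add: free_algebra_def)
  also have "\<dots> = cls (x + y)"
  proof (intro Set.set_eqI iffI)
    fix z assume "z \<in> (\<Union>h\<in>cls x. \<Union>k\<in>cls y. {h + k})"
    then obtain h k where hk: "h \<in> cls x" "k \<in> cls y" "z = h + k" by blast
    have "(h - x) + (k - y) \<in> lpa_rel_ideal G" using hk by (intro rel_ideal_add) (auto simp: mem_cls)
    then show "z \<in> cls (x + y)" using hk by (simp add: mem_cls algebra_simps)
  next
    fix z assume "z \<in> cls (x + y)"
    then have "z - y \<in> cls x" by (simp add: mem_cls algebra_simps)
    moreover have "y \<in> cls y" by (simp add: mem_cls rel_ideal_zero)
    moreover have "z = (z - y) + y" by simp
    ultimately show "z \<in> (\<Union>h\<in>cls x. \<Union>k\<in>cls y. {h + k})" by blast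
  qed
  finally show ?thesis .
qed

lemma lpa_mult:
  assumes "x \<in> polys" "y \<in> polys"
  shows "cls x \<otimes>\<^bsub>lpa G\<^esub> cls y = cls (x * y)"
proof -
  have "cls x \<otimes>\<^bsub>lpa G\<^esub> cls y = (\<Union>a\<in>cls x. \<Union>b\<in>cls y. cls (a * b))"
    by (simp add: lpa_def FactRing_def rcoset_mult_def lpa_class_def) (simp add: free_algebra_def)
  also have "\<dots> = (\<Union>a\<in>cls x. \<Union>b\<in>cls y. cls (x * y))"
  proof -
    have "cls (a * b) = cls (x * y)" if ab: "a \<in> cls x" "b \<in> cls y" for a b
    proof -
      have "b - y \<in> polys" using ab rel_ideal_polys by (auto simp: mem_cls)
      then have b: "b \<in> polys" using polys_add[OF _ assms(2), of "b - y"] by simp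
      have "(a - x) * b + x * (b - y) \<in> lpa_rel_ideal G"
        using ab assms b by (intro rel_ideal_add rel_ideal_left rel_ideal_right) (auto simp: mem_cls)
      then show ?thesis by (simp add: cls_eq_iff algebra_simps)
    qed
    then show ?thesis by simp
  qed
  also have "\<dots> = cls (x * y)"
  proof -
    have "x \<in> cls x" "y \<in> cls y" by (simp_all add: mem_cls rel_ideal_zero)
    then show ?thesis by blast
  qed
  finally show ?thesis .
qed

lemma lpa_abelian_group: "abelian_group (lpa G :: ('v, 'e, 'k::field) lpa_elem ring)"
proof (rule abelian_groupI)
  fix x y z :: "('v, 'e, 'k) lpa_elem" assume "x \<in> carrier (lpa G)" "y \<in> carrier (lpa G)" "z \<in> carrier (lpa G)"
  then obtain a b c where "x = cls a" "a \<in> polys" "y = cls b" "b \<in> polys" "z = cls c" "c \<in> polys"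
    by (auto simp: lpa_carrier)
  then show "x \<oplus>\<^bsub>lpa G\<^esub> y \<oplus>\<^bsub>lpa G\<^esub> z = x \<oplus>\<^bsub>lpa G\<^esub> (y \<oplus>\<^bsub>lpa G\<^esub> z)"
    by (simp add: lpa_add add.assoc)
next
  fix x y :: "('v, 'e, 'k) lpa_elem" assume "x \<in> carrier (lpa G)" "y \<in> carrier (lpa G)"
  then obtain a b where ab: "x = cls a" "a \<in> polys" "y = cls b" "b \<in> polys"
    by (auto simp: lpa_carrier)
  then show "x \<oplus>\<^bsub>lpa G\<^esub> y = y \<oplus>\<^bsub>lpa G\<^esub> x" by (simp add: lpa_add add.commute)
  show "x \<oplus>\<^bsub>lpa G\<^esub> y \<in> carrier (lpa G)"
    using ab polys_add[OF ab(2,4)] by (auto simp: lpa_add lpa_carrier)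
next
  fix x :: "('v, 'e, 'k) lpa_elem" assume "x \<in> carrier (lpa G)"
  then obtain a where a: "x = cls a" "a \<in> polys" by (auto simp: lpa_carrier)
  then show "\<zero>\<^bsub>lpa G\<^esub> \<oplus>\<^bsub>lpa G\<^esub> x = x" by (simp add: lpa_add lpa_zero)
  have "cls (- a) \<oplus>\<^bsub>lpa G\<^esub> x = \<zero>\<^bsub>lpa G\<^esub>" using a by (simp add: lpa_add lpa_zero)
  then show "\<exists>y\<in>carrier (lpa G). y \<oplus>\<^bsub>lpa G\<^esub> x = \<zero>\<^bsub>lpa G\<^esub>"
    using polys_uminus[OF a(2)] by (auto simp: lpa_carrier)
qed (auto simp: lpa_zero lpa_carrier intro: polys_zero)

lemma lpa_uminus: "x \<in> polys \<Longrightarrow> \<ominus>\<^bsub>lpa G\<^esub> cls x = cls (- x)"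
  using polys_uminus
  by (intro abelian_group.minus_equality[OF lpa_abelian_group]) (auto simp: lpa_add lpa_zero lpa_carrier)

lemma lpa_finsum:
  assumes "finite N" "\<And>n. n \<in> N \<Longrightarrow> z n \<in> polys"
  shows "(\<Oplus>\<^bsub>lpa G\<^esub>n\<in>N. cls (z n)) = cls (\<Sum>n\<in>N. z n)"
proof -
  interpret L: abelian_group "lpa G" by (rule lpa_abelian_group)
  show ?thesis
    using assms
  proof (induction N rule: finite_induct)
    case empty
    then show ?case by (simp add: lpa_zero)
  next
    case (insert n N)
    then have "(\<lambda>n. cls (z n)) \<in> N \<rightarrow> carrier (lpa G)" "cls (z n) \<in> carrier (lpa G)"
      by (auto simp: lpa_carrier)
    then show ?case using insert by (simp add: L.finsum_insert lpa_add)
  qed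
qed


subsection \<open>Ideals\<close>

text \<open>The correspondence between the ideals of the quotient and their encodings in the free algebra.\<close>

definition push :: "('v, 'e, 'k::field) gen_poly set \<Rightarrow> ('v, 'e, 'k) lpa_elem set" where
  "push I = cls ` (I \<inter> polys)"

definition lift :: "('v, 'e, 'k::field) lpa_elem set \<Rightarrow> ('v, 'e, 'k) gen_poly set" where
  "lift P = {x\<in>aug. cls (clean x) \<in> P}"

lemma two_sided_ideal_iff:
  fixes P :: "('v, 'e, 'k::field) lpa_elem set"
  shows "two_sided_ideal (lpa G) P \<longleftrightarrow> P \<subseteq> carrier (lpa G) \<and> cls 0 \<in> P \<and>
     (\<forall>x\<in>polys. \<forall>y\<in>polys. cls x \<in> P \<longrightarrow> cls y \<in> P \<longrightarrow> cls (x + y) \<in> P) \<and>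
     (\<forall>x\<in>polys. cls x \<in> P \<longrightarrow> cls (- x) \<in> P) \<and>
     (\<forall>x\<in>polys. \<forall>y\<in>polys. cls x \<in> P \<longrightarrow> cls (y * x) \<in> P \<and> cls (x * y) \<in> P)"
  (is "?L \<longleftrightarrow> ?R")
proof
  interpret L: abelian_group "lpa G" by (rule lpa_abelian_group)
  assume ?L
  then interpret additive_subgroup P "lpa G" by (simp add: two_sided_ideal_def)
  have mult: "y \<otimes>\<^bsub>lpa G\<^esub> a \<in> P \<and> a \<otimes>\<^bsub>lpa G\<^esub> y \<in> P" if "a \<in> P" "y \<in> carrier (lpa G)" for a y
    using \<open>?L\<close> that by (simp add: two_sided_ideal_def)
  show ?R
  proof (intro conjI ballI impI)
    show "P \<subseteq> carrier (lpa G)" by (rule a_subset)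
    show "cls 0 \<in> P" using zero_closed by (simp add: lpa_zero)
    show "cls (x + y) \<in> P" if "cls x \<in> P" "cls y \<in> P" for x y
      using a_closed[OF that] by (simp add: lpa_add)
    show "cls (- x) \<in> P" if "x \<in> polys" "cls x \<in> P" for x
      using a_inv_closed[OF that(2)] lpa_uminus[OF that(1)] by simp
    show "cls (y * x) \<in> P" "cls (x * y) \<in> P" if "x \<in> polys" "y \<in> polys" "cls x \<in> P" for x y
      using mult[OF that(3), of "cls y"] that by (auto simp: lpa_mult lpa_carrier)
  qed
next
  assume R: ?R
  have rep: "\<exists>x\<in>polys. a = cls x" if "a \<in> P" for a using R that by (auto simp: lpa_carrier)
  show ?L
    unfolding two_sided_ideal_def
  proof (intro conjI ballI)
    show "additive_subgroup P (lpa G)"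
    proof (rule additive_subgroupI, rule subgroup.intro)
      show "P \<subseteq> carrier (add_monoid (lpa G))" using R by simp
      show "\<one>\<^bsub>add_monoid (lpa G)\<^esub> \<in> P" using R by (simp add: lpa_zero)
      fix a assume a: "a \<in> P"
      then obtain x where x: "x \<in> polys" "a = cls x" using rep by blast
      show "inv\<^bsub>add_monoid (lpa G)\<^esub> a \<in> P"
        using R a x lpa_uminus[OF x(1)] by (simp add: a_inv_def)
      fix b assume b: "b \<in> P"
      then obtain y where y: "y \<in> polys" "b = cls y" using rep by blast
      show "a \<otimes>\<^bsub>add_monoid (lpa G)\<^esub> b \<in> P"
        using R a b x y by (simp add: lpa_add)
    qed
  next
    fix a y :: "('v, 'e, 'k) lpa_elem" assume a: "a \<in> P" and y: "y \<in> carrier (lpa G)"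
    obtain x where x: "x \<in> polys" "a = cls x" using rep[OF a] by blast
    obtain z where z: "z \<in> polys" "y = cls z" using y by (auto simp: lpa_carrier)
    show "y \<otimes>\<^bsub>lpa G\<^esub> a \<in> P" "a \<otimes>\<^bsub>lpa G\<^esub> y \<in> P"
      using R a x z by (simp_all add: lpa_mult)
  qed
qed

text \<open>Ideals of the quotient are not assumed to be subspaces. They are closed under scalars, and under
  multiplication by polynomials with a constant term, because the path algebra has local units.\<close>

lemma lift_ideal:
  fixes P :: "('v, 'e, 'k::field) lpa_elem set"
  assumes "two_sided_ideal (lpa G) P"
  shows "lpa_ideal G (lift P)"
proof -
  note P = assms[unfolded two_sided_ideal_iff]
  have zero: "x \<in> lift P" if "x \<in> aug" "x \<approx> 0" for x
    using cls_clean_eq[OF that(1) _ that(2)] that(1) P by (simp add: lift_def)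
  have mult: "x * a \<in> lift P \<and> a * x \<in> lift P" if a: "a \<in> lift P" for a x
  proof -
    have aug: "a \<in> aug" using a by (simp add: lift_def)
    obtain A where A: "xp A * a \<approx> a" "a * xp A \<approx> a" using local_units[OF aug] by blast
    have m: "clean y * clean a = clean (y * a)" "clean a * clean y = clean (a * y)" for y
      by (simp_all add: clean_mult)
    have in_P: "cls (clean (y * a)) \<in> P \<and> cls (clean (a * y)) \<in> P" if "y \<in> aug" for y
      using P clean_polys[OF that] clean_polys[OF aug] a unfolding m[symmetric] by (simp add: lift_def)
    have "cls (clean (x * xp A * a)) = cls (clean (x * a))"
      by (rule cls_clean_eq) (use aug lpa_eq_left[OF A(1), of x] in \<open>auto simp: mult.assoc\<close>)
    moreover have "cls (clean (a * (xp A * x))) = cls (clean (a * x))"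
      by (rule cls_clean_eq) (use aug lpa_eq_right[OF A(2), of x] in \<open>auto simp: mult.assoc\<close>)
    ultimately show ?thesis
      using in_P[of "x * xp A"] in_P[of "xp A * x"] aug by (simp add: lift_def)
  qed
  have "ring_ideal (lift P)"
    unfolding ring_ideal_def
  proof (intro conjI ballI allI)
    show "0 \<in> lift P" by (rule zero) auto
    show "a + b \<in> lift P" if "a \<in> lift P" "b \<in> lift P" for a b
    proof -
      have aug: "a \<in> aug" "b \<in> aug" and mem: "cls (clean a) \<in> P" "cls (clean b) \<in> P"
        using that by (auto simp: lift_def)
      have "cls (clean a + clean b) \<in> P"
        using P mem clean_polys[OF aug(1)] clean_polys[OF aug(2)] by blast
      then show ?thesis using aug by (simp add: lift_def)
    qed
  qed (use mult in auto)
  moreover have "lpa_relators G \<subseteq> lift P"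
    using zero lpa_relators_aug lpa_eq_relator[of _ 0 G] by auto
  moreover have "letter g \<in> lift P" if "g \<notin> gens G" for g
    using zero[OF _ superfluous_letter[OF that]] by simp
  ultimately show ?thesis by (auto simp: lpa_ideal_def lift_def)
qed

lemma cls_push_iff:
  fixes I :: "('v, 'e, 'k::field) gen_poly set"
  assumes I: "lpa_ideal G I" and x: "x \<in> polys"
  shows "cls x \<in> push I \<longleftrightarrow> x \<in> I"
proof
  assume "cls x \<in> push I"
  then obtain y where y: "y \<in> I" "y \<in> polys" "cls x = cls y" by (auto simp: push_def)
  then have "x \<approx> y" using cls_eq_polys[OF x] by blast
  then show "x \<in> I" using y lpa_eq_ideal[OF _ I] by blast
qed (use x in \<open>auto simp: push_def\<close>)

lemma push_ideal:
  fixes I :: "('v, 'e, 'k::field) gen_poly set"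
  assumes I: "lpa_ideal G I"
  shows "two_sided_ideal (lpa G) (push I)"
  unfolding two_sided_ideal_iff
proof (intro conjI ballI impI)
  show "push I \<subseteq> carrier (lpa G)" by (auto simp: push_def lpa_carrier)
  show "cls 0 \<in> push I" by (simp add: cls_push_iff[OF I polys_zero] lpa_ideal_zero[OF I])
  fix x assume x: "x \<in> polys" "cls x \<in> push I"
  then have xI: "x \<in> I" using cls_push_iff[OF I] by blast
  show "cls (- x) \<in> push I"
    using lpa_ideal_uminus[OF I xI] cls_push_iff[OF I polys_uminus[OF x(1)]] by blast
  fix y :: "('v, 'e, 'k) gen_poly" assume y: "y \<in> polys"
  show "cls (y * x) \<in> push I" "cls (x * y) \<in> push I"
    using lpa_ideal_left[OF I xI] lpa_ideal_right[OF I xI] polys_mult[OF x(1) y] polys_mult[OF y x(1)]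
    by (simp_all add: cls_push_iff[OF I])
  assume "cls y \<in> push I"
  then have "y \<in> I" using cls_push_iff[OF I y] by blast
  then show "cls (x + y) \<in> push I"
    using lpa_ideal_add[OF I xI] polys_add[OF x(1) y] by (simp add: cls_push_iff[OF I])
qed

lemma lift_push:
  assumes I: "lpa_ideal G I"
  shows "lift (push I) = I"
proof (intro Set.set_eqI)
  fix x
  have "x \<in> lift (push I) \<longleftrightarrow> x \<in> aug \<and> clean x \<in> I"
    using cls_push_iff[OF I clean_polys] by (auto simp: lift_def)
  also have "\<dots> \<longleftrightarrow> x \<in> I"
    using lpa_eq_ideal[OF clean_eqv I] lpa_ideal_subset_aug[OF I] by blast
  finally show "x \<in> lift (push I) \<longleftrightarrow> x \<in> I" .
qed

lemma push_lift:
  assumes "P \<subseteq> carrier (lpa G)"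
  shows "push (lift P) = P"
proof
  show "push (lift P) \<subseteq> P" by (auto simp: push_def lift_def polys_iff)
  show "P \<subseteq> push (lift P)"
  proof
    fix a assume a: "a \<in> P"
    then obtain x where "x \<in> polys" "a = cls x" using assms by (auto simp: lpa_carrier)
    then show "a \<in> push (lift P)" using a by (auto simp: push_def lift_def polys_iff)
  qed
qed

lemma two_sided_ideal_subset: "two_sided_ideal (lpa G) P \<Longrightarrow> P \<subseteq> carrier (lpa G)"
  by (simp add: two_sided_ideal_iff)

lemma push_mono: "I \<subseteq> J \<Longrightarrow> push I \<subseteq> push J"
  by (auto simp: push_def)

lemma lift_mono: "P \<subseteq> Q \<Longrightarrow> lift P \<subseteq> lift Q"
  by (auto simp: lift_def)

lemma push_aug: "push aug = carrier (lpa G)"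
  by (auto simp: push_def lpa_carrier polys_iff)

lemma generated_ideal_push:
  assumes Y: "Y \<subseteq> polys"
  shows "generated_ideal (lpa G) (cls ` Y) = push (lpa_gen G Y)"
proof
  have I: "lpa_ideal G (lpa_gen G Y)" using Y polys_aug by (intro lpa_gen_ideal) blast
  have "cls ` Y \<subseteq> push (lpa_gen G Y)" using Y lpa_gen_superset[of Y G] by (auto simp: push_def)
  then show "generated_ideal (lpa G) (cls ` Y) \<subseteq> push (lpa_gen G Y)"
    unfolding generated_ideal_def using push_ideal[OF I] by blast
  show "push (lpa_gen G Y) \<subseteq> generated_ideal (lpa G) (cls ` Y)"
    unfolding generated_ideal_def
  proof (rule Inter_greatest)
    fix P assume "P \<in> {I. two_sided_ideal (lpa G) I \<and> cls ` Y \<subseteq> I}"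
    then have P: "two_sided_ideal (lpa G) P" "cls ` Y \<subseteq> P" by auto
    have "Y \<subseteq> lift P"
    proof
      fix x assume x: "x \<in> Y"
      then have "x \<in> aug" "clean x = x" using Y polys_iff by blast+
      then show "x \<in> lift P" using P(2) x by (auto simp: lift_def)
    qed
    then have "push (lpa_gen G Y) \<subseteq> push (lift P)"
      by (intro push_mono lpa_gen_least lift_ideal P(1))
    then show "push (lpa_gen G Y) \<subseteq> P" using push_lift[OF two_sided_ideal_subset[OF P(1)]] by simp
  qed
qed

lemma ideal_of_pair_push:
  assumes "H \<subseteq> gverts G" "S \<subseteq> breaking G H"
  shows "ideal_of_pair G H S = push (pair_ideal G H S)"
proof -
  have "xp A \<in> polys" if "A \<in> H" for A using that assms polys_generators(1) by blast
  moreover have "breaking_gen G H w \<in> polys" if "w \<in> S" for w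
    unfolding breaking_gen_def using that assms breaking_edges
    by (intro polys_diff polys_sum polys_mult polys_generators) (auto simp: emitted_def)
  ultimately have "xp ` H \<union> breaking_gen G H ` S \<subseteq> polys" by blast
  from generated_ideal_push[OF this] show ?thesis
    by (simp add: ideal_of_pair_def pair_ideal_def image_Un image_image)
qed

lemma prime_lift_iff:
  fixes P :: "('v, 'e, 'k::field) lpa_elem set"
  assumes P: "two_sided_ideal (lpa G) P"
  shows "prime_two_sided_ideal (lpa G) P \<longleftrightarrow> prime_lpa_ideal G (lift P)"
proof -
  note PI = lift_ideal[OF P] and Pc = two_sided_ideal_subset[OF P]
  have "lift P = aug \<longleftrightarrow> P = carrier (lpa G)"
    using push_lift[OF Pc] lift_push[OF lpa_ideal_aug] push_aug by metis
  moreover have "(\<forall>I J. two_sided_ideal (lpa G) I \<and> two_sided_ideal (lpa G) J \<and>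
        (\<forall>a\<in>I. \<forall>b\<in>J. a \<otimes>\<^bsub>lpa G\<^esub> b \<in> P) \<longrightarrow> I \<subseteq> P \<or> J \<subseteq> P) \<longleftrightarrow>
      (\<forall>J K. lpa_ideal G J \<and> lpa_ideal G K \<and> (\<forall>a\<in>J. \<forall>b\<in>K. a * b \<in> lift P) \<longrightarrow> J \<subseteq> lift P \<or> K \<subseteq> lift P)"
    (is "?A \<longleftrightarrow> ?B")
  proof
    assume A: ?A
    show ?B
    proof (intro allI impI, elim conjE)
      fix J K :: "('v, 'e, 'k) gen_poly set"
      assume JK: "lpa_ideal G J" "lpa_ideal G K" "\<forall>a\<in>J. \<forall>b\<in>K. a * b \<in> lift P"
      have "a \<otimes>\<^bsub>lpa G\<^esub> b \<in> P" if ab: "a \<in> push J" "b \<in> push K" for a b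
      proof -
        obtain x y where xy: "x \<in> J" "x \<in> polys" "a = cls x" "y \<in> K" "y \<in> polys" "b = cls y"
          using ab unfolding push_def by blast
        have "x * y \<in> lift P" using JK xy by blast
        then show ?thesis using xy polys_mult[OF xy(2,5)] by (simp add: lpa_mult lift_def polys_iff)
      qed
      then have "push J \<subseteq> P \<or> push K \<subseteq> P" using A push_ideal[OF JK(1)] push_ideal[OF JK(2)] by blast
      then show "J \<subseteq> lift P \<or> K \<subseteq> lift P"
        using lift_mono[of "push J" P] lift_mono[of "push K" P] lift_push[OF JK(1)] lift_push[OF JK(2)] by auto
    qed
  next
    assume B: ?B
    show ?A
    proof (intro allI impI, elim conjE)
      fix I J :: "('v, 'e, 'k) lpa_elem set"
      assume IJ: "two_sided_ideal (lpa G) I" "two_sided_ideal (lpa G) J" "\<forall>a\<in>I. \<forall>b\<in>J. a \<otimes>\<^bsub>lpa G\<^esub> b \<in> P"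
      have "x * y \<in> lift P" if xy: "x \<in> lift I" "y \<in> lift J" for x y
      proof -
        have aug: "x \<in> aug" "y \<in> aug" using xy by (auto simp: lift_def)
        have "cls (clean x) \<otimes>\<^bsub>lpa G\<^esub> cls (clean y) \<in> P" using IJ(3) xy by (auto simp: lift_def)
        then show ?thesis
          using aug by (simp add: lpa_mult[OF clean_polys clean_polys] lift_def clean_mult)
      qed
      then have "lift I \<subseteq> lift P \<or> lift J \<subseteq> lift P" using B lift_ideal[OF IJ(1)] lift_ideal[OF IJ(2)] by blast
      then show "I \<subseteq> P \<or> J \<subseteq> P"
        using push_mono[of "lift I" "lift P"] push_mono[of "lift J" "lift P"] push_lift[OF Pc]
          push_lift[OF two_sided_ideal_subset[OF IJ(1)]] push_lift[OF two_sided_ideal_subset[OF IJ(2)]] by auto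
    qed
  qed
  ultimately show ?thesis
    unfolding prime_two_sided_ideal_def prime_lpa_ideal_iff using P PI by blast
qed

lemma degree_part_eqv:
  fixes x y :: "('v, 'e, 'k::field) gen_poly"
  assumes "x \<approx> y"
  shows "degree_part n x \<approx> degree_part n y"
proof -
  have "graded (lpa_gen G {} :: ('v, 'e, 'k) gen_poly set)" by (rule lpa_gen_homogeneous_graded) auto
  then have "degree_part n (x - y) \<in> lpa_gen G {}" using assms by (auto simp: graded_def lpa_eq_def)
  then show ?thesis by (simp add: lpa_eq_def)
qed

lemma graded_lift_iff:
  fixes P :: "('v, 'e, 'k::field) lpa_elem set"
  assumes P: "two_sided_ideal (lpa G) P"
  shows "lpa_graded_ideal G P \<longleftrightarrow> graded (lift P)"
proof
  note PI = lift_ideal[OF P]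
  interpret L: abelian_group "lpa G :: ('v, 'e, 'k) lpa_elem ring" by (rule lpa_abelian_group)
  assume gr: "lpa_graded_ideal G P"
  show "graded (lift P)"
    unfolding graded_def
  proof (intro ballI allI)
    fix a m assume a: "a \<in> lift P"
    then have aug: "a \<in> aug" and aP: "cls (clean a) \<in> P" by (auto simp: lift_def)
    obtain N y where N: "finite N" "\<forall>n\<in>N. y n \<in> P \<inter> lpa_component G n"
      "cls (clean a) = (\<Oplus>\<^bsub>lpa G\<^esub>n\<in>N. y n)"
      using gr aP unfolding lpa_graded_ideal_def by blast
    have "\<forall>n\<in>N. \<exists>z. y n = cls z \<and> z \<in> polys \<and> homogeneous n z"
      using N(2) by (auto simp: lpa_component_def homogeneous_def)
    then obtain z where z: "\<And>n. n \<in> N \<Longrightarrow> y n = cls (z n)" "\<And>n. n \<in> N \<Longrightarrow> z n \<in> polys"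
      "\<And>n. n \<in> N \<Longrightarrow> homogeneous n (z n)" by metis
    have zP: "z n \<in> lift P" if "n \<in> N" for n
      using N(2) z[OF that] that by (auto simp: lift_def polys_iff)
    have "(\<Oplus>\<^bsub>lpa G\<^esub>n\<in>N. y n) = (\<Oplus>\<^bsub>lpa G\<^esub>n\<in>N. cls (z n))"
      by (rule L.finsum_cong') (use z in \<open>auto simp: lpa_carrier\<close>)
    also have "\<dots> = cls (\<Sum>n\<in>N. z n)" by (rule lpa_finsum[OF N(1) z(2)])
    finally have "clean a \<approx> (\<Sum>n\<in>N. z n)"
      using N(3) cls_eq_polys[OF clean_polys[OF aug] polys_sum[of N z]] z(2) by simp
    then have "a \<approx> (\<Sum>n\<in>N. z n)" using lpa_eq_trans[OF lpa_eq_sym[OF clean_eqv]] by blast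
    then have "degree_part m a \<approx> degree_part m (\<Sum>n\<in>N. z n)" by (rule degree_part_eqv)
    moreover have "degree_part m (\<Sum>n\<in>N. z n) \<in> lift P"
      unfolding part_sum
    proof (rule lpa_ideal_sum[OF PI])
      fix n assume n: "n \<in> N"
      show "degree_part m (z n) \<in> lift P"
        using degree_part_homogeneous[OF z(3)[OF n], of m] zP[OF n] lpa_ideal_zero[OF PI] by simp
    qed
    ultimately show "degree_part m a \<in> lift P" using lpa_eq_ideal[OF _ PI] by blast
  qed
next
  assume gr: "graded (lift P)"
  show "lpa_graded_ideal G P"
    unfolding lpa_graded_ideal_def
  proof (intro conjI ballI P)
    fix x assume x: "x \<in> P"
    then obtain a where a: "a \<in> polys" "x = cls a"
      using two_sided_ideal_subset[OF P] by (auto simp: lpa_carrier)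
    have aP: "a \<in> lift P" using a x by (auto simp: lift_def polys_iff)
    let ?N = "word_degree ` Poly_Mapping.keys a" and ?y = "\<lambda>n. cls (degree_part n a)"
    have part: "degree_part n a \<in> polys" for n by (rule polys_degree_part[OF a(1)])
    have "?y n \<in> P \<inter> lpa_component G n" for n
    proof
      have "degree_part n a \<in> lift P" using gr aP by (auto simp: graded_def)
      then show "?y n \<in> P" using part[of n] by (auto simp: lift_def polys_iff)
      show "?y n \<in> lpa_component G n"
        using part[of n] homogeneous_degree_part[of n a] unfolding lpa_component_def homogeneous_def by blast
    qed
    moreover have "x = (\<Oplus>\<^bsub>lpa G\<^esub>n\<in>?N. ?y n)"
      using lpa_finsum[of ?N "\<lambda>n. degree_part n a"] part a(2) sum_degree_parts[of ?N a] by simp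
    ultimately show "\<exists>N y. finite N \<and> (\<forall>n\<in>N. y n \<in> P \<inter> lpa_component G n) \<and> x = (\<Oplus>\<^bsub>lpa G\<^esub>n\<in>N. y n)"
      by (intro exI[of _ ?N] exI[of _ ?y]) simp
  qed
qed


section \<open>The graded prime ideals\<close>

lemma pair_ideal_prime_directed:
  assumes H: "hereditary G H" "saturated G H" and dir: "downward_directed G (gverts G - H)"
  shows "prime_lpa_ideal G (pair_ideal G H (breaking G H) :: ('v, 'e, 'k::field) gen_poly set)"
proof (rule pair_ideal_prime[OF H(1)])
  let ?I = "pair_ideal G H (breaking G H) :: ('v, 'e, 'k) gen_poly set"
  show sets: "ideal_sets ?I = H" by (rule pair_ideal_faithful(1)[OF H subset_refl])
  have notin: "xp A \<notin> ?I" if "A \<in> gverts G - H" for A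
  proof
    assume "xp A \<in> ?I"
    then have "A \<in> ideal_sets ?I" using that by (simp add: ideal_sets_def)
    then show False using that sets by blast
  qed
  obtain A where A: "A \<in> gverts G - H" using dir by (auto simp: downward_directed_def)
  show "?I \<noteq> aug" using notin[OF A] by auto
  fix J K :: "('v, 'e, 'k) gen_poly set"
  assume JK: "lpa_ideal G J" "lpa_ideal G K"
    "(\<exists>A\<in>gverts G - H. xp A \<in> J) \<or> (\<exists>w\<in>breaking G H - breaking G H. breaking_gen G H w \<in> J)"
    "(\<exists>A\<in>gverts G - H. xp A \<in> K) \<or> (\<exists>w\<in>breaking G H - breaking G H. breaking_gen G H w \<in> K)"
  then obtain A B where AB: "A \<in> gverts G - H" "xp A \<in> J" "B \<in> gverts G - H" "xp B \<in> K" by blast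
  then obtain C where C: "C \<in> gverts G - H" "reaches G A C" "reaches G B C"
    using dir unfolding downward_directed_def by blast
  have "xp C \<in> J" "xp C \<in> K"
    using reaches_in_ideal[OF JK(1) _ AB(2) _ C(2)] reaches_in_ideal[OF JK(2) _ AB(4) _ C(3)] AB C by auto
  moreover have "xp C * xp C \<notin> ?I"
    using notin[OF C(1)] C(1) lpa_eq_ideal[OF p_idem pair_ideal_ideal] by blast
  ultimately show "\<exists>x. x \<in> J \<and> x \<in> K \<and> x * x \<notin> ?I" by blast
qed

lemma pair_ideal_prime_breaking:
  assumes H: "hereditary G H" "saturated G H" and w: "w \<in> breaking G H"
    and reach: "\<forall>A\<in>gverts G - H. reaches G A {w}"
  shows "prime_lpa_ideal G (pair_ideal G H (breaking G H - {w}) :: ('v, 'e, 'k::field) gen_poly set)"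
proof (rule pair_ideal_prime[OF H(1)])
  let ?I = "pair_ideal G H (breaking G H - {w}) :: ('v, 'e, 'k) gen_poly set"
  let ?b = "breaking_gen G H w :: ('v, 'e, 'k) gen_poly"
  have sub: "breaking G H - {w} \<subseteq> breaking G H" by blast
  show "ideal_sets ?I = H" by (rule pair_ideal_faithful(1)[OF H sub])
  have notin: "?b \<notin> ?I" using pair_ideal_faithful(2)[OF H sub w, where 'k = 'k] by blast
  then show "?I \<noteq> aug" by auto
  note wG = breaking_edges(4)[OF w]
  have mem: "?b \<in> J" if J: "lpa_ideal G J"
    "(\<exists>A\<in>gverts G - H. xp A \<in> J) \<or> (\<exists>v\<in>breaking G H - (breaking G H - {w}). breaking_gen G H v \<in> J)" for J
    using J(2)
  proof
    assume "\<exists>A\<in>gverts G - H. xp A \<in> J"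
    then obtain A where A: "A \<in> gverts G - H" "xp A \<in> J" by blast
    then have "xp {w} \<in> J" using reaches_in_ideal[OF J(1) _ A(2) wG] reach by blast
    then have "xp {w} * ?b \<in> J" by (rule lpa_ideal_right[OF J(1)])
    moreover have "xp {w} * ?b \<approx> ?b" using p_breaking_gen[OF w wG, where 'k = 'k] by simp
    ultimately show ?thesis using lpa_eq_ideal[OF _ J(1)] by blast
  qed auto
  have "?b * ?b \<approx> ?b"
  proof -
    let ?E = "{e \<in> emitted G w. rng G e \<notin> H}"
    note fin = breaking_edges[OF w]
    have q: "range_sum ?E * ?b \<approx> 0"
    proof -
      have "range_sum ?E * ?b = range_sum ?E * xp {w} - range_sum ?E * (range_sum ?E :: ('v, 'e, 'k) gen_poly)"
        by (simp add: breaking_gen_eq right_diff_distrib)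
      also have "\<dots> \<approx> range_sum {e \<in> ?E. src G e \<in> {w}} - range_sum ?E"
        by (intro lpa_eq_diff range_sum_p range_sum_idem fin)
      also have "{e \<in> ?E. src G e \<in> {w}} = ?E" by (auto simp: emitted_def)
      finally show ?thesis by simp
    qed
    have "?b * ?b = xp {w} * ?b - range_sum ?E * ?b"
      by (simp add: breaking_gen_eq left_diff_distrib)
    also have "\<dots> \<approx> ?b - 0"
      using lpa_eq_diff[OF p_breaking_gen[OF w wG, where 'k = 'k] q] by simp
    finally show ?thesis by simp
  qed
  then have "?b * ?b \<notin> ?I" using notin lpa_eq_ideal[OF _ pair_ideal_ideal] by blast
  then show "\<exists>x. x \<in> J \<and> x \<in> K \<and> x * x \<notin> ?I"
    if "lpa_ideal G J" "lpa_ideal G K"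
    "(\<exists>A\<in>gverts G - H. xp A \<in> J) \<or> (\<exists>v\<in>breaking G H - (breaking G H - {w}). breaking_gen G H v \<in> J)"
    "(\<exists>A\<in>gverts G - H. xp A \<in> K) \<or> (\<exists>v\<in>breaking G H - (breaking G H - {w}). breaking_gen G H v \<in> K)"
    for J K using mem that by blast
qed

lemma push_graded_prime:
  assumes "prime_lpa_ideal G (pair_ideal G H S :: ('v, 'e, 'k::field) gen_poly set)"
    and "hereditary G H" "S \<subseteq> breaking G H"
  shows "prime_two_sided_ideal (lpa G) (ideal_of_pair G H S :: ('v, 'e, 'k) lpa_elem set)"
    and "lpa_graded_ideal G (ideal_of_pair G H S :: ('v, 'e, 'k) lpa_elem set)"
proof -
  let ?I = "pair_ideal G H S :: ('v, 'e, 'k) gen_poly set"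
  have eq: "ideal_of_pair G H S = push ?I"
    using assms by (intro ideal_of_pair_push) (auto simp: hereditary_def)
  have ideal: "two_sided_ideal (lpa G) (push ?I)" by (rule push_ideal[OF pair_ideal_ideal])
  show "prime_two_sided_ideal (lpa G) (ideal_of_pair G H S :: ('v, 'e, 'k) lpa_elem set)"
    unfolding eq prime_lift_iff[OF ideal] lift_push[OF pair_ideal_ideal] by (rule assms(1))
  show "lpa_graded_ideal G (ideal_of_pair G H S :: ('v, 'e, 'k) lpa_elem set)"
    unfolding eq graded_lift_iff[OF ideal] lift_push[OF pair_ideal_ideal] by (rule pair_ideal_graded)
qed

end

theorem theorem3p4:
  fixes G :: "('v, 'e) ultragraph"
    and X1 X2 :: "('v, 'e, 'k::field) lpa_elem set set"
  assumes "ultragraph G"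
    and "X1 = {ideal_of_pair G H (breaking G H) | H.
           hereditary G H \<and> saturated G H \<and> downward_directed G (gverts G - H)}"
    and "X2 = {ideal_of_pair G H (breaking G H - {w}) | H w.
           hereditary G H \<and> saturated G H \<and> w \<in> breaking G H \<and>
           (\<forall>A\<in>gverts G - H. reaches G A {w})}"
  shows "X1 \<union> X2 = {P. prime_two_sided_ideal (lpa G) P \<and> lpa_graded_ideal G P}"
proof
  interpret ultragraph G by (rule assms(1))
  show "X1 \<union> X2 \<subseteq> {P. prime_two_sided_ideal (lpa G) P \<and> lpa_graded_ideal G P}"
  proof
    fix P assume "P \<in> X1 \<union> X2"
    then consider H where "P = ideal_of_pair G H (breaking G H)" "hereditary G H" "saturated G H"
        "downward_directed G (gverts G - H)"
      | H w where "P = ideal_of_pair G H (breaking G H - {w})" "hereditary G H" "saturated G H"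
        "w \<in> breaking G H" "\<forall>A\<in>gverts G - H. reaches G A {w}"
      unfolding assms(2,3) by blast
    then show "P \<in> {P. prime_two_sided_ideal (lpa G) P \<and> lpa_graded_ideal G P}"
    proof cases
      case 1
      show ?thesis
        using push_graded_prime[OF pair_ideal_prime_directed[OF 1(2-4)] 1(2) subset_refl] 1(1) by simp
    next
      case 2
      show ?thesis
        using push_graded_prime[OF pair_ideal_prime_breaking[OF 2(2-5)] 2(2)] 2(1) by simp
    qed
  qed
  show "{P. prime_two_sided_ideal (lpa G) P \<and> lpa_graded_ideal G P} \<subseteq> X1 \<union> X2"
  proof
    fix P :: "('v, 'e, 'k) lpa_elem set"
    assume "P \<in> {P. prime_two_sided_ideal (lpa G) P \<and> lpa_graded_ideal G P}"
    then have prime: "prime_two_sided_ideal (lpa G) P" and graded: "lpa_graded_ideal G P" by auto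
    have P: "two_sided_ideal (lpa G) P" using prime by (simp add: prime_two_sided_ideal_def)
    have eq: "P = push (lift P)" using push_lift[OF two_sided_ideal_subset[OF P]] by simp
    have lp: "prime_lpa_ideal G (lift P)" using prime prime_lift_iff[OF P] by simp
    have lg: "graded (lift P)" using graded graded_lift_iff[OF P] by simp
    show "P \<in> X1 \<union> X2"
      using lp lg
    proof (cases rule: graded_prime_cases)
      case (1 H)
      have "ideal_of_pair G H (breaking G H) = push (pair_ideal G H (breaking G H) :: ('v, 'e, 'k) gen_poly set)"
        by (rule ideal_of_pair_push) (use 1(1) in \<open>auto simp: hereditary_def\<close>)
      then have "P = ideal_of_pair G H (breaking G H)" using eq by (simp only: 1(4))
      then show ?thesis using 1 unfolding assms(2) by blast
    next
      case (2 H w)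
      have "ideal_of_pair G H (breaking G H - {w}) =
          push (pair_ideal G H (breaking G H - {w}) :: ('v, 'e, 'k) gen_poly set)"
        by (rule ideal_of_pair_push) (use 2(1) in \<open>auto simp: hereditary_def\<close>)
      then have "P = ideal_of_pair G H (breaking G H - {w})" using eq by (simp only: 2(5))
      then show ?thesis using 2 unfolding assms(3) by blast
    qed
  qed
qed

end
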